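(* Let $\Omega\subset\mathbb R^N$ be an open set with locally Lipschitz boundary. Let $\Psi\in C(\mathbb R^m,\mathbb R^{l\times N})$ satisfy $|\Psi(\psi)|\le C_0|\psi|^{p/2}$ for all $\psi\in\mathbb R^m$, for some constants $C_0>0$ and $p\ge1$. For every $\varepsilon>0$ let $E_\varepsilon:L^p(\Omega,\mathbb R^m)\to[0,+\infty)\cup\{+\infty\}$ be a functional, let $\delta_\varepsilon>0$ with $\lim_{\varepsilon\to0^+}\delta_\varepsilon=0$, and define $P_\varepsilon:L^p(\Omega,\mathbb R^m)\to[0,+\infty]$ by $$P_\varepsilon(\phi)=E_\varepsilon(\phi)+\frac1{\delta_\varepsilon}\int_{\mathbb R^N}\big|\nabla\bar H_{\Psi(\phi)}(x)\big|^2dx$$ and $Q_\varepsilon:L^p(\Omega,\mathbb R^m)\times L^2(\mathbb R^N,\mathbb R^{l\times N})\to[0,+\infty]$ by $$Q_\varepsilon(\phi,L)=\begin{cases}E_\varepsilon(\phi)+\frac1{\delta_\varepsilon}\int_{\mathbb R^N}\big|L(x)+\chi_\Omega(x)\Psi(\phi(x))\big|^2dx&\text{if }\mathrm{div}_xL\equiv0,\\+\infty&\text{otherwise.}\end{cases}$$ Then for every $\phi\in L^p(\Omega,\mathbb R^m)$ such that $\mathrm{div}_x\{\chi_\Omega\Psi(\phi)\}=0$ in $\mathbb R^N$ we have $$\inf\Big\{\liminf_{\varepsilon\to0^+}P_\varepsilon(\phi_\varepsilon):\phi_\varepsilon\to\phi\text{ in }L^p(\Omega,\mathbb R^m)\Big\}=\inf\Big\{\liminf_{\varepsilon\to0^+}Q_\varepsilon(\phi_\varepsilon,L_\varepsilon):\phi_\varepsilon\to\phi\text{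 in }L^p(\Omega,\mathbb R^m),\ L_\varepsilon\to-\chi_\Omega\Psi(\phi)\text{ in }L^2(\mathbb R^N,\mathbb R^{l\times N})\Big\}$$ and $$\inf\Big\{\limsup_{\varepsilon\to0^+}P_\varepsilon(\phi_\varepsilon):\phi_\varepsilon\to\phi\text{ in }L^p(\Omega,\mathbb R^m)\Big\}=\inf\Big\{\limsup_{\varepsilon\to0^+}Q_\varepsilon(\phi_\varepsilon,L_\varepsilon):\phi_\varepsilon\to\phi\text{ in }L^p(\Omega,\mathbb R^m),\ L_\varepsilon\to-\chi_\Omega\Psi(\phi)\text{ in }L^2(\mathbb R^N,\mathbb R^{l\times N})\Big\}.$$
   Context: $\chi_\Omega$ is the characteristic function of $\Omega$; the divergence of an $l\times N$ matrix field is taken row-wise, in the sense of distributions. For $\phi\in L^p(\Omega,\mathbb R^m)$, $\bar H_{\Psi(\phi)}:\mathbb R^N\to\mathbb R^l$ is defined by $\Delta_x\bar H_{\Psi(\phi)}=\mathrm{div}_x\{\chi_\Omega\Psi(\phi)\}$ in $\mathbb R^N$ and $\nabla_x\bar H_{\Psi(\phi)}\in L^2(\mathbb R^N,\mathbb R^{l\times N})$. The infima are over families indexed by $\varepsilon>0$ converging as $\varepsilon\to0^+$. *)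

theory Defs
  imports "HOL-Analysis.Analysis"
begin

(* \<Omega> is, near each boundary point and in suitable orthonormal coordinates, the strict
   subgraph of a Lipschitz function of N - 1 variables: \<nu> is the vertical direction, and
   x - (x \<bullet> \<nu>) \<nu> are the remaining coordinates, ranging over the hyperplane orthogonal to \<nu>. *)
definition locally_lipschitz_boundary :: "(real^'n) set \<Rightarrow> bool" where
  "locally_lipschitz_boundary \<Omega> \<longleftrightarrow>
     (\<forall>x0 \<in> frontier \<Omega>. \<exists>r>0. \<exists>\<nu>. \<exists>g. \<exists>C. norm \<nu> = 1 \<and>
        C-lipschitz_on {y. y \<bullet> \<nu> = 0} g \<and>
        \<Omega> \<inter> ball x0 r = {x \<in> ball x0 r. x \<bullet> \<nu> < g (x - (x \<bullet> \<nu>) *\<^sub>R \<nu>)})"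


subsection \<open>Lebesgue spaces\<close>

(* Elements are represented by functions rather than by almost-everywhere classes.  For the
   measure lebesgue_on \<Omega> the values outside \<Omega> are irrelevant. *)
definition Lp_space :: "real \<Rightarrow> 'a measure \<Rightarrow> ('a \<Rightarrow> 'b::euclidean_space) set" where
  "Lp_space p M = {f \<in> borel_measurable M. integrable M (\<lambda>x. norm (f x) powr p)}"

definition Lp_norm :: "real \<Rightarrow> 'a measure \<Rightarrow> ('a \<Rightarrow> 'b::euclidean_space) \<Rightarrow> real" where
  "Lp_norm p M f = (LINT x|M. norm (f x) powr p) powr (1 / p)"

(* Strong convergence in L^p as \<epsilon> \<rightarrow> 0+ of a family of elements of L^p indexed by \<epsilon> > 0. *)
definition Lp_family_converges ::
    "real \<Rightarrow> 'a measure \<Rightarrow> (real \<Rightarrow> 'a \<Rightarrow> 'b::euclidean_space) \<Rightarrow> ('a \<Rightarrow> 'b) \<Rightarrow> bool" where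
  "Lp_family_converges p M f g \<longleftrightarrow>
     (\<forall>\<epsilon>>0. f \<epsilon> \<in> Lp_space p M) \<and> g \<in> Lp_space p M \<and>
     ((\<lambda>\<epsilon>. Lp_norm p M (\<lambda>x. f \<epsilon> x - g x)) \<longlongrightarrow> 0) (at_right 0)"

definition locally_integrable :: "(real^'n \<Rightarrow> 'b::euclidean_space) \<Rightarrow> bool" where
  "locally_integrable f \<longleftrightarrow> (\<forall>K. compact K \<longrightarrow> set_integrable lebesgue K f)"


subsection \<open>Test functions and distributional derivatives\<close>

definition partial_deriv :: "'n \<Rightarrow> (real^'n \<Rightarrow> real) \<Rightarrow> real^'n \<Rightarrow> real" where
  "partial_deriv j f x = frechet_derivative f (at x) (axis j 1)"

fun Ck :: "nat \<Rightarrow> (real^'n \<Rightarrow> real) \<Rightarrow> bool" where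
  "Ck 0 f \<longleftrightarrow> continuous_on UNIV f"
| "Ck (Suc k) f \<longleftrightarrow> (\<forall>x. f differentiable (at x)) \<and> (\<forall>j. Ck k (partial_deriv j f))"

definition test_functions :: "(real^'n \<Rightarrow> real) set" where
  "test_functions = {\<zeta>. (\<forall>k. Ck k \<zeta>) \<and> compact (closure {x. \<zeta> x \<noteq> 0})}"

definition gradient :: "(real^'n \<Rightarrow> real) \<Rightarrow> real^'n \<Rightarrow> real^'n" where
  "gradient \<zeta> x = (\<chi> j. partial_deriv j \<zeta> x)"

definition laplacian :: "(real^'n \<Rightarrow> real) \<Rightarrow> real^'n \<Rightarrow> real" where
  "laplacian \<zeta> x = (\<Sum>j\<in>UNIV. partial_deriv j (partial_deriv j \<zeta>) x)"

(* The row-wise distributional divergence of an l \<times> N matrix field F, as an R^l-valued functional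
   on test functions: component i is - \<integral> \<Sum>j. F_ij \<partial>_j \<zeta>. *)
definition distr_div :: "(real^'n \<Rightarrow> real^'n^'l) \<Rightarrow> (real^'n \<Rightarrow> real) \<Rightarrow> real^'l" where
  "distr_div F \<zeta> = - (LINT x|lebesgue. F x *v gradient \<zeta> x)"

definition distr_laplacian :: "(real^'n \<Rightarrow> real^'l) \<Rightarrow> (real^'n \<Rightarrow> real) \<Rightarrow> real^'l" where
  "distr_laplacian H \<zeta> = (LINT x|lebesgue. laplacian \<zeta> x *\<^sub>R H x)"

definition div_free :: "(real^'n \<Rightarrow> real^'n^'l) \<Rightarrow> bool" where
  "div_free F \<longleftrightarrow> (\<forall>\<zeta>\<in>test_functions. distr_div F \<zeta> = 0)"

definition has_weak_gradient :: "(real^'n \<Rightarrow> real^'l) \<Rightarrow> (real^'n \<Rightarrow> real^'n^'l) \<Rightarrow> bool" where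
  "has_weak_gradient H G \<longleftrightarrow> locally_integrable H \<and> locally_integrable G \<and>
     (\<forall>\<zeta>\<in>test_functions. \<forall>i j.
        (LINT x|lebesgue. \<zeta> x * G x $ i $ j) = - (LINT x|lebesgue. partial_deriv j \<zeta> x * H x $ i))"

(* A representative; the weak gradient is unique up to null sets. *)
definition weak_gradient :: "(real^'n \<Rightarrow> real^'l) \<Rightarrow> real^'n \<Rightarrow> real^'n^'l" where
  "weak_gradient H = (SOME G. has_weak_gradient H G)"


subsection \<open>The potential and the functionals\<close>

(* \<Delta>H = div F in the sense of distributions on R^N, with weak gradient of H in L^2. *)
definition is_potential :: "(real^'n \<Rightarrow> real^'n^'l) \<Rightarrow> (real^'n \<Rightarrow> real^'l) \<Rightarrow> bool" where
  "is_potential F H \<longleftrightarrow> locally_integrable H \<and>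
     (\<forall>\<zeta>\<in>test_functions. distr_laplacian H \<zeta> = distr_div F \<zeta>) \<and>
     (\<exists>G \<in> Lp_space 2 lebesgue. has_weak_gradient H G)"

(* For F in L^2 a potential exists and is determined up to an additive constant, so that only its
   gradient is canonical. *)
definition Hbar :: "(real^'n \<Rightarrow> real^'n^'l) \<Rightarrow> real^'n \<Rightarrow> real^'l" where
  "Hbar F = (SOME H. is_potential F H)"

definition cut_field ::
    "(real^'n) set \<Rightarrow> (real^'m \<Rightarrow> real^'n^'l) \<Rightarrow> (real^'n \<Rightarrow> real^'m) \<Rightarrow> real^'n \<Rightarrow> real^'n^'l" where
  "cut_field \<Omega> \<Psi> \<phi> x = indicat_real \<Omega> x *\<^sub>R \<Psi> (\<phi> x)"

definition P_functional ::
    "(real^'n) set \<Rightarrow> (real^'m \<Rightarrow> real^'n^'l) \<Rightarrow> (real \<Rightarrow> (real^'n \<Rightarrow> real^'m) \<Rightarrow> ennreal) \<Rightarrow>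
     (real \<Rightarrow> real) \<Rightarrow> real \<Rightarrow> (real^'n \<Rightarrow> real^'m) \<Rightarrow> ennreal" where
  "P_functional \<Omega> \<Psi> E \<delta> \<epsilon> \<phi> =
     E \<epsilon> \<phi> + ennreal (1 / \<delta> \<epsilon>) *
       (\<integral>\<^sup>+x. ennreal ((norm (weak_gradient (Hbar (cut_field \<Omega> \<Psi> \<phi>)) x))\<^sup>2) \<partial>lebesgue)"

definition Q_functional ::
    "(real^'n) set \<Rightarrow> (real^'m \<Rightarrow> real^'n^'l) \<Rightarrow> (real \<Rightarrow> (real^'n \<Rightarrow> real^'m) \<Rightarrow> ennreal) \<Rightarrow>
     (real \<Rightarrow> real) \<Rightarrow> real \<Rightarrow> (real^'n \<Rightarrow> real^'m) \<Rightarrow> (real^'n \<Rightarrow> real^'n^'l) \<Rightarrow> ennreal" where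
  "Q_functional \<Omega> \<Psi> E \<delta> \<epsilon> \<phi> L =
     (if div_free L
      then E \<epsilon> \<phi> + ennreal (1 / \<delta> \<epsilon>) *
        (\<integral>\<^sup>+x. ennreal ((norm (L x + cut_field \<Omega> \<Psi> \<phi> x))\<^sup>2) \<partial>lebesgue)
      else \<infinity>)"

end

(* Write F = cut_field \<Omega> \<Psi> \<phi> and G = weak_gradient (Hbar F).  Since div G = div F, the field G - F is
   divergence free and Q(\<phi>, G - F) = P(\<phi>).  Conversely, G has the least L2 norm among all fields with
   the divergence of F, so P(\<phi>) \<le> Q(\<phi>, L) whenever div L = 0.

   Recovery families: where P_\<epsilon>(\<phi>_\<epsilon>) is below a fixed finite bound b one has |G_\<epsilon>|^2 \<le> b \<delta>_\<epsilon>, so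
   L_\<epsilon> = G_\<epsilon> - F_\<epsilon> converges to -F in L2 along these \<epsilon>, because F_\<epsilon> tends to F.  For the remaining \<epsilon>
   take L_\<epsilon> = -F, which is harmless for the lower and upper limits as soon as b exceeds them.

   The gradient G is the L2 limit of a minimizing sequence of \<integral> |F - grad z|^2 over test functions z; a
   Poincare inequality makes z minus its average over the unit ball converge locally in L1, which gives
   the potential.  Two potentials have the same gradient by Liouville's theorem for weakly harmonic
   functions in L2. *)
theory Submission
  imports Defs
begin

text \<open>Two steps rest on integrals over balls. A locally integrable function whose integral
  over every ball vanishes is zero almost everywhere, and bumps built from exp(-c/t) tend to the
  indicator of a ball as c tends to 0. This gives uniqueness of weak gradients, and also Liouville's
  theorem once the bumps are dilated: the derivative in the scale is the Laplacian of an explicit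
  test function, and square integrability sends the integral to 0 as the bump spreads out. The
  minimizing sequence is chosen with error 16^-n. Consecutive gradients then differ by a multiple of
  4^-n in L2, fast enough for almost everywhere convergence by telescoping; Fatou's lemma gives the
  L2 bound for the limit. \<open>Hbar\<close> and \<open>weak_gradient\<close> are arbitrary
  choices, so every property of the constructed gradient has to be carried over to them by
  uniqueness. Families are indexed by real \<epsilon> while dominated convergence concerns
  sequences, so the continuity of F in \<phi> is proved by contradiction along rapidly converging
  sequences.\<close>

section \<open>Calculus of k times continuously differentiable functions\<close>

lemma partial_deriv_eqI:
  "(f has_derivative f') (at x) \<Longrightarrow> partial_deriv j f x = f' (axis j 1)"
  unfolding partial_deriv_def by (metis frechet_derivative_at)

lemma Ck_continuous: "Ck k f \<Longrightarrow> continuous_on UNIV f"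
  by (cases k) (auto intro!: differentiable_imp_continuous_on simp: differentiable_on_def differentiable_at_withinI)

lemma Ck_SucD: "Ck (Suc k) f \<Longrightarrow> Ck k f"
proof (induction k arbitrary: f)
  case 0
  then show ?case using Ck_continuous[of "Suc 0" f] by simp
next
  case (Suc k)
  then show ?case by (metis Ck.simps(2))
qed

lemma Ck_const: "Ck k (\<lambda>x :: real^'n. c)"
proof (induction k arbitrary: c)
  case (Suc k)
  have "partial_deriv j (\<lambda>x :: real^'n. c) = (\<lambda>x. 0)" for j
    by (rule ext, rule partial_deriv_eqI) (auto intro!: derivative_eq_intros)
  then show ?case using Suc by auto
qed auto

lemma partial_deriv_add:
  assumes "\<And>x. f differentiable (at x)" "\<And>x. g differentiable (at x)"
  shows "partial_deriv j (\<lambda>x. f x + g x) = (\<lambda>x. partial_deriv j f x + partial_deriv j g x)"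
proof
  fix x
  show "partial_deriv j (\<lambda>x. f x + g x) x = partial_deriv j f x + partial_deriv j g x"
    unfolding partial_deriv_def[of j f] partial_deriv_def[of j g]
    by (rule partial_deriv_eqI) (intro has_derivative_add assms[unfolded frechet_derivative_works])
qed

lemma partial_deriv_mult:
  assumes "\<And>x. f differentiable (at x)" "\<And>x. g differentiable (at x)"
  shows "partial_deriv j (\<lambda>x. f x * g x) = (\<lambda>x. f x * partial_deriv j g x + partial_deriv j f x * g x)"
proof
  fix x
  show "partial_deriv j (\<lambda>x. f x * g x) x = f x * partial_deriv j g x + partial_deriv j f x * g x"
    unfolding partial_deriv_def[of j f] partial_deriv_def[of j g]
    by (rule partial_deriv_eqI) (intro has_derivative_mult assms[unfolded frechet_derivative_works])
qed

lemma Ck_add: "Ck k f \<Longrightarrow> Ck k g \<Longrightarrow> Ck k (\<lambda>x. f x + g x)"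
proof (induction k arbitrary: f g)
  case 0
  then show ?case by (auto intro!: continuous_intros)
next
  case (Suc k)
  then show ?case by (auto simp: partial_deriv_add)
qed

lemma Ck_mult: "Ck k f \<Longrightarrow> Ck k g \<Longrightarrow> Ck k (\<lambda>x. f x * g x)"
proof (induction k arbitrary: f g)
  case 0
  then show ?case by (auto intro!: continuous_intros)
next
  case (Suc k)
  have "Ck k f" "Ck k g"
    using Suc.prems Ck_SucD by blast+
  with Suc show ?case by (auto simp: partial_deriv_mult intro!: Ck_add)
qed

lemma Ck_component: "Ck k (\<lambda>x::real^'n. x $ i)"
proof (cases k)
  case 0
  then show ?thesis by (auto intro!: continuous_intros)
next
  case (Suc l)
  have d: "((\<lambda>x::real^'n. x $ i) has_derivative (\<lambda>h. h $ i)) (at x)" for x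
    by (rule bounded_linear.has_derivative[OF bounded_linear_vec_nth]) simp
  then have "(\<lambda>x::real^'n. x $ i) differentiable (at x)" for x
    unfolding differentiable_def by blast
  moreover have "partial_deriv j (\<lambda>x::real^'n. x $ i) = (\<lambda>x. axis j 1 $ i)" for j
    by (rule ext, rule partial_deriv_eqI[OF d])
  ultimately show ?thesis using Suc Ck_const by auto
qed

subsection \<open>Smooth bumps\<close>

text \<open>The polynomial in 1/t makes the family closed under differentiation, so smoothness
  follows by one induction over all members. The rate \<open>c\<close> stays a parameter because it
  is later sent to 0.\<close>

definition exp_bump :: "real \<Rightarrow> real poly \<Rightarrow> real \<Rightarrow> real" where
  "exp_bump c p t = (if t \<le> 0 then 0 else poly p (1 / t) * exp (- (c / t)))"

text \<open>The derivative of p(1/t) exp(-c/t) is (1/t^2) (c p(1/t) - p'(1/t)) exp(-c/t); the factor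
  \<open>[:0, 0, 1:]\<close> is 1/t^2 read as a polynomial in 1/t.\<close>

definition bump_deriv :: "real \<Rightarrow> real poly \<Rightarrow> real poly" where
  "bump_deriv c p = [:0, 0, 1:] * (smult c p - pderiv p)"

lemma poly_times_exp_tendsto_0:
  assumes "c > 0"
  shows "((\<lambda>x::real. poly p x * exp (- (c * x))) \<longlongrightarrow> 0) at_top"
proof -
  have 1: "((\<lambda>x. x ^ k * exp (- (c * x))) \<longlongrightarrow> 0) at_top" for k
  proof -
    have "((\<lambda>x. (c * x) ^ k / exp (c * x)) \<longlongrightarrow> 0) at_top"
      by (rule filterlim_compose[OF tendsto_power_div_exp_0])
         (use assms in \<open>auto intro!: filterlim_tendsto_pos_mult_at_top filterlim_ident\<close>)
    then have "((\<lambda>x. (1 / c ^ k) * ((c * x) ^ k / exp (c * x))) \<longlongrightarrow> (1 / c ^ k) * 0) at_top"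
      by (intro tendsto_intros)
    then show ?thesis using assms by (simp add: power_mult_distrib exp_minus field_simps)
  qed
  have "((\<lambda>x. \<Sum>i\<le>degree p. coeff p i * (x ^ i * exp (- (c * x)))) \<longlongrightarrow> (\<Sum>i\<le>degree p. coeff p i * 0)) at_top"
    by (intro tendsto_intros 1)
  then show ?thesis by (simp add: poly_altdef sum_distrib_right mult.assoc)
qed

lemma exp_bump_tendsto_0:
  assumes "c > 0"
  shows "(exp_bump c p \<longlongrightarrow> 0) (at 0)"
proof -
  have "((\<lambda>t. poly p (1 / t) * exp (- (c * (1 / t)))) \<longlongrightarrow> 0) (at_right 0)"
    by (rule filterlim_compose[OF poly_times_exp_tendsto_0[OF assms]])
       (simp add: divide_inverse filterlim_inverse_at_top_right)
  then have "(exp_bump c p \<longlongrightarrow> 0) (at_right 0)"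
    by (rule Lim_transform_eventually) (auto simp: exp_bump_def eventually_at_filter)
  moreover have "(exp_bump c p \<longlongrightarrow> 0) (at_left 0)"
    by (rule Lim_transform_eventually[OF tendsto_const]) (auto simp: exp_bump_def eventually_at_filter)
  ultimately show ?thesis by (simp add: filterlim_split_at)
qed

lemma DERIV_exp_bump:
  assumes "c > 0"
  shows "(exp_bump c p has_real_derivative exp_bump c (bump_deriv c p) t) (at t)"
proof -
  consider "t < 0" | "t = 0" | "t > 0" by linarith
  then show ?thesis
  proof cases
    case 1
    show ?thesis
      by (rule has_field_derivative_transform_within[where f = "\<lambda>x. 0" and d = "- t"])
         (use 1 in \<open>auto simp: exp_bump_def dist_real_def intro!: derivative_eq_intros\<close>)
  next
    case 2
    \<comment> \<open>The difference quotient at 0 belongs to the same family, with the polynomial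
      multiplied by its variable, so its limit is already known.\<close>
    have "(\<lambda>h. (exp_bump c p (0 + h) - exp_bump c p 0) / h) = exp_bump c ([:0, 1:] * p)"
      by (auto simp: exp_bump_def fun_eq_iff)
    then show ?thesis
      using 2 exp_bump_tendsto_0[OF assms, of "[:0, 1:] * p"]
      by (simp add: DERIV_def) (simp add: exp_bump_def)
  next
    case 3
    have "((\<lambda>t. poly p (1 / t) * exp (- (c / t))) has_real_derivative
       poly p (1 / t) * (exp (- (c / t)) * (c / t^2)) + (poly (pderiv p) (1 / t) * (- 1 / t^2)) * exp (- (c / t))) (at t)"
      using 3 by (auto intro!: derivative_eq_intros DERIV_chain2[OF poly_DERIV] simp: power2_eq_square field_simps)
    moreover have "poly p (1 / t) * (exp (- (c / t)) * (c / t^2)) + (poly (pderiv p) (1 / t) * (- 1 / t^2)) * exp (- (c / t)) = exp_bump c (bump_deriv c p) t"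
      using 3 by (simp add: exp_bump_def bump_deriv_def field_simps power2_eq_square)
    ultimately have "((\<lambda>t. poly p (1 / t) * exp (- (c / t))) has_real_derivative exp_bump c (bump_deriv c p) t) (at t)"
      by simp
    then show ?thesis
      by (rule has_field_derivative_transform_within[where d = t])
         (use 3 in \<open>auto simp: exp_bump_def dist_real_def\<close>)
  qed
qed

lemma continuous_on_exp_bump: "c > 0 \<Longrightarrow> continuous_on UNIV (exp_bump c p)"
  by (meson DERIV_exp_bump DERIV_isCont continuous_at_imp_continuous_on)

text \<open>A quadratic polynomial, positive exactly on the ball of radius 1/s about
  \<open>y\<close> when s > 0. The radius enters through its reciprocal because bumps will be
  differentiated in the scale \<open>s\<close>.\<close>

definition cap :: "real \<Rightarrow> real^'n \<Rightarrow> real^'n \<Rightarrow> real" where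
  "cap s y x = 1 - s^2 * ((x - y) \<bullet> (x - y))"

lemma cap_has_derivative:
  "(cap s y has_derivative (\<lambda>h. - 2 * s^2 * ((x - y) \<bullet> h))) (at x)"
  unfolding cap_def[abs_def]
  by (auto intro!: derivative_eq_intros simp: fun_eq_iff inner_commute algebra_simps)

lemma exp_bump_cap_has_derivative:
  assumes "c > 0"
  shows "((\<lambda>x. exp_bump c p (cap s y x)) has_derivative
     (\<lambda>h. exp_bump c (bump_deriv c p) (cap s y x) * (- 2 * s^2 * ((x - y) \<bullet> h)))) (at x)"
  using has_derivative_compose[OF cap_has_derivative DERIV_exp_bump[OF assms, unfolded has_field_derivative_def]]
  by (simp add: mult.assoc)

lemma partial_deriv_exp_bump_cap:
  assumes "c > 0"
  shows "partial_deriv j (\<lambda>x. exp_bump c p (cap s y x))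
     = (\<lambda>x. exp_bump c (bump_deriv c p) (cap s y x) * (- 2 * s^2 * (x - y) $ j))"
  by (rule ext) (simp add: partial_deriv_eqI[OF exp_bump_cap_has_derivative[OF assms]] inner_axis)

lemma Ck_affine: "Ck k (\<lambda>x. a * (x - y) $ j)"
proof -
  have "Ck k (\<lambda>x. a * x $ j + - a * y $ j)"
    by (intro Ck_add Ck_mult Ck_const Ck_component)
  then show ?thesis by (simp add: algebra_simps)
qed

text \<open>A partial derivative is another member of the family times an affine function. Hence the
  induction runs over \<open>k\<close> with the polynomial left arbitrary.\<close>

lemma Ck_exp_bump_cap: "c > 0 \<Longrightarrow> Ck k (\<lambda>x. exp_bump c p (cap s y x))"
proof (induction k arbitrary: p)
  case 0
  have "continuous_on UNIV (\<lambda>x. exp_bump c p (cap s y x))"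
    by (rule continuous_on_compose2[OF continuous_on_exp_bump[OF 0]])
       (auto simp: cap_def[abs_def] intro!: continuous_intros)
  then show ?case by simp
next
  case (Suc k)
  have "(\<lambda>x. exp_bump c p (cap s y x)) differentiable (at x)" for x
    using exp_bump_cap_has_derivative[OF Suc.prems] unfolding differentiable_def by blast
  then show ?case
    using Ck_mult[OF Suc.IH Ck_affine] Suc.prems
    by (auto simp only: Ck.simps partial_deriv_exp_bump_cap)
qed

lemma cap_pos_iff:
  assumes "s > 0"
  shows "cap s y x > 0 \<longleftrightarrow> x \<in> ball y (1 / s)"
proof -
  have "cap s y x > 0 \<longleftrightarrow> (s * norm (x - y))^2 < 1"
    by (simp add: cap_def power2_norm_eq_inner power_mult_distrib)
  also have "\<dots> \<longleftrightarrow> s * norm (x - y) < 1"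
    using assms by (simp add: abs_square_less_1 abs_mult)
  finally show ?thesis using assms by (simp add: dist_norm norm_minus_commute field_simps)
qed

lemma exp_bump_cap_eq_0: "s > 0 \<Longrightarrow> x \<notin> ball y (1 / s) \<Longrightarrow> exp_bump c p (cap s y x) = 0"
  using cap_pos_iff[of s y x] by (auto simp: exp_bump_def)

section \<open>Closure properties of test functions\<close>

lemma test_functionsI:
  assumes "\<And>k. Ck k f" "\<And>x. x \<notin> ball y r \<Longrightarrow> f x = 0"
  shows "f \<in> test_functions"
proof -
  have "{x. f x \<noteq> 0} \<subseteq> ball y r" using assms(2) by blast
  then show ?thesis
    using assms(1) bounded_subset[OF bounded_ball] by (auto simp: test_functions_def compact_closure)
qed

lemma exp_bump_cap_test: "c > 0 \<Longrightarrow> s > 0 \<Longrightarrow> (\<lambda>x. exp_bump c p (cap s y x)) \<in> test_functions"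
  by (rule test_functionsI[OF Ck_exp_bump_cap exp_bump_cap_eq_0])

lemma test_bounded_support:
  assumes "z \<in> test_functions"
  obtains R where "R > 0" "\<And>x. x \<notin> ball 0 R \<Longrightarrow> z x = 0"
proof -
  have "bounded {x. z x \<noteq> 0}"
    using assms by (auto simp: test_functions_def compact_closure)
  then obtain R where "R > 0" "{x. z x \<noteq> 0} \<subseteq> ball 0 R"
    by (metis bounded_subset_ballD)
  then show ?thesis using that by blast
qed

lemma test_differentiable: "z \<in> test_functions \<Longrightarrow> z differentiable (at x)"
  using Ck.simps(2)[of 0 z] by (auto simp: test_functions_def)

lemma test_has_derivative:
  assumes "z \<in> test_functions"
  shows "(z has_derivative (\<lambda>h. gradient z x \<bullet> h)) (at x)"
proof -
  have d: "(z has_derivative frechet_derivative z (at x)) (at x)"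
    using test_differentiable[OF assms] frechet_derivative_works by blast
  then interpret L: bounded_linear "frechet_derivative z (at x)"
    by (rule has_derivative_bounded_linear)
  have "frechet_derivative z (at x) h = gradient z x \<bullet> h" for h
  proof -
    have "frechet_derivative z (at x) h = frechet_derivative z (at x) (\<Sum>j\<in>UNIV. h $ j *\<^sub>R axis j 1)"
      by (simp add: basis_expansion scalar_mult_eq_scaleR[symmetric])
    also have "\<dots> = gradient z x \<bullet> h"
      by (simp add: L.sum L.scaleR gradient_def partial_deriv_def inner_vec_def mult.commute)
    finally show ?thesis .
  qed
  then show ?thesis using d by presburger
qed

lemma test_continuous: "z \<in> test_functions \<Longrightarrow> continuous_on UNIV z"
  using Ck_continuous by (auto simp: test_functions_def)

lemma test_partial:
  assumes "z \<in> test_functions"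
  shows "partial_deriv j z \<in> test_functions"
proof -
  obtain R where R: "R > 0" "\<And>x. x \<notin> ball 0 R \<Longrightarrow> z x = 0"
    using test_bounded_support[OF assms] by blast
  \<comment> \<open>Enlarging the radius by 1 leaves a unit ball around \<open>x\<close> on which
    \<open>z\<close> vanishes, so the derivative there is that of the zero function.\<close>
  have "partial_deriv j z x = 0" if "x \<notin> ball 0 (R + 1)" for x
  proof (rule partial_deriv_eqI)
    have "ball x 1 \<inter> ball 0 R = {}"
    proof -
      have "dist x 0 \<ge> R + 1" using that by (simp add: dist_commute)
      then show ?thesis by (simp add: disjoint_ballI)
    qed
    then have "z y = 0" if "dist y x < 1" for y
      using that R(2)[of y] by (metis IntI dist_commute empty_iff mem_ball)
    then show "(z has_derivative (\<lambda>h. 0)) (at x)"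
      by (intro has_derivative_transform_within[OF has_derivative_const[of 0], of 1]) auto
  qed
  moreover have "Ck k (partial_deriv j z)" for k
    using assms Ck.simps(2)[of k z] by (auto simp: test_functions_def)
  ultimately show ?thesis by (rule test_functionsI[rotated])
qed

lemma test_mult:
  assumes "z \<in> test_functions" "\<And>k. Ck k f"
  shows "(\<lambda>x. f x * z x) \<in> test_functions"
proof -
  obtain R where R: "R > 0" "\<And>x. x \<notin> ball 0 R \<Longrightarrow> z x = 0"
    using test_bounded_support[OF assms(1)] by blast
  show ?thesis
    by (rule test_functionsI[of _ 0 R]) (use R assms in \<open>auto simp: test_functions_def intro!: Ck_mult\<close>)
qed

lemma test_add:
  assumes "z \<in> test_functions" "f \<in> test_functions"
  shows "(\<lambda>x. f x + z x) \<in> test_functions"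
proof -
  obtain R where R: "R > 0" "\<And>x. x \<notin> ball 0 R \<Longrightarrow> z x = 0"
    using test_bounded_support[OF assms(1)] by blast
  obtain S where S: "S > 0" "\<And>x. x \<notin> ball 0 S \<Longrightarrow> f x = 0"
    using test_bounded_support[OF assms(2)] by blast
  show ?thesis
    by (rule test_functionsI[of _ 0 "max R S"]) (use R S assms in \<open>auto simp: test_functions_def intro!: Ck_add\<close>)
qed

lemma test_scale: "z \<in> test_functions \<Longrightarrow> (\<lambda>x. a * z x) \<in> test_functions"
  by (intro test_mult Ck_const)

lemma gradient_add_scale:
  assumes "z \<in> test_functions" "f \<in> test_functions"
  shows "gradient (\<lambda>x. f x + a * z x) x = gradient f x + a *\<^sub>R gradient z x"
proof -
  have "((\<lambda>x. f x + a * z x) has_derivative (\<lambda>h. (gradient f x + a *\<^sub>R gradient z x) \<bullet> h)) (at x)"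
    by (auto intro!: derivative_eq_intros test_has_derivative assms simp: inner_add_left)
  then show ?thesis
    by (simp add: vec_eq_iff gradient_def partial_deriv_eqI inner_axis)
qed

lemma test_integrable_lborel:
  assumes "z \<in> test_functions"
  shows "integrable lborel z"
proof -
  obtain R where R: "R > 0" "\<And>x. x \<notin> ball 0 R \<Longrightarrow> z x = 0"
    using test_bounded_support[OF assms] by blast
  have "integrable lborel (\<lambda>x. indicator (cball 0 R) x *\<^sub>R z x)"
    by (rule borel_integrable_compact) (auto intro: continuous_on_subset[OF test_continuous[OF assms]])
  moreover have "(\<lambda>x. indicator (cball 0 R) x *\<^sub>R z x) = z"
    using R(2) by (auto simp: indicator_def fun_eq_iff)
  ultimately show ?thesis by simp
qed

lemma test_integrable: "z \<in> test_functions \<Longrightarrow> integrable lebesgue z"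
  by (metis test_integrable_lborel integrable_completion borel_measurable_integrable)

lemma test_bounded:
  assumes "z \<in> test_functions"
  obtains B where "B > 0" "\<And>x. \<bar>z x\<bar> \<le> B"
proof -
  obtain R where R: "R > 0" "\<And>x. x \<notin> ball 0 R \<Longrightarrow> z x = 0"
    using test_bounded_support[OF assms] by blast
  have "compact (z ` cball 0 R)"
    by (rule compact_continuous_image) (auto intro: continuous_on_subset[OF test_continuous[OF assms]])
  then obtain B where B: "B > 0" "\<And>x. x \<in> cball 0 R \<Longrightarrow> norm (z x) \<le> B"
    by (metis bounded_pos compact_imp_bounded imageI)
  have "\<bar>z x\<bar> \<le> B" for x
    using B(1) B(2)[of x] R(2)[of x] by (cases "x \<in> ball 0 R") auto
  with B(1) show ?thesis by (rule that)
qed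

subsection \<open>Integrals of test functions\<close>

lemma integral_lborel_translate:
  fixes f :: "real^'n \<Rightarrow> real"
  assumes [measurable]: "f \<in> borel_measurable borel"
  shows "(LINT x|lborel. f (h + x)) = (LINT x|lborel. f x)"
  by (subst (2) lborel_distr_plus[of h, symmetric], subst integral_distr) auto

lemma nn_integral_lborel_translate:
  fixes f :: "real^'n \<Rightarrow> ennreal"
  assumes [measurable]: "f \<in> borel_measurable borel"
  shows "(\<integral>\<^sup>+x. f (h + x) \<partial>lborel) = (\<integral>\<^sup>+x. f x \<partial>lborel)"
  by (subst (2) lborel_distr_plus[of h, symmetric], subst nn_integral_distr) auto

lemma test_measurable: "z \<in> test_functions \<Longrightarrow> z \<in> borel_measurable borel"
  by (rule borel_measurable_continuous_onI[OF test_continuous])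

lemma gradient_continuous: "z \<in> test_functions \<Longrightarrow> continuous_on UNIV (gradient z)"
  unfolding gradient_def[abs_def]
  by (intro continuous_on_vec_lambda test_continuous test_partial)

lemma gradient_measurable: "z \<in> test_functions \<Longrightarrow> gradient z \<in> borel_measurable borel"
  by (rule borel_measurable_continuous_onI[OF gradient_continuous])

lemma integral_lebesgue_lborel:
  fixes f :: "real^'n \<Rightarrow> 'b::euclidean_space"
  shows "f \<in> borel_measurable borel \<Longrightarrow> (LINT x|lebesgue. f x) = (LINT x|lborel. f x)"
  by (intro integral_completion) simp

lemma test_DERIV_line:
  assumes "z \<in> test_functions"
  shows "((\<lambda>t. z (y + t *\<^sub>R h)) has_real_derivative gradient z (y + t *\<^sub>R h) \<bullet> h) (at t)"
proof -
  have "((\<lambda>t. y + t *\<^sub>R h) has_derivative (\<lambda>u. u *\<^sub>R h)) (at t)"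
    by (auto intro!: derivative_eq_intros)
  from has_derivative_compose[OF this test_has_derivative[OF assms]]
  show ?thesis by (simp add: has_field_derivative_def mult.commute[of _ "_ \<bullet> _"])
qed

lemma gradient_axis: "gradient z x \<bullet> axis j 1 = partial_deriv j z x"
  by (simp add: gradient_def inner_axis)

text \<open>Difference quotients have integral 0 by translation invariance of Lebesgue measure. They
  are bounded by the maximum of the derivative on a fixed ball and vanish outside it, so the
  integral of their limit is 0 as well.\<close>

lemma integral_partial_deriv_eq_0:
  assumes z: "z \<in> test_functions"
  shows "(LINT x|lebesgue. partial_deriv j z x) = 0"
proof -
  obtain R where R: "R > 0" "\<And>x. x \<notin> ball 0 R \<Longrightarrow> z x = 0"
    using test_bounded_support[OF z] by blast
  obtain B where B: "B > 0" "\<And>x. \<bar>partial_deriv j z x\<bar> \<le> B"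
    using test_bounded[OF test_partial[OF z]] by blast
  define e :: "real^'a" where "e = axis j 1"
  have ne: "norm e = 1" by (simp add: e_def)
  define d where "d n x = (z (inverse (real (Suc n)) *\<^sub>R e + x) - z x) / inverse (real (Suc n))" for n x
  have [measurable]: "z \<in> borel_measurable borel" by (rule test_measurable[OF z])
  have dm[measurable]: "d n \<in> borel_measurable borel" for n
    unfolding d_def by measurable
  have d0: "(LINT x|lborel. d n x) = 0" for n
  proof -
    have "integrable lborel (\<lambda>x. z (inverse (real (Suc n)) *\<^sub>R e + x))"
      using test_integrable_lborel[OF z]
      by (subst (asm) lborel_distr_plus[of "inverse (real (Suc n)) *\<^sub>R e", symmetric])
         (subst (asm) integrable_distr_eq, auto)
    then show ?thesis
      unfolding d_def using test_integrable_lborel[OF z]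
      by (simp add: integral_lborel_translate)
  qed
  have bound: "norm (d n x) \<le> B * indicator (cball 0 (R + 1)) x" for n x
  proof (cases "x \<in> cball 0 (R + 1)")
    case True
    define h where "h = inverse (real (Suc n))"
    have h: "h > 0" by (simp add: h_def)
    \<comment> \<open>The mean value theorem bounds every quotient by \<open>B\<close>, uniformly in
      the step size.\<close>
    have "\<exists>t. 0 < t \<and> t < h \<and> z (x + h *\<^sub>R e) - z (x + 0 *\<^sub>R e) = (h - 0) * (gradient z (x + t *\<^sub>R e) \<bullet> e)"
      by (rule MVT2[OF h]) (rule test_DERIV_line[OF z])
    then obtain t where t: "z (x + h *\<^sub>R e) - z x = h * partial_deriv j z (x + t *\<^sub>R e)"
      by (auto simp: e_def gradient_axis)
    have "d n x = partial_deriv j z (x + t *\<^sub>R e)"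
      unfolding d_def h_def[symmetric] using t h by (simp add: add.commute)
    then show ?thesis using True B(2) by simp
  next
    case False
    \<comment> \<open>Steps have length at most 1: outside the ball of radius R + 1 both the point
      and its translate miss the support.\<close>
    have "inverse (real (Suc n)) \<le> 1" by (simp add: inverse_le_1_iff)
    then have "norm (inverse (real (Suc n)) *\<^sub>R e) \<le> 1" by (simp add: ne)
    then have "norm (inverse (real (Suc n)) *\<^sub>R e + x) \<ge> R"
      using False norm_triangle_ineq4[of "inverse (real (Suc n)) *\<^sub>R e + x" "inverse (real (Suc n)) *\<^sub>R e"] by simp
    then have "z (inverse (real (Suc n)) *\<^sub>R e + x) = 0" "z x = 0"
      using False by (auto intro!: R(2))
    then show ?thesis using False by (simp add: d_def)
  qed
  have lim: "(\<lambda>n. d n x) \<longlonglongrightarrow> partial_deriv j z x" for x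
  proof -
    have "((\<lambda>h. (z (x + (0 + h) *\<^sub>R e) - z (x + 0 *\<^sub>R e)) / h) \<longlongrightarrow> gradient z (x + 0 *\<^sub>R e) \<bullet> e) (at 0)"
      using test_DERIV_line[OF z, of x e 0] unfolding DERIV_def .
    then have "((\<lambda>h. (z (x + h *\<^sub>R e) - z x) / h) \<longlongrightarrow> partial_deriv j z x) (at 0)"
      by (simp add: e_def gradient_axis)
    moreover have "filterlim (\<lambda>n. inverse (real (Suc n))) (at 0) sequentially"
      using LIMSEQ_inverse_real_of_nat by (auto simp: filterlim_at)
    ultimately have "(\<lambda>n. (z (x + inverse (real (Suc n)) *\<^sub>R e) - z x) / inverse (real (Suc n))) \<longlonglongrightarrow> partial_deriv j z x"
      by (rule filterlim_compose)
    then show ?thesis by (simp add: d_def add.commute)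
  qed
  have "(\<lambda>n. LINT x|lborel. d n x) \<longlonglongrightarrow> (LINT x|lborel. partial_deriv j z x)"
  proof (rule integral_dominated_convergence[where w = "\<lambda>x. B * indicator (cball 0 (R + 1)) x"])
    show "partial_deriv j z \<in> borel_measurable lborel"
      using test_measurable[OF test_partial[OF z]] by simp
    show "integrable lborel (\<lambda>x::real^'a. B * indicator (cball 0 (R + 1)) x)"
      by (intro integrable_mult_right integrable_real_indicator) (use emeasure_lborel_cball_finite in auto)
  qed (use lim bound in auto)
  then have "(LINT x|lborel. partial_deriv j z x) = 0"
    by (simp add: d0 LIMSEQ_const_iff)
  then show ?thesis
    by (simp add: integral_lebesgue_lborel test_measurable test_partial z)
qed

text \<open>The derivative of the product of two test functions has integral 0; expand it by the
  Leibniz rule.\<close>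

lemma integration_by_parts_test:
  assumes z: "z \<in> test_functions" and f: "f \<in> test_functions"
  shows "(LINT x|lebesgue. f x * partial_deriv j z x) = - (LINT x|lebesgue. partial_deriv j f x * z x)"
proof -
  have Ck: "Ck k f" "Ck k (partial_deriv j f)" for k
    using f test_partial[OF f, of j] by (auto simp: test_functions_def)
  have "(LINT x|lebesgue. partial_deriv j (\<lambda>x. f x * z x) x) = 0"
    by (intro integral_partial_deriv_eq_0 test_mult z Ck)
  also have "partial_deriv j (\<lambda>x. f x * z x) = (\<lambda>x. f x * partial_deriv j z x + partial_deriv j f x * z x)"
    by (intro partial_deriv_mult test_differentiable f z)
  finally show ?thesis
    using test_integrable[OF test_mult[OF test_partial[OF z] Ck(1)]]
      test_integrable[OF test_mult[OF z Ck(2)]] by simp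
qed

subsection \<open>A Poincare inequality on balls\<close>

lemma measurable_in_ball [measurable (raw)]:
  fixes f :: "'a \<Rightarrow> real^'n"
  shows "f \<in> borel_measurable M \<Longrightarrow> Measurable.pred M (\<lambda>x. f x \<in> ball a r)"
  unfolding mem_ball by measurable

text \<open>The fundamental theorem of calculus on the segment from y to y + h bounds the difference
  by \<open>norm h\<close> times the mean of the gradient over the segment. After exchanging the
  integrals, each fixed point of the segment contributes a translate of \<open>ball 0 r\<close>
  lying inside \<open>ball 0 (r + norm h)\<close>.\<close>

lemma translate_difference_bound:
  assumes z: "z \<in> test_functions"
  shows "(\<integral>\<^sup>+y\<in>ball 0 r. ennreal \<bar>z (y + h) - z y\<bar> \<partial>lborel)
    \<le> ennreal (norm h) * (\<integral>\<^sup>+y\<in>ball 0 (r + norm h). ennreal (norm (gradient z y)) \<partial>lborel)"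
proof -
  have gm[measurable]: "gradient z \<in> borel_measurable borel" by (rule gradient_measurable[OF z])
  have pw: "ennreal \<bar>z (y + h) - z y\<bar> \<le> (\<integral>\<^sup>+t. ennreal (norm h) * ennreal (norm (gradient z (y + t *\<^sub>R h))) * indicator {0..1} t \<partial>lborel)"
    (is "_ \<le> (\<integral>\<^sup>+t. ?g y t \<partial>lborel)") for y
  proof -
    have cont: "continuous_on UNIV (\<lambda>t. gradient z (y + t *\<^sub>R h) \<bullet> h)"
      by (intro continuous_intros continuous_on_compose2[OF gradient_continuous[OF z]]) auto
    have "(LINT t|lborel. (gradient z (y + t *\<^sub>R h) \<bullet> h) * indicator {0..1} t) = z (y + 1 *\<^sub>R h) - z (y + 0 *\<^sub>R h)"
      by (rule integral_FTC_Icc_real)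
         (use cont test_DERIV_line[OF z] in \<open>auto simp: continuous_on_eq_continuous_at\<close>)
    then have "ennreal \<bar>z (y + h) - z y\<bar> = ennreal (norm (LINT t|lborel. (gradient z (y + t *\<^sub>R h) \<bullet> h) * indicator {0..1} t))"
      by simp
    also have "\<dots> \<le> (\<integral>\<^sup>+t. ennreal (norm ((gradient z (y + t *\<^sub>R h) \<bullet> h) * indicator {0..1} t)) \<partial>lborel)"
    proof (rule integral_norm_bound_ennreal)
      show "integrable lborel (\<lambda>t. (gradient z (y + t *\<^sub>R h) \<bullet> h) * indicator {0..1} t)"
        using borel_integrable_compact[of "{0..1}" "\<lambda>t. gradient z (y + t *\<^sub>R h) \<bullet> h"] continuous_on_subset[OF cont]
        by (simp add: mult.commute)
    qed
    also have "\<dots> \<le> (\<integral>\<^sup>+t. ?g y t \<partial>lborel)"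
    proof (rule nn_integral_mono)
      fix t :: real
      show "ennreal (norm ((gradient z (y + t *\<^sub>R h) \<bullet> h) * indicator {0..1} t)) \<le> ?g y t"
        using Cauchy_Schwarz_ineq2[of "gradient z (y + t *\<^sub>R h)" h]
        by (auto simp: indicator_def ennreal_mult[symmetric] mult.commute intro!: ennreal_leI)
    qed
    finally show ?thesis .
  qed
  have "(\<integral>\<^sup>+y\<in>ball 0 r. ennreal \<bar>z (y + h) - z y\<bar> \<partial>lborel) \<le> (\<integral>\<^sup>+y\<in>ball 0 r. (\<integral>\<^sup>+t. ?g y t \<partial>lborel) \<partial>lborel)"
    by (intro nn_integral_mono mult_right_mono pw) auto
  also have "\<dots> = (\<integral>\<^sup>+y. \<integral>\<^sup>+t. ?g y t * indicator (ball 0 r) y \<partial>lborel \<partial>lborel)"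
    by (subst nn_integral_multc) auto
  also have "\<dots> = (\<integral>\<^sup>+t. \<integral>\<^sup>+y. ?g y t * indicator (ball 0 r) y \<partial>lborel \<partial>lborel)"
    by (rule lborel_pair.Fubini') measurable
  also have "\<dots> \<le> (\<integral>\<^sup>+t. ennreal (norm h) * (\<integral>\<^sup>+y\<in>ball 0 (r + norm h). ennreal (norm (gradient z y)) \<partial>lborel) * indicator {0..1::real} t \<partial>lborel)"
  proof (rule nn_integral_mono)
    fix t :: real
    show "(\<integral>\<^sup>+y. ?g y t * indicator (ball 0 r) y \<partial>lborel) \<le> ennreal (norm h) * (\<integral>\<^sup>+y\<in>ball 0 (r + norm h). ennreal (norm (gradient z y)) \<partial>lborel) * indicator {0..1::real} t"
    proof (cases "t \<in> {0..1}")
      case True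
      have "(\<integral>\<^sup>+y. ?g y t * indicator (ball 0 r) y \<partial>lborel) \<le> (\<integral>\<^sup>+y. ennreal (norm h) * (ennreal (norm (gradient z (t *\<^sub>R h + y))) * indicator (ball 0 (r + norm h)) (t *\<^sub>R h + y)) \<partial>lborel)"
      proof (rule nn_integral_mono)
        fix y :: "real^'a"
        have "t *\<^sub>R h + y \<in> ball 0 (r + norm h)" if "y \<in> ball 0 r"
        proof -
          have "norm (t *\<^sub>R h) \<le> norm h" using True by (simp add: mult_left_le_one_le)
          then show ?thesis using that norm_triangle_ineq[of "t *\<^sub>R h" y] by simp
        qed
        then show "?g y t * indicator (ball 0 r) y \<le> ennreal (norm h) * (ennreal (norm (gradient z (t *\<^sub>R h + y))) * indicator (ball 0 (r + norm h)) (t *\<^sub>R h + y))"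
          using True by (auto simp: indicator_def add.commute)
      qed
      also have "\<dots> = ennreal (norm h) * (\<integral>\<^sup>+y. ennreal (norm (gradient z (t *\<^sub>R h + y))) * indicator (ball 0 (r + norm h)) (t *\<^sub>R h + y) \<partial>lborel)"
        by (rule nn_integral_cmult) measurable
      also have "\<dots> = ennreal (norm h) * (\<integral>\<^sup>+y. ennreal (norm (gradient z y)) * indicator (ball 0 (r + norm h)) y \<partial>lborel)"
        by (subst nn_integral_lborel_translate[of "\<lambda>y. ennreal (norm (gradient z y)) * indicator (ball 0 (r + norm h)) y"]) auto
      finally show ?thesis using True by simp
    qed simp
  qed
  also have "\<dots> = ennreal (norm h) * (\<integral>\<^sup>+y\<in>ball 0 (r + norm h). ennreal (norm (gradient z y)) \<partial>lborel)"
    by (subst nn_integral_cmult_indicator) auto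
  finally show ?thesis .
qed

text \<open>The averaging ball stays the unit ball whatever ball is integrated over, so a single
  constant per function serves every radius.\<close>

definition ball_average :: "(real^'n \<Rightarrow> real) \<Rightarrow> real" where
  "ball_average z = (LINT x|lborel. indicator (ball 0 1) x * z x) / measure lborel (ball (0::real^'n) 1)"

text \<open>The average is an average of differences z x - z y, and each difference is a translation
  difference by h = x - y. Since h has length below 2R, \<open>translate_difference_bound\<close>
  applies with gradients on \<open>ball 0 (3 * R)\<close>; integrating over h produces the volume of
  the ball of radius 2R.\<close>

lemma poincare_ball_L1:
  assumes z: "z \<in> test_functions" and R: "R \<ge> 1"
  shows "(\<integral>\<^sup>+x\<in>ball (0::real^'n) R. ennreal \<bar>z x - ball_average z\<bar> \<partial>lborel)
    \<le> ennreal (2 * R * measure lborel (ball (0::real^'n) (2 * R)) / measure lborel (ball (0::real^'n) 1))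
        * (\<integral>\<^sup>+x\<in>ball 0 (3 * R). ennreal (norm (gradient z x)) \<partial>lborel)"
proof -
  define m where "m = measure lborel (ball (0::real^'n) 1)"
  have m: "m > 0" by (simp add: m_def)
  have m': "measure lborel (ball (0::real^'n) 1) = m" by (simp add: m_def)
  define A where "A = (\<integral>\<^sup>+x\<in>ball (0::real^'n) (3 * R). ennreal (norm (gradient z x)) \<partial>lborel)"
  have [measurable]: "z \<in> borel_measurable borel" by (rule test_measurable[OF z])
  have ind: "integrable lborel (indicator (ball (0::real^'n) 1) :: _ \<Rightarrow> real)"
    by (rule integrable_real_indicator) (use emeasure_lborel_ball_finite in auto)
  have iz: "integrable lborel (\<lambda>x. indicator (ball (0::real^'n) 1) x * z x)"
    using integrable_mult_indicator[OF _ test_integrable_lborel[OF z], of "ball 0 1"] by simp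
  have pw: "ennreal \<bar>z x - ball_average z\<bar> \<le> ennreal (1 / m) * (\<integral>\<^sup>+y. ennreal \<bar>z x - z y\<bar> * indicator (ball 0 R) y \<partial>lborel)" for x
  proof -
    have "(LINT y|lborel. indicator (ball 0 1) y * (z x - z y)) = m * z x - m * ball_average z"
      using ind iz m by (simp add: right_diff_distrib m' ball_average_def)
    then have "z x - ball_average z = 1 / m * (LINT y|lborel. indicator (ball 0 1) y * (z x - z y))"
      using m by (simp add: field_simps)
    then have "ennreal \<bar>z x - ball_average z\<bar> = ennreal (1 / m) * ennreal (norm (LINT y|lborel. indicator (ball 0 1) y * (z x - z y)))"
      using m by (simp add: abs_mult ennreal_mult[symmetric])
    also have "\<dots> \<le> ennreal (1 / m) * (\<integral>\<^sup>+y. ennreal (norm (indicator (ball 0 1) y * (z x - z y))) \<partial>lborel)"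
    proof (intro mult_left_mono integral_norm_bound_ennreal)
      show "integrable lborel (\<lambda>y. indicator (ball 0 1) y * (z x - z y))"
        using Bochner_Integration.integrable_diff[OF integrable_mult_left[OF ind, of "z x"] iz] by (simp add: right_diff_distrib)
    qed auto
    \<comment> \<open>As R is at least 1, the unit ball may be enlarged to \<open>ball 0 R\<close>,
      so that both variables range over the same ball.\<close>
    also have "\<dots> \<le> ennreal (1 / m) * (\<integral>\<^sup>+y. ennreal \<bar>z x - z y\<bar> * indicator (ball 0 R) y \<partial>lborel)"
      using R by (intro mult_left_mono nn_integral_mono) (auto simp: indicator_def)
    finally show ?thesis .
  qed
  have "(\<integral>\<^sup>+x\<in>ball (0::real^'n) R. ennreal \<bar>z x - ball_average z\<bar> \<partial>lborel)
     \<le> (\<integral>\<^sup>+x. ennreal (1 / m) * (\<integral>\<^sup>+y. ennreal \<bar>z x - z y\<bar> * indicator (ball 0 R) y * indicator (ball 0 R) x \<partial>lborel) \<partial>lborel)"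
    using pw by (intro nn_integral_mono) (auto simp: indicator_def)
  also have "\<dots> = ennreal (1 / m) * (\<integral>\<^sup>+x. \<integral>\<^sup>+y. ennreal \<bar>z x - z y\<bar> * indicator (ball 0 R) y * indicator (ball 0 R) x \<partial>lborel \<partial>lborel)"
    by (rule nn_integral_cmult) measurable
  also have "(\<integral>\<^sup>+x. \<integral>\<^sup>+y. ennreal \<bar>z x - z y\<bar> * indicator (ball 0 R) y * indicator (ball 0 R) x \<partial>lborel \<partial>lborel)
     = (\<integral>\<^sup>+y. \<integral>\<^sup>+x. ennreal \<bar>z x - z y\<bar> * indicator (ball 0 R) y * indicator (ball 0 R) x \<partial>lborel \<partial>lborel)"
    by (rule lborel_pair.Fubini') measurable
  \<comment> \<open>Substitution x = y + h in the inner integral.\<close>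
  also have "\<dots> = (\<integral>\<^sup>+y. \<integral>\<^sup>+h. ennreal \<bar>z (y + h) - z y\<bar> * indicator (ball 0 R) y * indicator (ball 0 R) (y + h) \<partial>lborel \<partial>lborel)"
    by (intro nn_integral_cong nn_integral_lborel_translate[symmetric]) measurable
  also have "\<dots> \<le> (\<integral>\<^sup>+y. \<integral>\<^sup>+h. ennreal \<bar>z (y + h) - z y\<bar> * indicator (ball 0 R) y * indicator (ball 0 (2 * R)) h \<partial>lborel \<partial>lborel)"
  proof (intro nn_integral_mono)
    fix y h :: "real^'n"
    have "h \<in> ball 0 (2 * R)" if "y \<in> ball 0 R" "y + h \<in> ball 0 R"
      using that norm_triangle_ineq4[of "y + h" y] by simp
    then show "ennreal \<bar>z (y + h) - z y\<bar> * indicator (ball 0 R) y * indicator (ball 0 R) (y + h) \<le> ennreal \<bar>z (y + h) - z y\<bar> * indicator (ball 0 R) y * indicator (ball 0 (2 * R)) h"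
      by (auto simp: indicator_def)
  qed
  also have "\<dots> = (\<integral>\<^sup>+h. \<integral>\<^sup>+y. ennreal \<bar>z (y + h) - z y\<bar> * indicator (ball 0 R) y * indicator (ball 0 (2 * R)) h \<partial>lborel \<partial>lborel)"
    by (rule lborel_pair.Fubini') measurable
  also have "\<dots> \<le> (\<integral>\<^sup>+h. (ennreal (2 * R) * A) * indicator (ball (0::real^'n) (2 * R)) h \<partial>lborel)"
  proof (rule nn_integral_mono)
    fix h :: "real^'n"
    show "(\<integral>\<^sup>+y. ennreal \<bar>z (y + h) - z y\<bar> * indicator (ball 0 R) y * indicator (ball 0 (2 * R)) h \<partial>lborel) \<le> (ennreal (2 * R) * A) * indicator (ball 0 (2 * R)) h"
    proof (cases "h \<in> ball 0 (2 * R)")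
      case True
      then have h: "norm h \<le> 2 * R" by simp
      have "(\<integral>\<^sup>+y\<in>ball 0 R. ennreal \<bar>z (y + h) - z y\<bar> \<partial>lborel) \<le> ennreal (norm h) * (\<integral>\<^sup>+y\<in>ball 0 (R + norm h). ennreal (norm (gradient z y)) \<partial>lborel)"
        by (rule translate_difference_bound[OF z])
      also have "\<dots> \<le> ennreal (2 * R) * A"
        unfolding A_def using h by (intro mult_mono ennreal_leI nn_integral_mono) (auto simp: indicator_def)
      finally show ?thesis using True by simp
    qed simp
  qed
  also have "\<dots> = (ennreal (2 * R) * A) * emeasure lborel (ball (0::real^'n) (2 * R))"
    by (rule nn_integral_cmult_indicator) auto
  also have "emeasure lborel (ball (0::real^'n) (2 * R)) = ennreal (measure lborel (ball (0::real^'n) (2 * R)))"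
    by (rule emeasure_eq_ennreal_measure) (use emeasure_lborel_ball_finite in \<open>metis less_irrefl infinity_ennreal_def\<close>)
  finally have "(\<integral>\<^sup>+x\<in>ball (0::real^'n) R. ennreal \<bar>z x - ball_average z\<bar> \<partial>lborel)
      \<le> ennreal (1 / m) * (ennreal (2 * R) * A * ennreal (measure lborel (ball (0::real^'n) (2 * R))))"
    by (simp add: mult_left_mono)
  also have "\<dots> = ennreal (2 * R * measure lborel (ball (0::real^'n) (2 * R)) / m) * A"
    using R m by (simp add: ennreal_mult[symmetric] mult_ac flip: ennreal_mult')
  finally show ?thesis unfolding A_def m' .
qed

subsection \<open>Functions with vanishing integrals over balls\<close>

lemma locally_integrable_bounded_set:
  assumes "locally_integrable u" "A \<in> sets lebesgue" "bounded A"
  shows "set_integrable lebesgue A u"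
proof (rule set_integrable_subset)
  show "set_integrable lebesgue (closure A) u"
    using assms by (simp add: locally_integrable_def)
qed (use assms closure_subset in auto)

lemma locally_integrable_measurable:
  fixes u :: "real^'n \<Rightarrow> 'b::euclidean_space"
  assumes "locally_integrable u"
  shows "u \<in> borel_measurable lebesgue"
proof (rule borel_measurable_LIMSEQ_metric)
  show "(\<lambda>x. indicator (cball 0 (real n)) x *\<^sub>R u x) \<in> borel_measurable lebesgue" for n
    using assms compact_cball[of "0::real^'n" "real n"] unfolding locally_integrable_def set_integrable_def
    by (blast dest: borel_measurable_integrable)
  fix x :: "real^'n"
  obtain N where N: "norm x \<le> real N" using real_arch_simple by blast
  have "eventually (\<lambda>n. indicator (cball 0 (real n)) x *\<^sub>R u x = u x) sequentially"
    using eventually_ge_at_top[of N] by eventually_elim (use N in \<open>auto simp: indicator_def\<close>)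
  then show "(\<lambda>n. indicator (cball 0 (real n)) x *\<^sub>R u x) \<longlonglongrightarrow> u x"
    by (rule tendsto_eventually)
qed

lemma locally_integrable_mult_bounded:
  fixes u :: "real^'n \<Rightarrow> real"
  assumes u: "locally_integrable u" and g: "g \<in> borel_measurable lebesgue"
    and B: "\<And>x. \<bar>g x\<bar> \<le> B" and R: "\<And>x. x \<notin> ball y R \<Longrightarrow> g x = 0"
  shows "integrable lebesgue (\<lambda>x. g x * u x)"
proof (rule Bochner_Integration.integrable_bound)
  show "integrable lebesgue (\<lambda>x. B * (indicator (ball y R) x *\<^sub>R u x))"
    using locally_integrable_bounded_set[OF u, of "ball y R"] by (auto simp: set_integrable_def)
  show "(\<lambda>x. g x * u x) \<in> borel_measurable lebesgue"
    using g locally_integrable_measurable[OF u] by measurable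
  show "AE x in lebesgue. norm (g x * u x) \<le> norm (B * (indicator (ball y R) x *\<^sub>R u x))"
  proof (rule AE_I2)
    fix x
    have "\<bar>g x\<bar> \<le> \<bar>B\<bar>" using B[of x] by linarith
    then show "norm (g x * u x) \<le> norm (B * (indicator (ball y R) x *\<^sub>R u x))"
      using R[of x] by (cases "x \<in> ball y R") (auto simp: abs_mult intro!: mult_right_mono)
  qed
qed

lemma locally_integrable_mult_test:
  fixes u :: "real^'n \<Rightarrow> real"
  assumes u: "locally_integrable u" and z: "z \<in> test_functions"
  shows "integrable lebesgue (\<lambda>x. z x * u x)"
proof -
  obtain R where R: "R > 0" "\<And>x. x \<notin> ball 0 R \<Longrightarrow> z x = 0"
    using test_bounded_support[OF z] by blast
  obtain B where B: "B > 0" "\<And>x. \<bar>z x\<bar> \<le> B" using test_bounded[OF z] by blast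
  show ?thesis
    by (rule locally_integrable_mult_bounded[OF u _ B(2), where y = 0 and R = R])
       (auto intro: measurable_completion simp: test_measurable[OF z] R(2))
qed

text \<open>By Vitali's covering theorem a bounded open set is, up to a null set, a countable
  disjoint union of balls, and integrals add up over it.\<close>

lemma set_integral_open_eq_0:
  fixes u :: "real^'n \<Rightarrow> real"
  assumes u: "locally_integrable u"
    and balls: "\<And>y r. r > 0 \<Longrightarrow> (LINT x:ball y r|lebesgue. u x) = 0"
    and U: "open U" "bounded U"
  shows "(LINT x:U|lebesgue. u x) = 0"
proof -
  define K where "K = {(a::real^'n, r::real). 0 < r \<and> ball a r \<subseteq> U}"
  have cov: "\<exists>i. i \<in> K \<and> x \<in> ball (fst i) (snd i) \<and> snd i < d" if x: "x \<in> U" and d: "0 < d" for x d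
  proof -
    obtain e where e: "e > 0" "ball x e \<subseteq> U" using U x by (meson openE)
    have "(x, min e (d / 2)) \<in> K" using e d by (auto simp: K_def)
    moreover have "x \<in> ball (fst (x, min e (d / 2))) (snd (x, min e (d / 2)))" using e d by simp
    moreover have "snd (x, min e (d / 2)) < d" using d by simp
    ultimately show ?thesis by blast
  qed
  obtain C where C: "countable C" "C \<subseteq> K"
     "pairwise (\<lambda>i j. disjnt (ball (fst i) (snd i)) (ball (fst j) (snd j))) C"
     "negligible (U - (\<Union>i\<in>C. ball (fst i) (snd i)))"
  proof (rule Vitali_covering_theorem_balls[of U K fst snd])
    show "\<exists>i. i \<in> K \<and> x \<in> ball (fst i) (snd i) \<and> snd i < d" if "x \<in> U" "0 < d" for x d
      using that by (rule cov)
  qed (rule that)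
  define V where "V = (\<Union>i\<in>C. ball (fst i) (snd i))"
  \<comment> \<open>An enumeration of the covering by natural numbers, padded with empty sets in
    case the covering is finite.\<close>
  define A where "A n = (if n \<in> to_nat_on C ` C then ball (fst (from_nat_into C n)) (snd (from_nat_into C n)) else {})" for n
  have VA: "V = (\<Union>n. A n)"
    using C(1) by (auto simp: V_def A_def split: if_splits)
  have VU: "V \<subseteq> U" using C(2) unfolding V_def K_def by fastforce
  have Vm: "V \<in> sets lebesgue" by (simp add: V_def sets_completionI_sets open_UN)
  have iV: "set_integrable lebesgue V u"
    by (rule locally_integrable_bounded_set[OF u Vm]) (use VU U bounded_subset in blast)
  have "(LINT x:V|lebesgue. u x) = (\<Sum>n. (LINT x:A n|lebesgue. u x))"
    unfolding VA
  proof (rule lebesgue_integral_countable_add)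
    show "A i \<in> sets lebesgue" for i by (simp add: A_def)
    show "A i \<inter> A j = {}" if "i \<noteq> j" for i j
    proof (cases "i \<in> to_nat_on C ` C \<and> j \<in> to_nat_on C ` C")
      case True
      then obtain p q where pq: "p \<in> C" "q \<in> C" "i = to_nat_on C p" "j = to_nat_on C q" by auto
      then have "p \<noteq> q" using that by auto
      then have "disjnt (ball (fst p) (snd p)) (ball (fst q) (snd q))"
        using C(3) pq by (auto simp: pairwise_def)
      then show ?thesis using pq C(1) by (simp add: A_def disjnt_def)
    qed (auto simp: A_def)
    show "set_integrable lebesgue (\<Union> (range A)) u" using iV by (simp add: VA)
  qed
  also have "\<dots> = (\<Sum>n. 0)"
  proof (rule suminf_cong)
    fix n
    show "(LINT x:A n|lebesgue. u x) = 0"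
    proof (cases "n \<in> to_nat_on C ` C")
      case True
      then have "from_nat_into C n \<in> C" using C(1) by auto
      then have "snd (from_nat_into C n) > 0" using C(2) by (auto simp: K_def)
      then show ?thesis using balls True by (simp add: A_def)
    qed (simp add: A_def set_lebesgue_integral_def)
  qed
  finally have V0: "(LINT x:V|lebesgue. u x) = 0" by simp
  have "(LINT x:U|lebesgue. u x) = (LINT x:V|lebesgue. u x)"
  proof (rule set_integral_cong_set)
    have "negligible (U - V)" using C(4) by (simp add: V_def)
    then have "U - V \<in> null_sets lebesgue" by (simp add: negligible_iff_null_sets)
    then have "AE x in lebesgue. x \<notin> U - V" by (rule AE_not_in)
    then show "AE x in lebesgue. x \<in> V \<longleftrightarrow> x \<in> U"
      by eventually_elim (use VU in blast)
    show "set_borel_measurable lebesgue U u" "set_borel_measurable lebesgue V u"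
      using locally_integrable_bounded_set[OF u, of U] iV U
      by (auto simp: set_integrable_def set_borel_measurable_def)
  qed
  with V0 show ?thesis by simp
qed

text \<open>A closed subset T of the set where u is positive has integral 0, because it is the
  difference of two bounded open sets. As u is positive on T, T is null, and inner regularity makes
  the whole positivity set null.\<close>

lemma ball_integrals_0_not_positive:
  fixes u :: "real^'n \<Rightarrow> real"
  assumes u: "locally_integrable u"
    and balls: "\<And>y r. r > 0 \<Longrightarrow> (LINT x:ball y r|lebesgue. u x) = 0"
  shows "AE x in lebesgue. u x \<le> 0"
proof -
  have um: "u \<in> borel_measurable lebesgue" by (rule locally_integrable_measurable[OF u])
  \<comment> \<open>The positivity set is cut by balls to keep the open sets bounded.\<close>
  define A where "A n = {x \<in> ball 0 (real n). u x > 0}" for n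
  have Am: "A n \<in> sets lebesgue" for n
  proof -
    have "A n = ball 0 (real n) \<inter> {x \<in> space lebesgue. u x > 0}" by (auto simp: A_def)
    also have "\<dots> \<in> sets lebesgue"
      by (intro sets.Int borel_measurable_less borel_measurable_const um) auto
    finally show ?thesis .
  qed
  have le: "emeasure lebesgue (A n) \<le> ennreal e" if e: "e > 0" for n e
  proof -
    obtain T where T: "closed T" "T \<subseteq> A n" "emeasure lebesgue (A n - T) < ennreal e"
      using sets_lebesgue_inner_closed[OF Am e] by metis
    have Tb: "T \<subseteq> ball 0 (real n)" using T(2) by (auto simp: A_def)
    have o: "open (ball 0 (real n) - T)" "bounded (ball 0 (real n) - T)"
      using T(1) by (auto intro: open_Diff bounded_diff)
    have Tm: "T \<in> sets lebesgue" using T(1) by simp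
    have iT: "set_integrable lebesgue T u"
      by (rule locally_integrable_bounded_set[OF u Tm]) (use Tb bounded_subset bounded_ball in blast)
    have iD: "set_integrable lebesgue (ball 0 (real n) - T) u"
      by (rule locally_integrable_bounded_set[OF u]) (use o in auto)
    have "(LINT x:(ball 0 (real n) - T) \<union> T|lebesgue. u x) = (LINT x:ball 0 (real n) - T|lebesgue. u x) + (LINT x:T|lebesgue. u x)"
      by (rule set_integral_Un) (use iT iD in auto)
    moreover have "(ball 0 (real n) - T) \<union> T = ball 0 (real n)" using Tb by blast
    ultimately have "(LINT x:T|lebesgue. u x) = 0"
      using set_integral_open_eq_0[OF u balls o] set_integral_open_eq_0[OF u balls open_ball bounded_ball] by simp
    moreover have nn: "AE x in lebesgue. 0 \<le> indicator T x *\<^sub>R u x"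
      using T(2) by (auto simp: indicator_def A_def subset_iff less_imp_le)
    ultimately have "AE x in lebesgue. indicator T x *\<^sub>R u x = 0"
      using integral_nonneg_eq_0_iff_AE[OF _ nn] iT by (simp add: set_integrable_def set_lebesgue_integral_def)
    then have "AE x in lebesgue. x \<notin> T"
      by eventually_elim (use T(2) in \<open>auto simp: indicator_def A_def split: if_splits\<close>)
    then have T0: "T \<in> null_sets lebesgue" using AE_iff_null_sets[OF Tm] by simp
    have "emeasure lebesgue (A n) = emeasure lebesgue (A n - T)"
      using emeasure_Diff_null_set[OF T0 Am] by simp
    with T(3) show ?thesis by simp
  qed
  have "emeasure lebesgue (A n) \<le> 0" for n
  proof (rule ennreal_le_epsilon)
    show "emeasure lebesgue (A n) \<le> 0 + ennreal e" if "0 < e" for e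
      using le[OF that, of n] by simp
  qed
  then have "A n \<in> null_sets lebesgue" for n using Am by (simp add: null_sets_def)
  then have "AE x in lebesgue. \<forall>n. x \<notin> A n"
    by (subst AE_all_countable) (auto intro: AE_not_in)
  then show ?thesis
  proof eventually_elim
    fix x assume x: "\<forall>n. x \<notin> A n"
    obtain n where "norm x < real n" using reals_Archimedean2 by blast
    with spec[OF x, of n] show "u x \<le> 0" by (simp add: A_def not_less)
  qed
qed

lemma ball_integrals_0_AE_0:
  fixes u :: "real^'n \<Rightarrow> real"
  assumes u: "locally_integrable u"
    and balls: "\<And>y r. r > 0 \<Longrightarrow> (LINT x:ball y r|lebesgue. u x) = 0"
  shows "AE x in lebesgue. u x = 0"
proof -
  have "locally_integrable (\<lambda>x. - u x)"
    using u by (auto simp: locally_integrable_def set_integrable_def)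
  then have "AE x in lebesgue. - u x \<le> 0"
    by (rule ball_integrals_0_not_positive) (use balls in \<open>simp add: set_lebesgue_integral_def\<close>)
  moreover have "AE x in lebesgue. u x \<le> 0"
    by (rule ball_integrals_0_not_positive[OF u balls])
  ultimately show ?thesis by eventually_elim auto
qed

text \<open>With a = c/t this is (1 + d a) exp(-a) \<le> 1, a consequence of 1 + a \<le> exp a. The
  case d = 0 is the plain bump used for the fundamental lemma; d = 1 is the profile 1 + c/t that
  dilation produces in Liouville's theorem. One uniform bound lets both pass to the limit c to
  0.\<close>

lemma exp_bump_affine_bound:
  assumes "c > 0" "0 \<le> d" "d \<le> 1"
  shows "\<bar>exp_bump c [:1, d * c:] t\<bar> \<le> 1"
proof (cases "t \<le> 0")
  case False
  define a where "a = c / t"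
  have a: "a > 0" using False assms by (simp add: a_def)
  have "1 + d * a \<le> 1 + a" using a assms by (simp add: mult_le_cancel_right1)
  also have "\<dots> \<le> exp a" by (rule exp_ge_add_one_self)
  finally have "(1 + d * a) * exp (- a) \<le> 1" by (simp add: exp_minus field_simps)
  moreover have "exp_bump c [:1, d * c:] t = (1 + d * a) * exp (- a)"
    using False by (simp add: exp_bump_def a_def)
  ultimately show ?thesis using a assms by (simp add: abs_mult)
qed (simp add: exp_bump_def)

lemma exp_bump_cap_measurable: "c > 0 \<Longrightarrow> (\<lambda>x. exp_bump c p (cap s y x)) \<in> borel_measurable lebesgue"
  by (intro measurable_completion) (simp add: borel_measurable_continuous_onI[OF Ck_continuous[OF Ck_exp_bump_cap]])

text \<open>As \<open>c\<close> tends to 0, the bumps stay bounded by 1 and converge to the indicator of the ball.\<close>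

lemma set_integral_ball_eq_0:
  fixes u :: "real^'n \<Rightarrow> real"
  assumes u: "locally_integrable u" and r: "r > 0" and d: "0 \<le> d" "d \<le> 1"
    and 0: "\<And>c. c > 0 \<Longrightarrow> (LINT x|lebesgue. exp_bump c [:1, d * c:] (cap (1 / r) y x) * u x) = 0"
  shows "(LINT x:ball y r|lebesgue. u x) = 0"
proof -
  define c where "c n = inverse (real (Suc n))" for n
  have c: "c n > 0" for n by (simp add: c_def)
  have r1: "1 / r > 0" "1 / (1 / r) = r" using r by auto
  have um[measurable]: "u \<in> borel_measurable lebesgue" by (rule locally_integrable_measurable[OF u])
  have "(\<lambda>n. LINT x|lebesgue. exp_bump (c n) [:1, d * c n:] (cap (1 / r) y x) * u x) \<longlonglongrightarrow> (LINT x|lebesgue. indicator (ball y r) x *\<^sub>R u x)"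
  proof (rule integral_dominated_convergence[where w = "\<lambda>x. norm (indicator (ball y r) x *\<^sub>R u x)"])
    have "integrable lebesgue (\<lambda>x. indicator (ball y r) x *\<^sub>R u x)"
      using locally_integrable_bounded_set[OF u, of "ball y r"] by (simp add: set_integrable_def)
    then show "integrable lebesgue (\<lambda>x. norm (indicator (ball y r) x *\<^sub>R u x))" 
      "(\<lambda>x. indicator (ball y r) x *\<^sub>R u x) \<in> borel_measurable lebesgue" by auto
    show "(\<lambda>x. exp_bump (c n) [:1, d * c n:] (cap (1 / r) y x) * u x) \<in> borel_measurable lebesgue" for n
      by (intro borel_measurable_times exp_bump_cap_measurable um c)
    show "AE x in lebesgue. norm (exp_bump (c n) [:1, d * c n:] (cap (1 / r) y x) * u x) \<le> norm (indicator (ball y r) x *\<^sub>R u x)" for n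
    proof (rule AE_I2)
      fix x
      show "norm (exp_bump (c n) [:1, d * c n:] (cap (1 / r) y x) * u x) \<le> norm (indicator (ball y r) x *\<^sub>R u x)"
        using exp_bump_affine_bound[OF c[of n] d, of "cap (1 / r) y x"] exp_bump_cap_eq_0[OF r1(1), of x y "c n" "[:1, d * c n:]"] r1(2)
        by (cases "x \<in> ball y r") (auto simp: abs_mult mult_left_le_one_le)
    qed
    show "AE x in lebesgue. (\<lambda>n. exp_bump (c n) [:1, d * c n:] (cap (1 / r) y x) * u x) \<longlonglongrightarrow> indicator (ball y r) x *\<^sub>R u x"
    proof (rule AE_I2)
      fix x
      show "(\<lambda>n. exp_bump (c n) [:1, d * c n:] (cap (1 / r) y x) * u x) \<longlonglongrightarrow> indicator (ball y r) x *\<^sub>R u x"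
      proof (cases "x \<in> ball y r")
        case True
        then have t: "cap (1 / r) y x > 0" using cap_pos_iff[OF r1(1), of y x] r1(2) by simp
        have "c \<longlonglongrightarrow> 0" unfolding c_def by (rule LIMSEQ_inverse_real_of_nat)
        then have "(\<lambda>n. (1 + 1 / cap (1 / r) y x * (d * c n)) * exp (- (c n / cap (1 / r) y x)) * u x)
           \<longlonglongrightarrow> (1 + 1 / cap (1 / r) y x * (d * 0)) * exp (- (0 / cap (1 / r) y x)) * u x"
          using t by (intro tendsto_intros) auto
        then show ?thesis using True t by (simp add: exp_bump_def not_le)
      next
        case False
        then show ?thesis using exp_bump_cap_eq_0[OF r1(1), of x y] r1(2) by simp
      qed
    qed
  qed
  then show ?thesis
    by (simp add: 0 c LIMSEQ_const_iff set_lebesgue_integral_def)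
qed

text \<open>The bumps with d = 0 are test functions and approximate indicators of balls, so all ball
  integrals of \<open>u\<close> vanish.\<close>

lemma fundamental_lemma:
  fixes u :: "real^'n \<Rightarrow> real"
  assumes u: "locally_integrable u"
    and 0: "\<And>z. z \<in> test_functions \<Longrightarrow> (LINT x|lebesgue. z x * u x) = 0"
  shows "AE x in lebesgue. u x = 0"
proof (rule ball_integrals_0_AE_0[OF u])
  fix y :: "real^'n" and r :: real assume r: "r > 0"
  show "(LINT x:ball y r|lebesgue. u x) = 0"
    by (rule set_integral_ball_eq_0[OF u r, of 0]) (use r in \<open>auto intro!: 0 exp_bump_cap_test\<close>)
qed

subsection \<open>A Liouville theorem for square integrable functions\<close>

lemma square_integrable_locally_integrable:
  fixes u :: "real^'n \<Rightarrow> 'b::euclidean_space"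
  assumes um: "u \<in> borel_measurable lebesgue" and u2: "integrable lebesgue (\<lambda>x. (norm (u x))\<^sup>2)"
  shows "locally_integrable u"
  unfolding locally_integrable_def set_integrable_def
proof (intro allI impI)
  fix K :: "(real^'n) set" assume K: "compact K"
  have ik: "integrable lebesgue (\<lambda>x. indicator K x :: real)"
    by (rule integrable_real_indicator)
       (use K lmeasurable_compact in \<open>auto simp: fmeasurable_def\<close>)
  show "integrable lebesgue (\<lambda>x. indicator K x *\<^sub>R u x)"
  proof (rule Bochner_Integration.integrable_bound[OF Bochner_Integration.integrable_add[OF ik u2]])
    show "(\<lambda>x. indicator K x *\<^sub>R u x) \<in> borel_measurable lebesgue"
      using um K lmeasurable_compact by (intro borel_measurable_scaleR borel_measurable_indicator) auto
    show "AE x in lebesgue. norm (indicator K x *\<^sub>R u x) \<le> norm (indicator K x + (norm (u x))\<^sup>2)"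
    proof (rule AE_I2)
      fix x
      \<comment> \<open>From a - a^2 \<le> 1/4; on a compact set the constant 1 is
        integrable.\<close>
      have "norm (u x) \<le> 1 + (norm (u x))\<^sup>2"
        using zero_le_power2[of "norm (u x) - 1/2"] by (simp add: power2_diff power_divide)
      then show "norm (indicator K x *\<^sub>R u x) \<le> norm (indicator K x + (norm (u x))\<^sup>2)"
        by (auto simp: indicator_def)
    qed
  qed
qed

section \<open>Radial bumps under dilation and Liouville's theorem\<close>

text \<open>In terms of t = \<open>cap s y x\<close> this is t exp(-c/t), whose derivative (1 + c/t)
  exp(-c/t) is \<open>exp_bump c [:1, c:]\<close>. Its gradient is therefore that radial bump times
  -2 s^2 (x - y), and the divergence of a bump times x - y is what a change of scale
  generates.\<close>

definition cap_bump :: "real \<Rightarrow> real \<Rightarrow> real^'n \<Rightarrow> real^'n \<Rightarrow> real" where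
  "cap_bump c s y x = cap s y x * exp_bump c [:1:] (cap s y x)"

lemma Ck_cap: "Ck k (cap s y)"
proof -
  \<comment> \<open>The factors \<open>1 *\<close> put the coordinates into the form of
    \<open>Ck_affine\<close>.\<close>
  have "Ck k (\<lambda>x. 1 + - (s\<^sup>2) * (\<Sum>j\<in>UNIV. (1 * (x - y) $ j) * (1 * (x - y) $ j)))"
  proof -
    have "Ck k (\<lambda>x. \<Sum>j\<in>J. (1 * (x - y) $ j) * (1 * (x - y) $ j))" if "finite J" for J
      using that
    proof induction
      case (insert a J)
      have "(\<lambda>x. \<Sum>j\<in>insert a J. (1 * (x - y) $ j) * (1 * (x - y) $ j)) = (\<lambda>x. (1 * (x - y) $ a) * (1 * (x - y) $ a) + (\<Sum>j\<in>J. (1 * (x - y) $ j) * (1 * (x - y) $ j)))"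
        using insert by (simp del: mult_1)
      then show ?case by (simp only:) (intro Ck_add Ck_mult Ck_affine insert)
    qed (simp add: Ck_const)
    from this[of UNIV] show ?thesis by (intro Ck_add Ck_mult Ck_const) simp
  qed
  moreover have "cap s y = (\<lambda>x. 1 + - (s\<^sup>2) * (\<Sum>j\<in>UNIV. (1 * (x - y) $ j) * (1 * (x - y) $ j)))"
    by (simp add: cap_def fun_eq_iff inner_vec_def)
  ultimately show ?thesis by simp
qed

lemma cap_bump_test:
  assumes "c > 0" "s > 0"
  shows "cap_bump c s y \<in> test_functions"
  unfolding cap_bump_def[abs_def] by (intro test_mult exp_bump_cap_test Ck_cap assms)

lemma cap_bump_has_derivative:
  assumes c: "c > 0"
  shows "(cap_bump c s y has_derivative (\<lambda>h. exp_bump c [:1, c:] (cap s y x) * (- 2 * s\<^sup>2 * ((x - y) \<bullet> h)))) (at x)"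
proof -
  have "((\<lambda>x. cap s y x * exp_bump c [:1:] (cap s y x)) has_derivative
     (\<lambda>h. cap s y x * (exp_bump c (bump_deriv c [:1:]) (cap s y x) * (- 2 * s^2 * ((x - y) \<bullet> h)))
        + (- 2 * s\<^sup>2 * ((x - y) \<bullet> h)) * exp_bump c [:1:] (cap s y x))) (at x)"
    by (rule has_derivative_mult[OF cap_has_derivative exp_bump_cap_has_derivative[OF c]])
  moreover
  have E: "cap s y x * exp_bump c (bump_deriv c [:1:]) (cap s y x) + exp_bump c [:1:] (cap s y x) = exp_bump c [:1, c:] (cap s y x)"
    by (auto simp: exp_bump_def bump_deriv_def field_simps)
  then have "(\<lambda>h. cap s y x * (exp_bump c (bump_deriv c [:1:]) (cap s y x) * (- 2 * s^2 * ((x - y) \<bullet> h)))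
        + (- 2 * s\<^sup>2 * ((x - y) \<bullet> h)) * exp_bump c [:1:] (cap s y x)) =
      (\<lambda>h. exp_bump c [:1, c:] (cap s y x) * (- 2 * s\<^sup>2 * ((x - y) \<bullet> h)))"
    by (intro ext) (simp add: algebra_simps flip: E)
  ultimately show ?thesis unfolding cap_bump_def[abs_def] by simp
qed

lemma partial_deriv_cap_bump:
  "c > 0 \<Longrightarrow> partial_deriv j (cap_bump c s y) = (\<lambda>x. exp_bump c [:1, c:] (cap s y x) * (- 2 * s\<^sup>2 * (x - y) $ j))"
  by (rule ext) (simp add: partial_deriv_eqI[OF cap_bump_has_derivative] inner_axis)

lemma second_partial_deriv_cap_bump:
  assumes c: "c > 0"
  shows "partial_deriv k (partial_deriv j (cap_bump c s y)) x =
     exp_bump c (bump_deriv c [:1, c:]) (cap s y x) * (4 * s ^ 4 * (x - y) $ k * (x - y) $ j)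
       - 2 * s\<^sup>2 * (if j = k then exp_bump c [:1, c:] (cap s y x) else 0)"
proof -
  have "((\<lambda>x. (x - y) $ j) has_derivative (\<lambda>h. h $ j)) (at x)"
    by (rule bounded_linear.has_derivative[OF bounded_linear_vec_nth, where g = "\<lambda>x. x - y" and g' = "\<lambda>h. h"])
       (auto intro!: derivative_eq_intros)
  then have l: "((\<lambda>x. - 2 * s\<^sup>2 * (x - y) $ j) has_derivative (\<lambda>h. - 2 * s\<^sup>2 * h $ j)) (at x)"
    by (rule has_derivative_mult_right)
  have ax: "axis k (1::real) $ j = (if j = k then 1 else 0)" by (simp add: axis_def)
  show ?thesis
    unfolding partial_deriv_cap_bump[OF c]
    by (subst partial_deriv_eqI[OF has_derivative_mult[OF exp_bump_cap_has_derivative[OF c] l]])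
       (simp del: vector_minus_component add: inner_axis ax power2_eq_square power4_eq_xxxx mult_ac)
qed

lemma laplacian_cap_bump:
  fixes y :: "real^'n"
  assumes c: "c > 0"
  shows "laplacian (cap_bump c s y) x = 4 * s ^ 4 * ((x - y) \<bullet> (x - y)) * exp_bump c (bump_deriv c [:1, c:]) (cap s y x)
       - 2 * s\<^sup>2 * real CARD('n) * exp_bump c [:1, c:] (cap s y x)"
  unfolding laplacian_def second_partial_deriv_cap_bump[OF c]
  by (simp add: sum_subtractf inner_vec_def sum_distrib_left sum_distrib_right mult_ac)

text \<open>For s > 0 the power of \<open>s\<close> compensates the shrinking of the support: the
  total mass is the same for every scale.\<close>

definition scaled_bump :: "real \<Rightarrow> real^'n \<Rightarrow> real \<Rightarrow> real^'n \<Rightarrow> real" where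
  "scaled_bump c y s x = s ^ CARD('n) * exp_bump c [:1, c:] (cap s y x)"

definition scaled_bump_deriv :: "real \<Rightarrow> real^'n \<Rightarrow> real \<Rightarrow> real^'n \<Rightarrow> real" where
  "scaled_bump_deriv c y s x = real CARD('n) * s ^ (CARD('n) - 1) * exp_bump c [:1, c:] (cap s y x)
     + s ^ CARD('n) * (exp_bump c (bump_deriv c [:1, c:]) (cap s y x) * (- 2 * s * ((x - y) \<bullet> (x - y))))"

lemma DERIV_scaled_bump:
  assumes c: "c > 0"
  shows "((\<lambda>s. scaled_bump c y s x) has_real_derivative scaled_bump_deriv c y s x) (at s)"
proof -
  have "((\<lambda>s. cap s y x) has_real_derivative (- 2 * s * ((x - y) \<bullet> (x - y)))) (at s)"
    unfolding cap_def by (auto intro!: derivative_eq_intros)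
  from DERIV_chain2[OF DERIV_exp_bump[OF c] this]
  show ?thesis unfolding scaled_bump_def scaled_bump_deriv_def
    by (auto intro!: derivative_eq_intros)
qed

text \<open>Rescaling the radial bump changes it by a Laplacian, so its integral against a weakly harmonic
  function does not depend on the scale.\<close>

lemma scaled_bump_deriv_laplacian:
  fixes y :: "real^'n"
  assumes c: "c > 0" and s: "s > 0"
  shows "scaled_bump_deriv c y s x = - (s ^ CARD('n) / (2 * s ^ 3)) * laplacian (cap_bump c s y) x"
proof -
  \<comment> \<open>The exponent \<open>CARD('n) - 1\<close> is a truncated difference; the
    dimension is positive, so one factor \<open>s\<close> can be split off.\<close>
  have "s ^ CARD('n) = s * s ^ (CARD('n) - 1)"
    by (metis One_nat_def Suc_pred power_Suc zero_less_card_finite)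
  then show ?thesis
    using s unfolding laplacian_cap_bump[OF c] scaled_bump_deriv_def
    by (simp add: field_simps power2_eq_square power3_eq_cube power4_eq_xxxx)
qed

lemma continuous_on_cap: "continuous_on UNIV (\<lambda>(s, x). cap s y x)"
  unfolding cap_def[abs_def] case_prod_beta by (intro continuous_intros)

text \<open>Differentiation under the integral sign. For scales near \<open>s\<close> all bumps live
  in one ball, and the derivative in the scale is bounded there by compactness, so difference
  quotients are dominated through the mean value theorem.\<close>

lemma DERIV_integral_scaled_bump:
  fixes u :: "real^'n \<Rightarrow> real"
  assumes u: "locally_integrable u" and c: "c > 0" and s: "s > 0"
  shows "((\<lambda>s. LINT x|lebesgue. scaled_bump c y s x * u x) has_real_derivative
      (LINT x|lebesgue. scaled_bump_deriv c y s x * u x)) (at s)"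
proof -
  have um[measurable]: "u \<in> borel_measurable lebesgue" by (rule locally_integrable_measurable[OF u])
  \<comment> \<open>All scales in [s - e, s + e] are at least e, hence their supports lie in the
    ball of radius 1/e.\<close>
  define e where "e = s / 2"
  have e: "e > 0" using s by (simp add: e_def)
  have cm: "(\<lambda>x. scaled_bump c y t x) \<in> borel_measurable lebesgue" for t
    unfolding scaled_bump_def[abs_def] by (intro borel_measurable_times borel_measurable_const exp_bump_cap_measurable c)
  have innm: "(\<lambda>x. (x - y) \<bullet> (x - y)) \<in> borel_measurable lebesgue"
    by (intro measurable_completion) simp
  have dm: "(\<lambda>x. scaled_bump_deriv c y t x) \<in> borel_measurable lebesgue" for t
    unfolding scaled_bump_deriv_def[abs_def]
    by (intro borel_measurable_add borel_measurable_times borel_measurable_const exp_bump_cap_measurable c innm)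
  have int: "integrable lebesgue (\<lambda>x. scaled_bump c y t x * u x)" if t: "t > 0" for t
  proof (rule locally_integrable_mult_bounded[OF u cm, where y = y and R = "1 / t" and B = "t ^ CARD('n)"])
    fix x
    show "\<bar>scaled_bump c y t x\<bar> \<le> t ^ CARD('n)"
      using exp_bump_affine_bound[OF c, of 1 "cap t y x"] t
      by (simp add: scaled_bump_def abs_mult mult_left_le)
    show "scaled_bump c y t x = 0" if "x \<notin> ball y (1 / t)"
      using exp_bump_cap_eq_0[OF t that] by (simp add: scaled_bump_def)
  qed
  have "continuous_on UNIV (\<lambda>(t, x). scaled_bump_deriv c y t x)"
    unfolding scaled_bump_deriv_def[abs_def] case_prod_beta
    by (intro continuous_intros continuous_on_compose2[OF continuous_on_exp_bump[OF c]])
       (use continuous_on_cap[of y] in \<open>auto simp: case_prod_beta\<close>)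
  then have "compact ((\<lambda>(t, x). scaled_bump_deriv c y t x) ` ({s - e..s + e} \<times> cball y (1 / e)))"
    by (intro compact_continuous_image compact_Times) (auto intro: continuous_on_subset)
  then obtain M where M: "M > 0" "\<And>t x. t \<in> {s - e..s + e} \<Longrightarrow> x \<in> cball y (1 / e) \<Longrightarrow> \<bar>scaled_bump_deriv c y t x\<bar> \<le> M"
    by (metis (mono_tags, lifting) bounded_pos compact_imp_bounded image_eqI mem_Sigma_iff old.prod.case real_norm_def)
  have M': "\<bar>scaled_bump_deriv c y t x\<bar> \<le> M * indicator (cball y (1 / e)) x" if t: "t \<in> {s - e..s + e}" for t x
  proof (cases "x \<in> cball y (1 / e)")
    case False
    have te: "t \<ge> e" using t by (simp add: e_def)
    then have "1 / t \<le> 1 / e" using e by (simp add: frac_le)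
    then have "x \<notin> ball y (1 / t)" using False by auto
    then have "exp_bump c p (cap t y x) = 0" for p using te e by (intro exp_bump_cap_eq_0) auto
    then show ?thesis using M(1) by (simp add: scaled_bump_deriv_def)
  qed (use M(2)[OF t] in auto)
  have "((\<lambda>h. ((LINT x|lebesgue. scaled_bump c y (s + h) x * u x) - (LINT x|lebesgue. scaled_bump c y s x * u x)) / h)
      \<longlongrightarrow> (LINT x|lebesgue. scaled_bump_deriv c y s x * u x)) (at 0)"
  proof (subst LIMSEQ_SEQ_conv[symmetric], intro allI impI, elim conjE)
    fix S :: "nat \<Rightarrow> real" assume S0: "\<forall>n. S n \<noteq> 0" and S: "S \<longlonglongrightarrow> 0"
    have "eventually (\<lambda>n. \<bar>S n\<bar> < e) sequentially"
      using S e by (auto dest: tendstoD simp: dist_real_def)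
    then obtain N where N: "\<And>n. n \<ge> N \<Longrightarrow> \<bar>S n\<bar> < e" by (auto simp: eventually_sequentially)
    \<comment> \<open>Dropping finitely many terms keeps every increment inside the interval on
      which the derivative is bounded.\<close>
    define T where "T n = S (n + N)" for n
    have T: "T n \<noteq> 0" "\<bar>T n\<bar> < e" for n using S0 N by (auto simp: T_def)
    have Tl: "T \<longlonglongrightarrow> 0" unfolding T_def using S by (rule LIMSEQ_ignore_initial_segment)
    have eq: "((LINT x|lebesgue. scaled_bump c y (s + T n) x * u x) - (LINT x|lebesgue. scaled_bump c y s x * u x)) / T n
       = (LINT x|lebesgue. (scaled_bump c y (s + T n) x - scaled_bump c y s x) / T n * u x)" for n
    proof -
      have "s + T n > 0" using T(2)[of n] by (simp add: e_def)
      then show ?thesis using int s T(1)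
        by (simp add: left_diff_distrib diff_divide_distrib)
    qed
    have q: "\<bar>(scaled_bump c y (s + T n) x - scaled_bump c y s x) / T n\<bar> \<le> M * indicator (cball y (1 / e)) x" for n x
    proof -
      \<comment> \<open>The mean value theorem is applied on the interval to the right or to the
        left of \<open>s\<close>, according to the sign of the increment.\<close>
      have "\<exists>t. t \<in> {s - e..s + e} \<and> (scaled_bump c y (s + T n) x - scaled_bump c y s x) / T n = scaled_bump_deriv c y t x"
      proof (cases "T n > 0")
        case True
        obtain t where t: "s < t" "t < s + T n" "scaled_bump c y (s + T n) x - scaled_bump c y s x = (s + T n - s) * scaled_bump_deriv c y t x"
          using MVT2[of s "s + T n" "\<lambda>s. scaled_bump c y s x" "\<lambda>s. scaled_bump_deriv c y s x"] DERIV_scaled_bump[OF c] True by auto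
        then show ?thesis using T[of n] by (intro exI[of _ t]) auto
      next
        case False
        then have "T n < 0" using T(1)[of n] by linarith
        then obtain t where t: "s + T n < t" "t < s" "scaled_bump c y s x - scaled_bump c y (s + T n) x = (s - (s + T n)) * scaled_bump_deriv c y t x"
          using MVT2[of "s + T n" s "\<lambda>s. scaled_bump c y s x" "\<lambda>s. scaled_bump_deriv c y s x"] DERIV_scaled_bump[OF c] by auto
        then have "scaled_bump c y (s + T n) x - scaled_bump c y s x = T n * scaled_bump_deriv c y t x" by (simp add: algebra_simps)
        then show ?thesis using T[of n] t by (intro exI[of _ t]) auto
      qed
      then obtain t where t: "t \<in> {s - e..s + e}" "(scaled_bump c y (s + T n) x - scaled_bump c y s x) / T n = scaled_bump_deriv c y t x"
        by blast
      show ?thesis unfolding t(2) by (rule M'[OF t(1)])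
    qed
    have "(\<lambda>n. LINT x|lebesgue. (scaled_bump c y (s + T n) x - scaled_bump c y s x) / T n * u x) \<longlonglongrightarrow> (LINT x|lebesgue. scaled_bump_deriv c y s x * u x)"
    proof (rule integral_dominated_convergence[where w = "\<lambda>x. M * norm (indicator (cball y (1 / e)) x *\<^sub>R u x)"])
      show "(\<lambda>x. scaled_bump_deriv c y s x * u x) \<in> borel_measurable lebesgue" by (intro borel_measurable_times dm um)
      show "(\<lambda>x. (scaled_bump c y (s + T n) x - scaled_bump c y s x) / T n * u x) \<in> borel_measurable lebesgue" for n
        by (intro borel_measurable_times borel_measurable_divide borel_measurable_diff cm um borel_measurable_const)
      show "integrable lebesgue (\<lambda>x. M * norm (indicator (cball y (1 / e)) x *\<^sub>R u x))"
        using u by (intro integrable_mult_right integrable_norm) (auto simp: locally_integrable_def set_integrable_def)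
      show "AE x in lebesgue. norm ((scaled_bump c y (s + T n) x - scaled_bump c y s x) / T n * u x) \<le> M * norm (indicator (cball y (1 / e)) x *\<^sub>R u x)" for n
      proof (rule AE_I2)
        fix x
        show "norm ((scaled_bump c y (s + T n) x - scaled_bump c y s x) / T n * u x) \<le> M * norm (indicator (cball y (1 / e)) x *\<^sub>R u x)"
          using mult_right_mono[OF q[of n x], of "\<bar>u x\<bar>"] by (simp add: abs_mult mult.assoc)
      qed
      show "AE x in lebesgue. (\<lambda>n. (scaled_bump c y (s + T n) x - scaled_bump c y s x) / T n * u x) \<longlonglongrightarrow> scaled_bump_deriv c y s x * u x"
      proof (rule AE_I2)
        fix x
        have "((\<lambda>h. (scaled_bump c y (s + h) x - scaled_bump c y s x) / h) \<longlongrightarrow> scaled_bump_deriv c y s x) (at 0)"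
          using DERIV_scaled_bump[OF c, of y x s] by (simp add: DERIV_def)
        moreover have "filterlim T (at 0) sequentially" using Tl T(1) by (simp add: filterlim_at)
        ultimately show "(\<lambda>n. (scaled_bump c y (s + T n) x - scaled_bump c y s x) / T n * u x) \<longlonglongrightarrow> scaled_bump_deriv c y s x * u x"
          by (intro tendsto_mult_right) (rule filterlim_compose)
      qed
    qed
    then have "(\<lambda>n. ((LINT x|lebesgue. scaled_bump c y (s + S (n + N)) x * u x) - (LINT x|lebesgue. scaled_bump c y s x * u x)) / S (n + N)) \<longlonglongrightarrow> (LINT x|lebesgue. scaled_bump_deriv c y s x * u x)"
      unfolding eq[symmetric] unfolding T_def .
    then show "(\<lambda>n. ((LINT x|lebesgue. scaled_bump c y (s + S n) x * u x) - (LINT x|lebesgue. scaled_bump c y s x * u x)) / S n) \<longlonglongrightarrow> (LINT x|lebesgue. scaled_bump_deriv c y s x * u x)"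
      by (rule LIMSEQ_offset)
  qed
  then show ?thesis unfolding DERIV_def .
qed

text \<open>The integral of \<open>u\<close> against the normalised dilates of a bump does not
  depend on the scale. At scale a the bump is at most a^N and lives on a ball of volume proportional
  to a^-N, so a small value of u^2 in the mean forces the integral to 0 as a tends to 0. Thus
  \<open>u\<close> is orthogonal to all these bumps, and shrinking \<open>c\<close> gives vanishing
  ball integrals.\<close>

lemma liouville_square_integrable:
  fixes u :: "real^'n \<Rightarrow> real"
  assumes um: "u \<in> borel_measurable lebesgue" and u2: "integrable lebesgue (\<lambda>x. (u x)\<^sup>2)"
    and harmonic: "\<And>c s y. c > 0 \<Longrightarrow> s > 0 \<Longrightarrow> (LINT x|lebesgue. laplacian (cap_bump c s y) x * u x) = 0"
  shows "AE x in lebesgue. u x = 0"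
proof -
  have u: "locally_integrable u"
    using square_integrable_locally_integrable[OF um] u2 by simp
  have zero: "(LINT x|lebesgue. exp_bump c [:1, c:] (cap s y x) * u x) = 0" if c: "c > 0" and s: "s > 0" for c s y
  proof -
    define J where "J s = (LINT x|lebesgue. scaled_bump c y s x * u x)" for s
    have dJ: "(J has_real_derivative 0) (at s)" if s: "s > 0" for s
    proof -
      have "(LINT x|lebesgue. scaled_bump_deriv c y s x * u x) = 0"
        by (simp add: scaled_bump_deriv_laplacian[OF c s] mult.assoc harmonic[OF c s])
      then show ?thesis using DERIV_integral_scaled_bump[OF u c s, of y] by (simp add: J_def[abs_def])
    qed
    \<comment> \<open>The interval from 0 to a + s + 1 contains both scales.\<close>
    have const: "J a = J s" if a: "a > 0" for a
      by (rule DERIV_isconst3[of 0 "a + s + 1" a s J]) (use a s dJ in auto)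
    define A where "A = (LINT x|lebesgue. (u x)\<^sup>2)"
    define V where "V = unit_ball_vol (real CARD('n))"
    have A: "A \<ge> 0" by (simp add: A_def)
    have bound: "\<bar>J s\<bar> \<le> (A + V) / real (Suc n)" for n
    proof -
      define h where "h = real (Suc n)"
      have h: "h \<ge> 1" by (simp add: h_def)
      \<comment> \<open>Since the dimension is at least 1, this choice gives a^N h \<le> a h = 1/h.
        The term with u^2 and the volume term are then both of order 1/h.\<close>
      define a where "a = 1 / h\<^sup>2"
      have a: "a > 0" "a \<le> 1" using h by (auto simp: a_def)
      define B where "B = ball y (1 / a)"
      have mB: "measure lebesgue B = V / a ^ CARD('n)"
        using a by (simp add: B_def V_def content_ball power_divide)
      have iB: "integrable lebesgue (\<lambda>x. indicator B x :: real)"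
        by (rule integrable_real_indicator) (use lmeasurable_ball[of y "1 / a"] in \<open>auto simp: B_def fmeasurable_def\<close>)
      have "\<bar>J a\<bar> \<le> (LINT x|lebesgue. a ^ CARD('n) * (h * (u x)\<^sup>2 + indicator B x / h))"
        unfolding J_def real_norm_def[symmetric]
      proof (rule order_trans[OF integral_norm_bound integral_mono])
        show "integrable lebesgue (\<lambda>x. a ^ CARD('n) * (h * (u x)\<^sup>2 + indicator B x / h))"
          using u2 iB by (intro integrable_mult_right Bochner_Integration.integrable_add integrable_divide) auto
        have cm: "(\<lambda>x. scaled_bump c y a x) \<in> borel_measurable lebesgue"
          unfolding scaled_bump_def[abs_def] by (intro borel_measurable_times borel_measurable_const exp_bump_cap_measurable c)
        have b: "\<bar>scaled_bump c y a x\<bar> \<le> a ^ CARD('n)" for x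
          using exp_bump_affine_bound[OF c, of 1 "cap a y x"] a
          by (simp add: scaled_bump_def abs_mult mult_left_le)
        have z: "scaled_bump c y a x = 0" if "x \<notin> B" for x
          using exp_bump_cap_eq_0[of a x y] a that by (simp add: scaled_bump_def B_def)
        show "integrable lebesgue (\<lambda>x. norm (scaled_bump c y a x * u x))"
          by (rule integrable_norm, rule locally_integrable_mult_bounded[OF u cm b, where y = y and R = "1 / a"]) (use z in \<open>auto simp: B_def\<close>)
        fix x
        show "norm (scaled_bump c y a x * u x) \<le> a ^ CARD('n) * (h * (u x)\<^sup>2 + indicator B x / h)"
        proof (cases "x \<in> B")
          case True
          \<comment> \<open>A weighted form of the inequality between arithmetic and geometric mean:
            the weight \<open>h\<close> on u^2 is paid for by 1/h on the support.\<close>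
          have "0 \<le> (h * \<bar>u x\<bar> - 1)\<^sup>2 + h * \<bar>u x\<bar>" using h by simp
          then have "\<bar>u x\<bar> * h \<le> (h * (u x)\<^sup>2 + 1 / h) * h"
            using h by (simp add: power2_eq_square algebra_simps abs_mult_self_eq)
          then have "\<bar>u x\<bar> \<le> h * (u x)\<^sup>2 + 1 / h" using h by (simp add: mult_le_cancel_right)
          then have "\<bar>scaled_bump c y a x\<bar> * \<bar>u x\<bar> \<le> a ^ CARD('n) * (h * (u x)\<^sup>2 + 1 / h)"
            by (intro mult_mono b) (use a in auto)
          then show ?thesis using True by (simp add: abs_mult)
        qed (use z a h in auto)
      qed
      also have "\<dots> = a ^ CARD('n) * (h * A + (V / a ^ CARD('n)) / h)"
        using u2 iB mB by (simp add: A_def)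
      also have "\<dots> = a ^ CARD('n) * h * A + V / h" using a h by (simp add: field_simps)
      also have "\<dots> \<le> 1 / h * A + V / h"
      proof -
        have "a ^ CARD('n) \<le> a ^ 1" by (rule power_decreasing) (use a in \<open>auto simp: Suc_le_eq\<close>)
        then have "a ^ CARD('n) * h \<le> a * h" using h by simp
        also have "a * h = 1 / h" using h by (simp add: a_def power2_eq_square)
        finally show ?thesis using A by (intro add_right_mono mult_right_mono)
      qed
      also have "\<dots> = (A + V) / h" by (simp add: add_divide_distrib)
      finally show ?thesis using const[OF a(1)] by (simp add: h_def)
    qed
    have "(\<lambda>n. (A + V) / real (Suc n)) \<longlonglongrightarrow> 0"
      using LIMSEQ_inverse_real_of_nat[THEN tendsto_mult_right_zero, of "A + V"] by (simp add: divide_inverse)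
    then have "\<bar>J s\<bar> \<le> 0"
      by (rule LIMSEQ_le_const) (use bound in auto)
    then have "J s = 0" by simp
    then show ?thesis using s by (simp add: J_def scaled_bump_def mult.assoc)
  qed
  show ?thesis
  proof (rule ball_integrals_0_AE_0[OF u])
    fix y :: "real^'n" and r :: real assume r: "r > 0"
    show "(LINT x:ball y r|lebesgue. u x) = 0"
      by (rule set_integral_ball_eq_0[OF u r, of 1]) (use r zero in auto)
  qed
qed

subsection \<open>Square integrable fields\<close>

lemma Lp_space_2_iff:
  "f \<in> Lp_space 2 M \<longleftrightarrow> f \<in> borel_measurable M \<and> integrable M (\<lambda>x. (norm (f x))\<^sup>2)"
proof -
  have "(\<lambda>x. norm (f x) powr 2) = (\<lambda>x. (norm (f x))\<^sup>2)"
    by (simp add: fun_eq_iff)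
  then show ?thesis by (simp add: Lp_space_def)
qed

lemma L2_integrable_inner:
  assumes "v \<in> Lp_space 2 M" "w \<in> Lp_space 2 M"
  shows "integrable M (\<lambda>x. v x \<bullet> w x)"
proof (rule Bochner_Integration.integrable_bound)
  show "integrable M (\<lambda>x. (norm (v x))\<^sup>2 + (norm (w x))\<^sup>2)"
    using assms by (simp add: Lp_space_2_iff)
  show "(\<lambda>x. v x \<bullet> w x) \<in> borel_measurable M"
    using assms by (auto simp: Lp_space_2_iff)
  show "AE x in M. norm (v x \<bullet> w x) \<le> norm ((norm (v x))\<^sup>2 + (norm (w x))\<^sup>2)"
  proof (rule AE_I2)
    fix x
    have "\<bar>v x \<bullet> w x\<bar> \<le> norm (v x) * norm (w x)" by (rule Cauchy_Schwarz_ineq2)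
    also have "\<dots> \<le> (norm (v x))\<^sup>2 + (norm (w x))\<^sup>2"
      using sum_squares_bound[of "norm (v x)" "norm (w x)"]
        mult_nonneg_nonneg[OF norm_ge_zero[of "v x"] norm_ge_zero[of "w x"]] by linarith
    finally show "norm (v x \<bullet> w x) \<le> norm ((norm (v x))\<^sup>2 + (norm (w x))\<^sup>2)" by simp
  qed
qed

lemma L2_scale: "v \<in> Lp_space 2 M \<Longrightarrow> (\<lambda>x. a *\<^sub>R v x) \<in> Lp_space 2 M"
  by (auto simp: Lp_space_2_iff power_mult_distrib)

lemma norm_add_sq_le: "(norm (a + b))\<^sup>2 \<le> 2 * (norm a)\<^sup>2 + 2 * (norm (b :: 'a :: real_normed_vector))\<^sup>2"
proof -
  have "(norm (a + b))\<^sup>2 \<le> (norm a + norm b)\<^sup>2" by (intro power_mono norm_triangle_ineq) auto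
  also have "\<dots> \<le> 2 * (norm a)\<^sup>2 + 2 * (norm b)\<^sup>2"
    using sum_squares_bound[of "norm a" "norm b"] by (simp add: power2_sum)
  finally show ?thesis .
qed

lemma L2_add:
  assumes "v \<in> Lp_space 2 M" "w \<in> Lp_space 2 M"
  shows "(\<lambda>x. v x + w x) \<in> Lp_space 2 M"
proof -
  have m: "(\<lambda>x. v x + w x) \<in> borel_measurable M"
    using assms by (auto simp: Lp_space_2_iff)
  have "integrable M (\<lambda>x. (norm (v x + w x))\<^sup>2)"
  proof (rule Bochner_Integration.integrable_bound)
    show "integrable M (\<lambda>x. 2 * (norm (v x))\<^sup>2 + 2 * (norm (w x))\<^sup>2)"
      using assms by (simp add: Lp_space_2_iff)
    show "(\<lambda>x. (norm (v x + w x))\<^sup>2) \<in> borel_measurable M"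
      using m by measurable
  qed (use norm_add_sq_le in \<open>auto intro!: AE_I2\<close>)
  with m show ?thesis by (simp add: Lp_space_2_iff)
qed

lemma L2_diff: "v \<in> Lp_space 2 M \<Longrightarrow> w \<in> Lp_space 2 M \<Longrightarrow> (\<lambda>x. v x - w x) \<in> Lp_space 2 M"
  using L2_add[OF _ L2_scale[of w M "-1"], of v] by simp

lemma L2_norm_add_scale:
  assumes "v \<in> Lp_space 2 M" "w \<in> Lp_space 2 M"
  shows "(LINT x|M. (norm (v x + t *\<^sub>R w x))\<^sup>2)
     = (LINT x|M. (norm (v x))\<^sup>2) + 2 * t * (LINT x|M. v x \<bullet> w x) + t\<^sup>2 * (LINT x|M. (norm (w x))\<^sup>2)"
proof -
  have "(norm (v x + t *\<^sub>R w x))\<^sup>2 = (norm (v x))\<^sup>2 + 2 * t * (v x \<bullet> w x) + t\<^sup>2 * (norm (w x))\<^sup>2" for x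
    unfolding power2_norm_eq_inner
    by (simp add: inner_add inner_commute power2_eq_square[of t] algebra_simps del: dot_square_norm)
  then show ?thesis
    using assms L2_integrable_inner[OF assms] by (simp add: Lp_space_2_iff)
qed

lemma discriminant_bound:
  fixes A B C :: real
  assumes "C \<ge> 0" "\<And>t. 0 \<le> A + 2 * t * B + t\<^sup>2 * C"
  shows "B\<^sup>2 \<le> A * C"
proof (cases "C = 0")
  case True
  have "B = 0"
  proof (rule ccontr)
    assume "B \<noteq> 0"
    \<comment> \<open>At this value of t the affine expression A + 2 t B equals -1.\<close>
    then show False using assms(2)[of "- (A + 1) / (2 * B)"] True by (simp add: field_simps)
  qed
  then show ?thesis using True by simp
next
  case False
  then have "C > 0" using assms(1) by simp
  \<comment> \<open>The vertex of the parabola.\<close>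
  then show ?thesis using assms(2)[of "- B / C"] by (simp add: field_simps power2_eq_square)
qed

lemma L2_Cauchy_Schwarz:
  assumes "v \<in> Lp_space 2 M" "w \<in> Lp_space 2 M"
  shows "\<bar>LINT x|M. v x \<bullet> w x\<bar> \<le> sqrt (LINT x|M. (norm (v x))\<^sup>2) * sqrt (LINT x|M. (norm (w x))\<^sup>2)"
proof -
  have "0 \<le> (LINT x|M. (norm (v x))\<^sup>2) + 2 * t * (LINT x|M. v x \<bullet> w x) + t\<^sup>2 * (LINT x|M. (norm (w x))\<^sup>2)" for t
    unfolding L2_norm_add_scale[OF assms, symmetric] by simp
  then have "(LINT x|M. v x \<bullet> w x)\<^sup>2 \<le> (LINT x|M. (norm (v x))\<^sup>2) * (LINT x|M. (norm (w x))\<^sup>2)"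
    by (intro discriminant_bound) auto
  then show ?thesis
    by (metis real_sqrt_abs real_sqrt_le_iff real_sqrt_mult)
qed

lemma norm_gradient_sq: "(norm (gradient z x))\<^sup>2 = (\<Sum>j\<in>UNIV. partial_deriv j z x * partial_deriv j z x)"
  by (simp add: power2_norm_eq_inner inner_vec_def gradient_def)

lemma gradient_L2:
  assumes z: "z \<in> test_functions"
  shows "gradient z \<in> Lp_space 2 lebesgue"
proof -
  have "integrable lebesgue (\<lambda>x. partial_deriv j z x * partial_deriv j z x)" for j
    using test_partial[OF z, of j] by (intro test_integrable test_mult) (auto simp: test_functions_def)
  then show ?thesis
    unfolding Lp_space_2_iff norm_gradient_sq
    by (auto intro!: measurable_completion simp: gradient_measurable[OF z])
qed

subsection \<open>Local convergence in mean\<close>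

text \<open>Geometric decay of consecutive differences on every ball makes the telescoping series
  converge absolutely almost everywhere. Its sum D also supplies the majorant |u 0| + D, integrable
  on balls, which gives local integrability of the limit and convergence of integrals against
  bounded functions of bounded support. It serves both for gradients and for normalised
  potentials.\<close>

lemma L1_loc_limit:
  fixes u :: "nat \<Rightarrow> real^'n \<Rightarrow> 'b::euclidean_space" and K :: "real \<Rightarrow> real"
  assumes u: "\<And>n. locally_integrable (u n)"
    and K: "\<And>R n. R \<ge> 1 \<Longrightarrow> (\<integral>\<^sup>+x\<in>ball 0 R. ennreal (norm (u (Suc n) x - u n x)) \<partial>lebesgue) \<le> ennreal (K R * (1/4) ^ n)"
  shows "\<exists>v. locally_integrable v \<and> (AE x in lebesgue. (\<lambda>n. u n x) \<longlonglongrightarrow> v x) \<and>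
    (\<forall>g R B. g \<in> borel_measurable lebesgue \<longrightarrow> (\<forall>x. \<bar>g x\<bar> \<le> B) \<longrightarrow> (\<forall>x. x \<notin> ball 0 R \<longrightarrow> g x = 0) \<longrightarrow>
      (\<lambda>n. LINT x|lebesgue. g x *\<^sub>R u n x) \<longlonglongrightarrow> (LINT x|lebesgue. g x *\<^sub>R v x))"
proof -
  have um[measurable]: "u n \<in> borel_measurable lebesgue" for n
    by (rule locally_integrable_measurable[OF u])
  define D where "D x = (\<Sum>n. ennreal (norm (u (Suc n) x - u n x)))" for x
  have Dm[measurable]: "D \<in> borel_measurable lebesgue" unfolding D_def by measurable
  have nm: "(\<lambda>x. ennreal (norm (u (Suc n) x - u n x))) \<in> borel_measurable lebesgue" for n
    by measurable
  have bm: "ball 0 R \<in> sets lebesgue" for R :: real by simp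
  have Dint: "(\<integral>\<^sup>+x\<in>ball 0 R. D x \<partial>lebesgue) < \<infinity>" if R: "R \<ge> 1" for R
  proof -
    have "(\<integral>\<^sup>+x\<in>ball 0 R. D x \<partial>lebesgue) = (\<integral>\<^sup>+x. (\<Sum>n. ennreal (norm (u (Suc n) x - u n x)) * indicator (ball 0 R) x) \<partial>lebesgue)"
      unfolding D_def by (simp add: ennreal_suminf_multc)
    also have "\<dots> = (\<Sum>n. \<integral>\<^sup>+x\<in>ball 0 R. ennreal (norm (u (Suc n) x - u n x)) \<partial>lebesgue)"
      by (rule nn_integral_suminf)
         (intro borel_measurable_times_ennreal borel_measurable_indicator bm nm)
    also have "\<dots> \<le> (\<Sum>n. ennreal (\<bar>K R\<bar> * (1/4) ^ n))"
    proof (rule suminf_le)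
      fix n
      \<comment> \<open>No sign is assumed for \<open>K R\<close>; the absolute value makes the
        series one of nonnegative terms.\<close>
      have "K R * (1/4) ^ n \<le> \<bar>K R\<bar> * (1/4) ^ n" by (intro mult_right_mono) auto
      then show "(\<integral>\<^sup>+x\<in>ball 0 R. ennreal (norm (u (Suc n) x - u n x)) \<partial>lebesgue) \<le> ennreal (\<bar>K R\<bar> * (1/4) ^ n)"
        using K[OF R, of n] by (meson ennreal_leI order_trans)
    qed auto
    also have "\<dots> < \<infinity>"
    proof -
      have "summable (\<lambda>n. \<bar>K R\<bar> * (1/4::real) ^ n)" by (intro summable_mult summable_geometric) auto
      then have "(\<Sum>n. ennreal (\<bar>K R\<bar> * (1/4) ^ n)) = ennreal (\<Sum>n. \<bar>K R\<bar> * (1/4) ^ n)"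
        by (intro suminf_ennreal2) auto
      then show ?thesis by simp
    qed
    finally show ?thesis .
  qed
  \<comment> \<open>Finiteness of D is known on each ball only; countably many balls exhaust the
    space.\<close>
  have "AE x in lebesgue. \<forall>k. D x * indicator (ball 0 (real (Suc k))) x \<noteq> \<infinity>"
  proof (subst AE_all_countable, intro allI)
    fix k
    show "AE x in lebesgue. D x * indicator (ball 0 (real (Suc k))) x \<noteq> \<infinity>"
      by (rule nn_integral_noteq_infinite)
         (use Dint[of "real (Suc k)"] bm in \<open>auto intro!: borel_measurable_times_ennreal borel_measurable_indicator Dm\<close>)
  qed
  then have Dfin: "AE x in lebesgue. D x \<noteq> \<infinity>"
  proof eventually_elim
    fix x assume x: "\<forall>k. D x * indicator (ball 0 (real (Suc k))) x \<noteq> \<infinity>"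
    obtain k where "norm x < real k" using reals_Archimedean2 by blast
    with spec[OF x, of k] show "D x \<noteq> \<infinity>" by simp
  qed
  have conv: "convergent (\<lambda>n. u n x)" and bound: "norm (u n x) \<le> norm (u 0 x) + enn2real (D x)" if x: "D x \<noteq> \<infinity>" for x n
  proof -
    have sm: "summable (\<lambda>n. norm (u (Suc n) x - u n x))"
      using x unfolding D_def by (intro summable_suminf_not_top) auto
    have Deq: "enn2real (D x) = (\<Sum>n. norm (u (Suc n) x - u n x))"
      unfolding D_def using sm by (subst suminf_ennreal2) (simp_all add: enn2real_ennreal suminf_nonneg)
    have tel: "(\<Sum>i<n. u (Suc i) x - u i x) = u n x - u 0 x" for n
      by (rule sum_lessThan_telescope)
    have "summable (\<lambda>n. u (Suc n) x - u n x)" using sm by (rule summable_norm_cancel)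
    then have "convergent (\<lambda>n. u n x - u 0 x)"
      by (simp add: summable_iff_convergent tel)
    then show "convergent (\<lambda>n. u n x)"
      using convergent_add[OF _ convergent_const[of "u 0 x"], of "\<lambda>n. u n x - u 0 x"] by simp
    have "norm (u n x - u 0 x) \<le> (\<Sum>i<n. norm (u (Suc i) x - u i x))"
      unfolding tel[symmetric] by (rule norm_sum)
    also have "\<dots> \<le> enn2real (D x)"
      unfolding Deq by (rule sum_le_suminf[OF sm]) auto
    finally show "norm (u n x) \<le> norm (u 0 x) + enn2real (D x)"
      using norm_triangle_sub[of "u n x" "u 0 x"] by linarith
  qed
  define v where "v x = lim (\<lambda>n. u n x)" for x
  have vm[measurable]: "v \<in> borel_measurable lebesgue" unfolding v_def by measurable
  have lim: "AE x in lebesgue. (\<lambda>n. u n x) \<longlonglongrightarrow> v x"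
    using Dfin by eventually_elim (simp add: v_def conv convergent_LIMSEQ_iff[symmetric])
  define W where "W x = norm (u 0 x) + enn2real (D x)" for x
  have W0: "W x \<ge> 0" for x by (simp add: W_def)
  have iW: "integrable lebesgue (\<lambda>x. indicator (ball 0 R) x * W x)" for R
  proof -
    \<comment> \<open>The integrability of D is available for radii at least 1.\<close>
    define R' where "R' = max R 1"
    have i0: "integrable lebesgue (\<lambda>x. indicator (ball 0 R) x * norm (u 0 x))"
      using integrable_norm[OF locally_integrable_bounded_set[OF u, of "ball 0 R" 0, unfolded set_integrable_def]] by simp
    have "integrable lebesgue (\<lambda>x. indicator (ball 0 R) x * enn2real (D x))"
    proof (rule integrableI_bounded)
      show "(\<lambda>x. indicator (ball 0 R) x * enn2real (D x)) \<in> borel_measurable lebesgue"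
        by (intro borel_measurable_times borel_measurable_indicator bm measurable_compose[OF Dm]) auto
      have "(\<integral>\<^sup>+x. ennreal (norm (indicator (ball 0 R) x * enn2real (D x))) \<partial>lebesgue) \<le> (\<integral>\<^sup>+x\<in>ball 0 R'. D x \<partial>lebesgue)"
      proof (rule nn_integral_mono)
        fix x :: "real^'n"
        show "ennreal (norm (indicator (ball 0 R) x * enn2real (D x))) \<le> D x * indicator (ball 0 R') x"
          by (cases "D x") (auto simp: indicator_def R'_def top_unique)
      qed
      also have "\<dots> < \<infinity>" by (rule Dint) (simp add: R'_def)
      finally show "(\<integral>\<^sup>+x. ennreal (norm (indicator (ball 0 R) x * enn2real (D x))) \<partial>lebesgue) < \<infinity>" .
    qed
    with i0 show ?thesis unfolding W_def distrib_left by (rule Bochner_Integration.integrable_add)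
  qed
  have vW: "AE x in lebesgue. norm (v x) \<le> W x"
    using lim Dfin
  proof eventually_elim
    fix x assume *: "(\<lambda>n. u n x) \<longlonglongrightarrow> v x" and "D x \<noteq> \<infinity>"
    then show "norm (v x) \<le> W x"
      by (intro LIMSEQ_le_const2[OF tendsto_norm[OF *]]) (use bound W_def in auto)
  qed
  show ?thesis
  proof (intro exI[of _ v] conjI allI impI)
    show "locally_integrable v"
      unfolding locally_integrable_def set_integrable_def
    proof (intro allI impI)
      fix K :: "(real^'n) set" assume K: "compact K"
      then obtain R where R: "K \<subseteq> ball 0 R" by (metis bounded_subset_ballD compact_imp_bounded)
      show "integrable lebesgue (\<lambda>x. indicator K x *\<^sub>R v x)"
      proof (rule Bochner_Integration.integrable_bound[OF iW[of R]])
        show "(\<lambda>x. indicator K x *\<^sub>R v x) \<in> borel_measurable lebesgue"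
          using vm K lmeasurable_compact by (intro borel_measurable_scaleR borel_measurable_indicator) auto
        show "AE x in lebesgue. norm (indicator K x *\<^sub>R v x) \<le> norm (indicator (ball 0 R) x * W x)"
          using vW
        proof eventually_elim
          case (elim x)
          then show ?case using R W0[of x] by (cases "x \<in> K") auto
        qed
      qed
    qed
    show "AE x in lebesgue. (\<lambda>n. u n x) \<longlonglongrightarrow> v x" by (rule lim)
    fix g :: "real^'n \<Rightarrow> real" and R B :: real
    assume g: "g \<in> borel_measurable lebesgue" and B: "\<forall>x. \<bar>g x\<bar> \<le> B" and R: "\<forall>x. x \<notin> ball 0 R \<longrightarrow> g x = 0"
    show "(\<lambda>n. LINT x|lebesgue. g x *\<^sub>R u n x) \<longlonglongrightarrow> (LINT x|lebesgue. g x *\<^sub>R v x)"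
    proof (rule integral_dominated_convergence[where w = "\<lambda>x. B * (indicator (ball 0 R) x * W x)"])
      show "(\<lambda>x. g x *\<^sub>R v x) \<in> borel_measurable lebesgue" "\<And>n. (\<lambda>x. g x *\<^sub>R u n x) \<in> borel_measurable lebesgue"
        using g by measurable
      show "integrable lebesgue (\<lambda>x. B * (indicator (ball 0 R) x * W x))" by (intro integrable_mult_right iW)
      show "AE x in lebesgue. (\<lambda>n. g x *\<^sub>R u n x) \<longlonglongrightarrow> g x *\<^sub>R v x"
        using lim by eventually_elim (intro tendsto_intros)
      show "AE x in lebesgue. norm (g x *\<^sub>R u n x) \<le> B * (indicator (ball 0 R) x * W x)" for n
        using Dfin
      proof eventually_elim
        case (elim x)
        show ?case
        proof (cases "x \<in> ball 0 R")
          case True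
          have "\<bar>g x\<bar> * norm (u n x) \<le> B * W x"
            using spec[OF B, of x] bound[OF elim, of n] by (intro mult_mono) (auto simp: W_def)
          then show ?thesis using True by simp
        qed (simp add: R)
      qed
    qed
  qed
qed

subsection \<open>Projection onto gradients\<close>

text \<open>Based on a \<le> d a^2 + 1/d. The free parameter is later taken as 4^n: for fields of
  energy of order 16^-n both terms become of order 4^-n, the rate that \<open>L1_loc_limit\<close>
  asks for.\<close>

lemma nn_integral_ball_le_L2:
  fixes v :: "real^'n \<Rightarrow> 'b::euclidean_space"
  assumes v: "v \<in> Lp_space 2 lebesgue" and d: "d > 0"
  shows "(\<integral>\<^sup>+x\<in>ball 0 R. ennreal (norm (v x)) \<partial>lebesgue)
     \<le> ennreal (d * (LINT x|lebesgue. (norm (v x))\<^sup>2) + measure lebesgue (ball (0::real^'n) R) / d)"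
proof -
  have iB: "integrable lebesgue (\<lambda>x. indicator (ball (0::real^'n) R) x :: real)"
    by (rule integrable_real_indicator) (use lmeasurable_ball[of "0::real^'n" R] in \<open>auto simp: fmeasurable_def\<close>)
  have v2: "integrable lebesgue (\<lambda>x. (norm (v x))\<^sup>2)" using v by (simp add: Lp_space_2_iff)
  have "(\<integral>\<^sup>+x\<in>ball 0 R. ennreal (norm (v x)) \<partial>lebesgue) \<le> (\<integral>\<^sup>+x. ennreal (d * (norm (v x))\<^sup>2 + indicator (ball 0 R) x / d) \<partial>lebesgue)"
  proof (rule nn_integral_mono)
    fix x :: "real^'n"
    define a where "a = norm (v x)"
    have "0 \<le> (d * a - 1)\<^sup>2 + d * a" using d by (simp add: a_def)
    then have "a * d \<le> (d * a\<^sup>2 + 1 / d) * d" using d by (simp add: power2_eq_square algebra_simps)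
    then have "a \<le> d * a\<^sup>2 + 1 / d" using d by (simp add: mult_le_cancel_right)
    then show "ennreal (norm (v x)) * indicator (ball 0 R) x \<le> ennreal (d * (norm (v x))\<^sup>2 + indicator (ball 0 R) x / d)"
      by (auto simp: indicator_def a_def intro!: ennreal_leI)
  qed
  also have "\<dots> = ennreal (LINT x|lebesgue. d * (norm (v x))\<^sup>2 + indicator (ball 0 R) x / d)"
    by (rule nn_integral_eq_integral)
       (use v2 iB d in \<open>auto intro!: Bochner_Integration.integrable_add\<close>)
  also have "(LINT x|lebesgue. d * (norm (v x))\<^sup>2 + indicator (ball 0 R) x / d)
      = d * (LINT x|lebesgue. (norm (v x))\<^sup>2) + measure lebesgue (ball (0::real^'n) R) / d"
    using v2 iB by simp
  finally show ?thesis .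
qed

lemma zero_test: "(\<lambda>x. 0) \<in> test_functions"
  by (rule test_functionsI[OF Ck_const]) simp

lemma gradient_diff:
  assumes "z \<in> test_functions" "f \<in> test_functions"
  shows "gradient (\<lambda>x. f x + - 1 * z x) = (\<lambda>x. gradient f x - gradient z x)"
  by (rule ext) (subst gradient_add_scale, use assms in auto)

lemma ball_average_diff:
  assumes "z \<in> test_functions" "f \<in> test_functions"
  shows "ball_average (\<lambda>x. f x + - 1 * z x) = ball_average f - ball_average z"
proof -
  have i: "integrable lborel (\<lambda>x. indicator (ball (0::real^'a) 1) x * g x)" if "g \<in> test_functions" for g
    using integrable_mult_indicator[OF _ test_integrable_lborel[OF that], of "ball 0 1"] by simp
  show ?thesis
    unfolding ball_average_def using i[OF assms(1)] i[OF assms(2)]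
    by (simp add: right_diff_distrib diff_divide_distrib)
qed

lemma test_locally_integrable: "z \<in> test_functions \<Longrightarrow> locally_integrable (\<lambda>x. z x - c)"
  unfolding locally_integrable_def set_integrable_def
proof (intro allI impI)
  fix K :: "(real^'a) set" assume z: "z \<in> test_functions" and K: "compact K"
  have "integrable lborel (\<lambda>x. indicator K x *\<^sub>R (z x - c))"
    by (rule borel_integrable_compact[OF K])
       (intro continuous_intros continuous_on_subset[OF test_continuous[OF z]] subset_UNIV)
  then show "integrable lebesgue (\<lambda>x. indicator K x *\<^sub>R (z x - c))"
    by (metis integrable_completion borel_measurable_integrable)
qed

lemma locally_integrable_vec_nth:
  assumes "locally_integrable v"
  shows "locally_integrable (\<lambda>x. v x $ j)"
  unfolding locally_integrable_def set_integrable_def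
proof (intro allI impI)
  fix K :: "(real^'a) set" assume "compact K"
  then have "integrable lebesgue (\<lambda>x. indicator K x *\<^sub>R v x)"
    using assms by (simp add: locally_integrable_def set_integrable_def)
  from integrable_bounded_linear[OF bounded_linear_vec_nth this, of j]
  show "integrable lebesgue (\<lambda>x. indicator K x *\<^sub>R v x $ j)" by simp
qed

text \<open>\<open>g\<close> is the projection of \<open>f\<close> onto the closure of gradients of
  test functions. The pairing with gradients determines the projection, which is why any
  \<open>w\<close> with the same pairings as \<open>f\<close> has norm at least that of
  \<open>g\<close>. The potential \<open>h\<close> arises from the approximating test functions
  after subtracting constants.\<close>

lemma gradient_projection:
  fixes f :: "real^'n \<Rightarrow> real^'n"
  assumes f: "f \<in> Lp_space 2 lebesgue"
  obtains h :: "real^'n \<Rightarrow> real" and g :: "real^'n \<Rightarrow> real^'n"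
  where "locally_integrable h" "g \<in> Lp_space 2 lebesgue"
    "\<And>\<zeta> j. \<zeta> \<in> test_functions \<Longrightarrow> (LINT x|lebesgue. \<zeta> x * g x $ j) = - (LINT x|lebesgue. partial_deriv j \<zeta> x * h x)"
    "\<And>\<zeta>. \<zeta> \<in> test_functions \<Longrightarrow> (LINT x|lebesgue. f x \<bullet> gradient \<zeta> x) = (LINT x|lebesgue. g x \<bullet> gradient \<zeta> x)"
    "\<And>w. w \<in> Lp_space 2 lebesgue \<Longrightarrow> (\<And>\<zeta>. \<zeta> \<in> test_functions \<Longrightarrow> (LINT x|lebesgue. w x \<bullet> gradient \<zeta> x) = (LINT x|lebesgue. f x \<bullet> gradient \<zeta> x))
        \<Longrightarrow> (LINT x|lebesgue. (norm (g x))\<^sup>2) \<le> (LINT x|lebesgue. (norm (w x))\<^sup>2)"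
proof -
  define I where "I z = (LINT x|lebesgue. (norm (f x - gradient z x))\<^sup>2)" for z
  define d where "d = Inf (I ` test_functions)"
  have bdd: "bdd_below (I ` test_functions)"
    by (rule bdd_belowI[of _ 0]) (auto simp: I_def)
  have dI: "d \<le> I z" if "z \<in> test_functions" for z
    unfolding d_def by (rule cInf_lower[OF _ bdd]) (use that in auto)
  \<comment> \<open>The tolerance 16^-n for the squared distance becomes 4^-n after taking a square
    root, and 4^-n is summable.\<close>
  have "\<exists>z\<in>test_functions. I z < d + (1/16) ^ n" for n :: nat
  proof -
    have "Inf (I ` test_functions) < d + (1/16) ^ n" by (simp add: d_def)
    from cInf_lessD[OF _ this] show ?thesis using zero_test by blast
  qed
  then obtain z where z: "\<And>n. z n \<in> test_functions" and Iz: "\<And>n. I (z n) < d + (1/16) ^ n"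
    by metis
  note gL2 = gradient_L2
  have rL2: "(\<lambda>x. f x - gradient (z n) x) \<in> Lp_space 2 lebesgue" for n
    by (intro L2_diff f gL2 z)
  define N where "N v = sqrt (LINT x|lebesgue. (norm (v x))\<^sup>2)" for v :: "real^'n \<Rightarrow> real^'n"
  \<comment> \<open>Near minimality implies near orthogonality: moving z n along
    \<open>\<zeta>\<close> cannot lower the energy by more than the tolerance, so a quadratic
    polynomial in t is nonnegative and its discriminant is bounded.\<close>
  have orth: "\<bar>LINT x|lebesgue. (f x - gradient (z n) x) \<bullet> gradient \<zeta> x\<bar> \<le> (1/4) ^ n * N (gradient \<zeta>)"
    if \<zeta>: "\<zeta> \<in> test_functions" for n \<zeta>
  proof -
    define B where "B = (LINT x|lebesgue. (f x - gradient (z n) x) \<bullet> gradient \<zeta> x)"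
    define C where "C = (LINT x|lebesgue. (norm (gradient \<zeta> x))\<^sup>2)"
    have "0 \<le> (1/16) ^ n + 2 * t * B + t\<^sup>2 * C" for t
    proof -
      have "d \<le> I (\<lambda>x. z n x + (- t) * \<zeta> x)"
        by (intro dI test_add test_scale z \<zeta>)
      also have "\<dots> = (LINT x|lebesgue. (norm ((f x - gradient (z n) x) + t *\<^sub>R gradient \<zeta> x))\<^sup>2)"
        unfolding I_def gradient_add_scale[OF \<zeta> z] by (simp add: algebra_simps)
      also have "\<dots> = I (z n) + 2 * t * B + t\<^sup>2 * C"
        unfolding I_def B_def C_def by (rule L2_norm_add_scale[OF rL2 gL2[OF \<zeta>]])
      finally show ?thesis using Iz[of n] by linarith
    qed
    then have "B\<^sup>2 \<le> (1/16) ^ n * C" by (intro discriminant_bound) (auto simp: C_def)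
    then have "sqrt (B\<^sup>2) \<le> sqrt ((1/16) ^ n * C)" by (rule real_sqrt_le_mono)
    also have "\<dots> = (1/4) ^ n * sqrt C"
    proof -
      have "((1::real)/16) ^ n = ((1/4) ^ n)\<^sup>2" by (simp add: power2_eq_square flip: power_mult_distrib)
      then show ?thesis by (simp add: real_sqrt_mult)
    qed
    finally show ?thesis by (simp add: B_def C_def N_def)
  qed
  define y where "y n x = z (Suc n) x + - 1 * z n x" for n x
  have y: "y n \<in> test_functions" for n
    unfolding y_def[abs_def] by (intro test_add test_scale z)
  have gy: "gradient (y n) = (\<lambda>x. gradient (z (Suc n)) x - gradient (z n) x)" for n
    unfolding y_def[abs_def] by (rule gradient_diff[OF z z])
  \<comment> \<open>The gradient of \<open>y n\<close> is the difference of two residuals. Testing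
    both with \<open>y n\<close> itself bounds its norm by (4^-n + 4^-(n+1)), which is rounded up to
    2 times 4^-n.\<close>
  have Ny: "(LINT x|lebesgue. (norm (gradient (y n) x))\<^sup>2) \<le> 4 * (1/16) ^ n" for n
  proof -
    define A where "A = (LINT x|lebesgue. (norm (gradient (y n) x))\<^sup>2)"
    have A0: "A \<ge> 0" by (simp add: A_def)
    have "A = (LINT x|lebesgue. (f x - gradient (z n) x) \<bullet> gradient (y n) x - (f x - gradient (z (Suc n)) x) \<bullet> gradient (y n) x)"
      unfolding A_def by (simp add: gy power2_norm_eq_inner flip: inner_diff_left)
    also have "\<dots> = (LINT x|lebesgue. (f x - gradient (z n) x) \<bullet> gradient (y n) x) - (LINT x|lebesgue. (f x - gradient (z (Suc n)) x) \<bullet> gradient (y n) x)"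
      by (intro Bochner_Integration.integral_diff L2_integrable_inner rL2 gL2 y)
    also have "\<dots> \<le> (1/4) ^ n * N (gradient (y n)) + (1/4) ^ Suc n * N (gradient (y n))"
      using orth[OF y[of n], of n] orth[OF y[of n], of "Suc n"] by linarith
    also have "\<dots> \<le> 2 * (1/4) ^ n * sqrt A"
    proof -
      have "(1/4) ^ n * sqrt A \<ge> 0" using A0 by simp
      then show ?thesis by (simp add: N_def A_def)
    qed
    finally have "sqrt A * sqrt A \<le> 2 * (1/4) ^ n * sqrt A" using A0 by simp
    then have "sqrt A \<le> 2 * (1/4) ^ n"
      using A0 mult_right_le_imp_le[of "sqrt A" "sqrt A" "2 * (1/4) ^ n"] by (cases "A = 0") auto
    then have "(sqrt A)\<^sup>2 \<le> (2 * (1/4) ^ n)\<^sup>2" by (rule power_mono) (use A0 in simp)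
    also have "\<dots> = 4 * (1/16) ^ n"
    proof -
      have "((1::real)/16) ^ n = ((1/4) ^ n)\<^sup>2" by (simp add: power2_eq_square flip: power_mult_distrib)
      then show ?thesis by (simp add: power_mult_distrib)
    qed
    finally show ?thesis using A0 by (simp add: A_def)
  qed
  have grad_y: "(\<integral>\<^sup>+x\<in>ball 0 R. ennreal (norm (gradient (y n) x)) \<partial>lebesgue) \<le> ennreal ((4 + measure lebesgue (ball (0::real^'n) R)) * (1/4) ^ n)" for n R
  proof -
    have "(\<integral>\<^sup>+x\<in>ball 0 R. ennreal (norm (gradient (y n) x)) \<partial>lebesgue) \<le> ennreal (4 ^ n * (LINT x|lebesgue. (norm (gradient (y n) x))\<^sup>2) + measure lebesgue (ball (0::real^'n) R) / 4 ^ n)"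
      by (rule nn_integral_ball_le_L2[OF gL2[OF y]]) simp
    also have "\<dots> \<le> ennreal (4 ^ n * (4 * (1/16) ^ n) + measure lebesgue (ball (0::real^'n) R) / 4 ^ n)"
      using Ny[of n] by (intro ennreal_leI add_right_mono mult_left_mono) auto
    also have "4 ^ n * (4 * (1/16) ^ n) + measure lebesgue (ball (0::real^'n) R) / 4 ^ n = (4 + measure lebesgue (ball (0::real^'n) R)) * (1/4::real) ^ n"
    proof -
      have "(4::real) ^ n * (1/16) ^ n = (1/4) ^ n" by (simp flip: power_mult_distrib)
      then have "(4::real) ^ n * (4 * (1/16) ^ n) = 4 * (1/4) ^ n" by (metis mult.left_commute)
      then show ?thesis by (simp only: distrib_right) (simp add: power_one_over)
    qed
    finally show ?thesis .
  qed
  \<comment> \<open>The test functions themselves need not converge; removing the average over the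
    unit ball controls them by their gradients.\<close>
  define c where "c n = ball_average (z n)" for n
  have cy: "ball_average (y n) = c (Suc n) - c n" for n
    unfolding y_def[abs_def] c_def by (rule ball_average_diff[OF z z])
  have gloc: "locally_integrable (gradient (z n))" for n
    using gL2[OF z, of n] by (intro square_integrable_locally_integrable) (auto simp: Lp_space_2_iff)
  have gK: "(\<integral>\<^sup>+x\<in>ball 0 R. ennreal (norm (gradient (z (Suc n)) x - gradient (z n) x)) \<partial>lebesgue) \<le> ennreal ((4 + measure lebesgue (ball (0::real^'n) R)) * (1/4) ^ n)" for R n
    using grad_y[of n R] by (simp only: gy)
  obtain g where g: "locally_integrable g" "AE x in lebesgue. (\<lambda>n. gradient (z n) x) \<longlonglongrightarrow> g x"
    and glim0: "\<forall>k R B. k \<in> borel_measurable lebesgue \<longrightarrow> (\<forall>x. \<bar>k x\<bar> \<le> B) \<longrightarrow> (\<forall>x. x \<notin> ball 0 R \<longrightarrow> k x = 0) \<longrightarrow>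
      (\<lambda>n. LINT x|lebesgue. k x *\<^sub>R gradient (z n) x) \<longlonglongrightarrow> (LINT x|lebesgue. k x *\<^sub>R g x)"
    using L1_loc_limit[of "\<lambda>n. gradient (z n)", OF gloc gK] by blast
  have glim: "(\<lambda>n. LINT x|lebesgue. k x *\<^sub>R gradient (z n) x) \<longlonglongrightarrow> (LINT x|lebesgue. k x *\<^sub>R g x)"
    if "k \<in> borel_measurable lebesgue" "\<And>x. \<bar>k x\<bar> \<le> B" "\<And>x. x \<notin> ball 0 R \<Longrightarrow> k x = 0" for k R B
    using glim0 that by blast
  define P where "P R = 2 * R * measure lborel (ball (0::real^'n) (2 * R)) / measure lborel (ball (0::real^'n) 1)" for R
  \<comment> \<open>Poincare's inequality trades the ball of radius R for gradients on radius 3R.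
    This is harmless because the constant in \<open>L1_loc_limit\<close> may depend on R.\<close>
  have hK: "(\<integral>\<^sup>+x\<in>ball 0 R. ennreal (norm ((z (Suc n) x - c (Suc n)) - (z n x - c n))) \<partial>lebesgue)
     \<le> ennreal (P R * (4 + measure lebesgue (ball (0::real^'n) (3 * R))) * (1/4) ^ n)" if R: "R \<ge> 1" for R n
  proof -
    have P0: "P R \<ge> 0" using R by (simp add: P_def)
    have "(\<integral>\<^sup>+x\<in>ball 0 R. ennreal (norm ((z (Suc n) x - c (Suc n)) - (z n x - c n))) \<partial>lebesgue)
      = (\<integral>\<^sup>+x\<in>ball 0 R. ennreal \<bar>y n x - ball_average (y n)\<bar> \<partial>lborel)"
      unfolding cy by (simp add: nn_integral_completion y_def algebra_simps)
    also have "\<dots> \<le> ennreal (P R) * (\<integral>\<^sup>+x\<in>ball 0 (3 * R). ennreal (norm (gradient (y n) x)) \<partial>lborel)"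
      unfolding P_def by (rule poincare_ball_L1[OF y R])
    also have "\<dots> \<le> ennreal (P R) * ennreal ((4 + measure lebesgue (ball (0::real^'n) (3 * R))) * (1/4) ^ n)"
      using grad_y[of n "3 * R"] by (intro mult_left_mono) (simp_all add: nn_integral_completion)
    also have "\<dots> = ennreal (P R * (4 + measure lebesgue (ball (0::real^'n) (3 * R))) * (1/4) ^ n)"
      using P0 by (simp add: ennreal_mult[symmetric] mult.assoc)
    finally show ?thesis .
  qed
  obtain h where h: "locally_integrable h"
    and hlim0: "\<forall>k R B. k \<in> borel_measurable lebesgue \<longrightarrow> (\<forall>x. \<bar>k x\<bar> \<le> B) \<longrightarrow> (\<forall>x. x \<notin> ball 0 R \<longrightarrow> k x = 0) \<longrightarrow>
      (\<lambda>n. LINT x|lebesgue. k x *\<^sub>R (z n x - c n)) \<longlonglongrightarrow> (LINT x|lebesgue. k x *\<^sub>R h x)"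
    using L1_loc_limit[of "\<lambda>n x. z n x - c n", OF test_locally_integrable[OF z] hK] by blast
  have hlim: "(\<lambda>n. LINT x|lebesgue. k x *\<^sub>R (z n x - c n)) \<longlonglongrightarrow> (LINT x|lebesgue. k x *\<^sub>R h x)"
    if "k \<in> borel_measurable lebesgue" "\<And>x. \<bar>k x\<bar> \<le> B" "\<And>x. x \<notin> ball 0 R \<Longrightarrow> k x = 0" for k R B
    using hlim0 that by blast
  have tmeas: "\<zeta> \<in> borel_measurable lebesgue" if "\<zeta> \<in> test_functions" for \<zeta> :: "real^'n \<Rightarrow> real"
    using test_measurable[OF that] by (intro measurable_completion) simp
  have glim_test: "(\<lambda>n. LINT x|lebesgue. \<zeta> x * gradient (z n) x $ j) \<longlonglongrightarrow> (LINT x|lebesgue. \<zeta> x * g x $ j)"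
    if \<zeta>: "\<zeta> \<in> test_functions" for \<zeta> j
  proof -
    obtain R where R: "R > 0" "\<And>x. x \<notin> ball 0 R \<Longrightarrow> \<zeta> x = 0" using test_bounded_support[OF \<zeta>] by blast
    obtain B where B: "B > 0" "\<And>x. \<bar>\<zeta> x\<bar> \<le> B" using test_bounded[OF \<zeta>] by blast
    have int: "integrable lebesgue (\<lambda>x. \<zeta> x *\<^sub>R v x)" if v: "locally_integrable v" for v :: "real^'n \<Rightarrow> real^'n"
    proof (rule Bochner_Integration.integrable_bound)
      show "integrable lebesgue (\<lambda>x. B *\<^sub>R (indicator (ball 0 R) x *\<^sub>R v x))"
        using locally_integrable_bounded_set[OF v, of "ball 0 R"] by (intro integrable_scaleR_right) (auto simp: set_integrable_def)
      show "(\<lambda>x. \<zeta> x *\<^sub>R v x) \<in> borel_measurable lebesgue"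
        using tmeas[OF \<zeta>] locally_integrable_measurable[OF v] by measurable
      show "AE x in lebesgue. norm (\<zeta> x *\<^sub>R v x) \<le> norm (B *\<^sub>R (indicator (ball 0 R) x *\<^sub>R v x))"
      proof (rule AE_I2)
        fix x show "norm (\<zeta> x *\<^sub>R v x) \<le> norm (B *\<^sub>R (indicator (ball 0 R) x *\<^sub>R v x))"
          using B R(2)[of x] by (cases "x \<in> ball 0 R") (auto intro!: mult_right_mono)
      qed
    qed
    have comp: "(LINT x|lebesgue. \<zeta> x * v x $ j) = (LINT x|lebesgue. \<zeta> x *\<^sub>R v x) $ j" if v: "locally_integrable v" for v :: "real^'n \<Rightarrow> real^'n"
      using integral_bounded_linear[OF bounded_linear_vec_nth int[OF v], of j] by simp
    show ?thesis
      unfolding comp[OF g(1)] comp[OF gloc]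
      by (intro tendsto_vec_nth glim[OF tmeas[OF \<zeta>] B(2) R(2)])
  qed
  have weak: "(LINT x|lebesgue. \<zeta> x * g x $ j) = - (LINT x|lebesgue. partial_deriv j \<zeta> x * h x)"
    if \<zeta>: "\<zeta> \<in> test_functions" for \<zeta> j
  proof (rule LIMSEQ_unique[OF glim_test[OF \<zeta>]])
    have p: "partial_deriv j \<zeta> \<in> test_functions" by (rule test_partial[OF \<zeta>])
    obtain R where R: "R > 0" "\<And>x. x \<notin> ball 0 R \<Longrightarrow> partial_deriv j \<zeta> x = 0" using test_bounded_support[OF p] by blast
    obtain B where B: "B > 0" "\<And>x. \<bar>partial_deriv j \<zeta> x\<bar> \<le> B" using test_bounded[OF p] by blast
    \<comment> \<open>The subtracted constants disappear because a partial derivative of a test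
      function has integral 0.\<close>
    have eq: "(LINT x|lebesgue. \<zeta> x * gradient (z n) x $ j) = - (LINT x|lebesgue. partial_deriv j \<zeta> x *\<^sub>R (z n x - c n))" for n
    proof -
      have "(LINT x|lebesgue. \<zeta> x * gradient (z n) x $ j) = - (LINT x|lebesgue. partial_deriv j \<zeta> x * z n x)"
        using integration_by_parts_test[OF z[of n] \<zeta>, of j] by (simp add: gradient_def)
      also have "(LINT x|lebesgue. partial_deriv j \<zeta> x * z n x) = (LINT x|lebesgue. partial_deriv j \<zeta> x * (z n x - c n))"
      proof -
        have "integrable lebesgue (\<lambda>x. partial_deriv j \<zeta> x * z n x)"
          using p by (intro test_integrable test_mult z) (simp add: test_functions_def)
        then show ?thesis
          using test_integrable[OF p] integral_partial_deriv_eq_0[OF \<zeta>, of j] by (simp add: right_diff_distrib)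
      qed
      finally show ?thesis by simp
    qed
    show "(\<lambda>n. LINT x|lebesgue. \<zeta> x * gradient (z n) x $ j) \<longlonglongrightarrow> - (LINT x|lebesgue. partial_deriv j \<zeta> x * h x)"
      unfolding eq using hlim[OF tmeas[OF p] B(2) R(2)] by (intro tendsto_minus) simp
  qed
  \<comment> \<open>For admissible \<open>w\<close> the pairing of \<open>f\<close> with the
    gradient of \<open>z n\<close> is that of \<open>w\<close>. Near orthogonality and
    Cauchy-Schwarz therefore bound the norm of this gradient by N w + 4^-n, and Fatou's lemma passes
    to the limit.\<close>
  have fatou: "g \<in> Lp_space 2 lebesgue \<and> (LINT x|lebesgue. (norm (g x))\<^sup>2) \<le> (LINT x|lebesgue. (norm (w x))\<^sup>2)"
    if w: "w \<in> Lp_space 2 lebesgue" and wf: "\<And>\<zeta>. \<zeta> \<in> test_functions \<Longrightarrow> (LINT x|lebesgue. w x \<bullet> gradient \<zeta> x) = (LINT x|lebesgue. f x \<bullet> gradient \<zeta> x)" for w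
  proof -
    have gm[measurable]: "g \<in> borel_measurable lebesgue" by (rule locally_integrable_measurable[OF g(1)])
    have zm[measurable]: "gradient (z n) \<in> borel_measurable lebesgue" for n by (rule locally_integrable_measurable[OF gloc])
    have Nz: "(LINT x|lebesgue. (norm (gradient (z n) x))\<^sup>2) \<le> (N w + (1/4) ^ n)\<^sup>2" for n
    proof -
      define A where "A = (LINT x|lebesgue. (norm (gradient (z n) x))\<^sup>2)"
      have A0: "A \<ge> 0" by (simp add: A_def)
      have "A = (LINT x|lebesgue. f x \<bullet> gradient (z n) x - (f x - gradient (z n) x) \<bullet> gradient (z n) x)"
        unfolding A_def by (simp add: power2_norm_eq_inner flip: inner_diff_left)
      also have "\<dots> = (LINT x|lebesgue. f x \<bullet> gradient (z n) x) - (LINT x|lebesgue. (f x - gradient (z n) x) \<bullet> gradient (z n) x)"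
        by (intro Bochner_Integration.integral_diff L2_integrable_inner rL2 gL2 z f)
      also have "\<dots> \<le> N w * sqrt A + (1/4) ^ n * sqrt A"
        using orth[OF z[of n], of n] wf[OF z[of n]] L2_Cauchy_Schwarz[OF w gL2[OF z[of n]]]
        by (simp add: N_def A_def)
      finally have "sqrt A * sqrt A \<le> (N w + (1/4) ^ n) * sqrt A" using A0 by (simp add: distrib_right)
      moreover have "N w + (1/4) ^ n \<ge> 0" by (simp add: N_def)
      ultimately have "sqrt A \<le> N w + (1/4) ^ n"
        using A0 mult_right_le_imp_le[of "sqrt A" "sqrt A" "N w + (1/4) ^ n"] by (cases "A = 0") auto
      then have "(sqrt A)\<^sup>2 \<le> (N w + (1/4) ^ n)\<^sup>2" by (rule power_mono) (use A0 in simp)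
      then show ?thesis using A0 by (simp add: A_def)
    qed
    have "(\<integral>\<^sup>+x. ennreal ((norm (g x))\<^sup>2) \<partial>lebesgue) = (\<integral>\<^sup>+x. liminf (\<lambda>n. ennreal ((norm (gradient (z n) x))\<^sup>2)) \<partial>lebesgue)"
    proof (rule nn_integral_cong_AE)
      show "AE x in lebesgue. ennreal ((norm (g x))\<^sup>2) = liminf (\<lambda>n. ennreal ((norm (gradient (z n) x))\<^sup>2))"
        using g(2)
      proof eventually_elim
        case (elim x)
        have "(\<lambda>n. ennreal ((norm (gradient (z n) x))\<^sup>2)) \<longlonglongrightarrow> ennreal ((norm (g x))\<^sup>2)"
          by (intro tendsto_ennrealI tendsto_power tendsto_norm elim)
        then show ?case by (rule lim_imp_Liminf[OF trivial_limit_sequentially, symmetric])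
      qed
    qed
    also have "\<dots> \<le> liminf (\<lambda>n. \<integral>\<^sup>+x. ennreal ((norm (gradient (z n) x))\<^sup>2) \<partial>lebesgue)"
      by (rule nn_integral_liminf) measurable
    also have "\<dots> \<le> liminf (\<lambda>n. ennreal ((N w + (1/4) ^ n)\<^sup>2))"
    proof (intro Liminf_mono always_eventually allI)
      fix n
      have "(\<integral>\<^sup>+x. ennreal ((norm (gradient (z n) x))\<^sup>2) \<partial>lebesgue) = ennreal (LINT x|lebesgue. (norm (gradient (z n) x))\<^sup>2)"
        by (rule nn_integral_eq_integral) (use gL2[OF z, of n] in \<open>auto simp: Lp_space_2_iff\<close>)
      also have "\<dots> \<le> ennreal ((N w + (1/4) ^ n)\<^sup>2)" by (rule ennreal_leI[OF Nz])
      finally show "(\<integral>\<^sup>+x. ennreal ((norm (gradient (z n) x))\<^sup>2) \<partial>lebesgue) \<le> ennreal ((N w + (1/4) ^ n)\<^sup>2)" .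
    qed
    also have "\<dots> = ennreal ((N w + 0)\<^sup>2)"
    proof (rule lim_imp_Liminf)
      have "(\<lambda>n. (1/4::real) ^ n) \<longlonglongrightarrow> 0" by (rule LIMSEQ_realpow_zero) auto
      then show "(\<lambda>n. ennreal ((N w + (1/4) ^ n)\<^sup>2)) \<longlonglongrightarrow> ennreal ((N w + 0)\<^sup>2)" by (intro tendsto_ennrealI tendsto_power tendsto_add tendsto_const)
    qed simp
    also have "\<dots> = ennreal (LINT x|lebesgue. (norm (w x))\<^sup>2)" by (simp add: N_def)
    finally have le: "(\<integral>\<^sup>+x. ennreal ((norm (g x))\<^sup>2) \<partial>lebesgue) \<le> ennreal (LINT x|lebesgue. (norm (w x))\<^sup>2)" .
    have int: "integrable lebesgue (\<lambda>x. (norm (g x))\<^sup>2)"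
      by (rule integrableI_nonneg) (use le in \<open>auto simp: le_less_trans\<close>)
    have "ennreal (LINT x|lebesgue. (norm (g x))\<^sup>2) \<le> ennreal (LINT x|lebesgue. (norm (w x))\<^sup>2)"
      using le nn_integral_eq_integral[OF int] by simp
    then show ?thesis using int gm by (simp add: Lp_space_2_iff ennreal_le_iff)
  qed
  \<comment> \<open>The field \<open>f\<close> is itself an admissible competitor, which yields
    square integrability of \<open>g\<close>.\<close>
  have gL: "g \<in> Lp_space 2 lebesgue" using fatou[OF f] by simp
  have fg: "(LINT x|lebesgue. f x \<bullet> gradient \<zeta> x) = (LINT x|lebesgue. g x \<bullet> gradient \<zeta> x)" if \<zeta>: "\<zeta> \<in> test_functions" for \<zeta>
  proof -
    have sum: "(LINT x|lebesgue. v x \<bullet> gradient \<zeta> x) = (\<Sum>j\<in>UNIV. LINT x|lebesgue. partial_deriv j \<zeta> x * v x $ j)" if v: "locally_integrable v" for v :: "real^'n \<Rightarrow> real^'n"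
    proof -
      have "integrable lebesgue (\<lambda>x. partial_deriv j \<zeta> x * v x $ j)" for j
        by (intro locally_integrable_mult_test locally_integrable_vec_nth test_partial \<zeta> v)
      then show ?thesis by (simp add: inner_vec_def gradient_def mult.commute[of "v _ $ _"])
    qed
    have "(\<lambda>n. LINT x|lebesgue. gradient (z n) x \<bullet> gradient \<zeta> x) \<longlonglongrightarrow> (LINT x|lebesgue. g x \<bullet> gradient \<zeta> x)"
      unfolding sum[OF g(1)] sum[OF gloc] by (intro tendsto_sum glim_test test_partial \<zeta>)
    \<comment> \<open>The residuals become orthogonal to each fixed gradient, so the pairings of
      \<open>f\<close> and of the limit \<open>g\<close> agree.\<close>
    moreover have "(\<lambda>n. (LINT x|lebesgue. f x \<bullet> gradient \<zeta> x) - (LINT x|lebesgue. gradient (z n) x \<bullet> gradient \<zeta> x)) \<longlonglongrightarrow> 0"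
    proof (rule Lim_null_comparison)
      show "\<forall>\<^sub>F n in sequentially. norm ((LINT x|lebesgue. f x \<bullet> gradient \<zeta> x) - (LINT x|lebesgue. gradient (z n) x \<bullet> gradient \<zeta> x)) \<le> (1/4) ^ n * N (gradient \<zeta>)"
      proof (intro always_eventually allI)
        fix n
        have "(LINT x|lebesgue. f x \<bullet> gradient \<zeta> x) - (LINT x|lebesgue. gradient (z n) x \<bullet> gradient \<zeta> x) = (LINT x|lebesgue. (f x - gradient (z n) x) \<bullet> gradient \<zeta> x)"
          unfolding inner_diff_left
          by (rule Bochner_Integration.integral_diff[symmetric]) (intro L2_integrable_inner f gL2 z \<zeta>)+
        then show "norm ((LINT x|lebesgue. f x \<bullet> gradient \<zeta> x) - (LINT x|lebesgue. gradient (z n) x \<bullet> gradient \<zeta> x)) \<le> (1/4) ^ n * N (gradient \<zeta>)"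
          using orth[OF \<zeta>, of n] by simp
      qed
      show "(\<lambda>n. (1/4) ^ n * N (gradient \<zeta>)) \<longlonglongrightarrow> 0"
        by (intro tendsto_mult_left_zero LIMSEQ_realpow_zero) auto
    qed
    ultimately have "(\<lambda>n. LINT x|lebesgue. f x \<bullet> gradient \<zeta> x) \<longlonglongrightarrow> 0 + (LINT x|lebesgue. g x \<bullet> gradient \<zeta> x)"
      using tendsto_add by fastforce
    then show ?thesis by (simp add: LIMSEQ_const_iff)
  qed
  show ?thesis
    by (rule that[OF h gL weak fg]) (use fatou in auto)
qed

subsection \<open>Symmetry of second partial derivatives\<close>

text \<open>The mean value theorem is used twice: in direction j for the difference in direction k,
  and then in direction k for the resulting derivative.\<close>

lemma second_difference_mean_value:
  assumes z: "z \<in> test_functions" and h: "h > 0"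
  obtains p q where "0 < p" "p < h" "0 < q" "q < h"
    "z (x + h *\<^sub>R axis k 1 + h *\<^sub>R axis j 1) - z (x + h *\<^sub>R axis j 1) - z (x + h *\<^sub>R axis k 1) + z x
      = h * (h * partial_deriv k (partial_deriv j z) (x + p *\<^sub>R axis j 1 + q *\<^sub>R axis k 1))"
proof -
  define a where "a t = z (x + h *\<^sub>R axis k 1 + t *\<^sub>R axis j 1) - z (x + t *\<^sub>R axis j 1)" for t
  have da: "(a has_real_derivative partial_deriv j z (x + h *\<^sub>R axis k 1 + t *\<^sub>R axis j 1) - partial_deriv j z (x + t *\<^sub>R axis j 1)) (at t)" for t
    unfolding a_def[abs_def] gradient_axis[symmetric]
    by (intro DERIV_diff test_DERIV_line z)
  obtain p where p: "0 < p" "p < h" "a h - a 0 = (h - 0) * (partial_deriv j z (x + h *\<^sub>R axis k 1 + p *\<^sub>R axis j 1) - partial_deriv j z (x + p *\<^sub>R axis j 1))"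
    using MVT2[OF h da] by blast
  define b where "b t = partial_deriv j z (x + p *\<^sub>R axis j 1 + t *\<^sub>R axis k 1)" for t
  have db: "(b has_real_derivative partial_deriv k (partial_deriv j z) (x + p *\<^sub>R axis j 1 + t *\<^sub>R axis k 1)) (at t)" for t
    unfolding b_def[abs_def] gradient_axis[symmetric, where z = "partial_deriv j z"]
    by (intro test_DERIV_line test_partial z)
  obtain q where q: "0 < q" "q < h" "b h - b 0 = (h - 0) * partial_deriv k (partial_deriv j z) (x + p *\<^sub>R axis j 1 + q *\<^sub>R axis k 1)"
    using MVT2[OF h db] by blast
  have "a h - a 0 = h * (b h - b 0)"
    using p(3) by (simp add: b_def add_ac)
  with q(3) have "a h - a 0 = h * (h * partial_deriv k (partial_deriv j z) (x + p *\<^sub>R axis j 1 + q *\<^sub>R axis k 1))"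
    by simp
  then show ?thesis
    by (intro that[OF p(1,2) q(1,2)]) (simp add: a_def)
qed

text \<open>The intermediate points lie within the step size of \<open>x\<close>, and the second
  derivative is continuous.\<close>

lemma second_difference_quotient_tendsto:
  assumes z: "z \<in> test_functions"
  shows "(\<lambda>n. (z (x + inverse (real (Suc n)) *\<^sub>R axis k 1 + inverse (real (Suc n)) *\<^sub>R axis j 1)
        - z (x + inverse (real (Suc n)) *\<^sub>R axis j 1) - z (x + inverse (real (Suc n)) *\<^sub>R axis k 1) + z x)
          / (inverse (real (Suc n)))\<^sup>2) \<longlonglongrightarrow> partial_deriv k (partial_deriv j z) x"
proof -
  define h where "h n = inverse (real (Suc n))" for n
  have h: "h n > 0" for n by (simp add: h_def)
  have "\<exists>p q. 0 < p \<and> p < h n \<and> 0 < q \<and> q < h n \<and>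
     z (x + h n *\<^sub>R axis k 1 + h n *\<^sub>R axis j 1) - z (x + h n *\<^sub>R axis j 1) - z (x + h n *\<^sub>R axis k 1) + z x
      = h n * (h n * partial_deriv k (partial_deriv j z) (x + p *\<^sub>R axis j 1 + q *\<^sub>R axis k 1))" for n
    using second_difference_mean_value[OF z h, of n x k j] by metis
  then obtain p q where pq: "\<And>n. 0 < p n" "\<And>n. p n < h n" "\<And>n. 0 < q n" "\<And>n. q n < h n"
     "\<And>n. z (x + h n *\<^sub>R axis k 1 + h n *\<^sub>R axis j 1) - z (x + h n *\<^sub>R axis j 1) - z (x + h n *\<^sub>R axis k 1) + z x
      = h n * (h n * partial_deriv k (partial_deriv j z) (x + p n *\<^sub>R axis j 1 + q n *\<^sub>R axis k 1))"
    by metis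
  have hl: "h \<longlonglongrightarrow> 0" unfolding h_def by (rule LIMSEQ_inverse_real_of_nat)
  have "p \<longlonglongrightarrow> 0"
    by (rule tendsto_sandwich[OF _ _ tendsto_const hl]) (auto intro!: always_eventually simp: pq less_imp_le)
  moreover have "q \<longlonglongrightarrow> 0"
    by (rule tendsto_sandwich[OF _ _ tendsto_const hl]) (auto intro!: always_eventually simp: pq less_imp_le)
  ultimately have "(\<lambda>n. x + p n *\<^sub>R axis j 1 + q n *\<^sub>R axis k 1) \<longlonglongrightarrow> x + 0 *\<^sub>R axis j 1 + 0 *\<^sub>R axis k 1"
    by (intro tendsto_intros)
  then have "(\<lambda>n. x + p n *\<^sub>R axis j 1 + q n *\<^sub>R axis k 1) \<longlonglongrightarrow> x" by simp
  then have "(\<lambda>n. partial_deriv k (partial_deriv j z) (x + p n *\<^sub>R axis j 1 + q n *\<^sub>R axis k 1)) \<longlonglongrightarrow> partial_deriv k (partial_deriv j z) x"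
    by (rule continuous_on_tendsto_compose[OF test_continuous[OF test_partial[OF test_partial[OF z]]]]) auto
  moreover have "(z (x + h n *\<^sub>R axis k 1 + h n *\<^sub>R axis j 1) - z (x + h n *\<^sub>R axis j 1) - z (x + h n *\<^sub>R axis k 1) + z x) / (h n)\<^sup>2
     = partial_deriv k (partial_deriv j z) (x + p n *\<^sub>R axis j 1 + q n *\<^sub>R axis k 1)" for n
    unfolding pq(5) using h[of n] by (simp add: power2_eq_square)
  ultimately show ?thesis unfolding h_def by simp
qed

text \<open>The second difference is symmetric in the two directions, so its quotient converges to
  both mixed derivatives.\<close>

lemma partial_deriv_commute:
  assumes z: "z \<in> test_functions"
  shows "partial_deriv k (partial_deriv j z) = partial_deriv j (partial_deriv k z)"
proof
  fix x
  show "partial_deriv k (partial_deriv j z) x = partial_deriv j (partial_deriv k z) x"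
    by (rule LIMSEQ_unique[OF second_difference_quotient_tendsto[OF z, of x k j]])
       (use second_difference_quotient_tendsto[OF z, of x j k] in \<open>simp add: algebra_simps\<close>)
qed

lemma test_sum: "finite J \<Longrightarrow> (\<And>k. k \<in> J \<Longrightarrow> f k \<in> test_functions) \<Longrightarrow> (\<lambda>x. \<Sum>k\<in>J. f k x) \<in> test_functions"
  by (induction J rule: finite_induct) (auto simp: zero_test intro!: test_add)

lemma laplacian_test: "z \<in> test_functions \<Longrightarrow> laplacian z \<in> test_functions"
  unfolding laplacian_def[abs_def] by (intro test_sum test_partial) auto

text \<open>Needed to move the Laplacian from a potential to the entries of its weak
  gradient.\<close>

lemma partial_deriv_laplacian:
  assumes z: "z \<in> test_functions"
  shows "partial_deriv j (laplacian z) = laplacian (partial_deriv j z)"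
proof
  fix x
  have "(laplacian z has_derivative (\<lambda>h. \<Sum>k\<in>UNIV. gradient (partial_deriv k (partial_deriv k z)) x \<bullet> h)) (at x)"
    unfolding laplacian_def[abs_def]
    by (intro has_derivative_sum test_has_derivative test_partial z)
  then have "partial_deriv j (laplacian z) x = (\<Sum>k\<in>UNIV. partial_deriv j (partial_deriv k (partial_deriv k z)) x)"
    using partial_deriv_eqI[of "laplacian z" _ x j] by (simp add: gradient_axis)
  also have "\<dots> = laplacian (partial_deriv j z) x"
    unfolding laplacian_def
    by (simp add: partial_deriv_commute[OF test_partial[OF z], of j] partial_deriv_commute[OF z, of j])
  finally show "partial_deriv j (laplacian z) x = laplacian (partial_deriv j z) x" .
qed

subsection \<open>Potentials of matrix fields\<close>

lemma integrable_vecI: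
  fixes f :: "'a \<Rightarrow> real^'l"
  assumes "\<And>i. integrable M (\<lambda>x. f x $ i)"
  shows "integrable M f"
proof -
  have "integrable M (\<lambda>x. \<Sum>i\<in>UNIV. (f x $ i) *\<^sub>R axis i (1::real))"
    by (intro Bochner_Integration.integrable_sum integrable_scaleR_left assms) 
  then show ?thesis by (simp add: basis_expansion scalar_mult_eq_scaleR[symmetric])
qed

lemma integral_vec_nth:
  fixes f :: "'a \<Rightarrow> real^'l"
  shows "integrable M f \<Longrightarrow> (LINT x|M. f x) $ i = (LINT x|M. f x $ i)"
  by (rule integral_bounded_linear[OF bounded_linear_vec_nth, symmetric])

text \<open>The form with inner products suits L2 arguments row by row; the form with entries suits
  integration by parts.\<close>

lemma distr_div_nth:
  fixes F :: "real^'n \<Rightarrow> real^'n^'l"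
  assumes F: "locally_integrable F" and z: "z \<in> test_functions"
  shows "distr_div F z $ i = - (LINT x|lebesgue. F x $ i \<bullet> gradient z x)"
    "distr_div F z $ i = - (\<Sum>j\<in>UNIV. LINT x|lebesgue. partial_deriv j z x * F x $ i $ j)"
proof -
  have int: "integrable lebesgue (\<lambda>x. partial_deriv j z x * F x $ i $ j)" for i j
    by (intro locally_integrable_mult_test locally_integrable_vec_nth F test_partial z)
  have comp: "((F x) *v (gradient z x)) $ i = (\<Sum>j\<in>UNIV. partial_deriv j z x * F x $ i $ j)" for x i
    by (simp add: matrix_vector_mult_def gradient_def mult.commute)
  have "integrable lebesgue (\<lambda>x. F x *v gradient z x)"
    by (rule integrable_vecI) (simp add: comp int)
  then have eq: "distr_div F z $ i = - (LINT x|lebesgue. (\<Sum>j\<in>UNIV. partial_deriv j z x * F x $ i $ j))"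
    by (simp add: distr_div_def integral_vec_nth comp)
  then show "distr_div F z $ i = - (LINT x|lebesgue. F x $ i \<bullet> gradient z x)"
    by (simp add: inner_vec_def gradient_def mult.commute)
  show "distr_div F z $ i = - (\<Sum>j\<in>UNIV. LINT x|lebesgue. partial_deriv j z x * F x $ i $ j)"
    unfolding eq by (simp add: int)
qed

lemma distr_laplacian_nth:
  fixes H :: "real^'n \<Rightarrow> real^'l"
  assumes H: "locally_integrable H" and z: "z \<in> test_functions"
  shows "distr_laplacian H z $ i = (LINT x|lebesgue. laplacian z x * H x $ i)"
proof -
  have "integrable lebesgue (\<lambda>x. laplacian z x *\<^sub>R H x)"
    by (rule integrable_vecI) (simp add: locally_integrable_mult_test locally_integrable_vec_nth H laplacian_test z)
  then show ?thesis by (simp add: distr_laplacian_def integral_vec_nth)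
qed

lemma L2_vec_nth: 
  fixes F :: "'a \<Rightarrow> ('b::euclidean_space, 'l::finite) vec"
  assumes F: "F \<in> Lp_space 2 M"
  shows "(\<lambda>x. F x $ i) \<in> Lp_space 2 M"
proof -
  have m: "(\<lambda>x. F x $ i) \<in> borel_measurable M"
  proof -
    have "(\<lambda>v::('b, 'l) vec. v $ i) \<in> borel_measurable borel"
      by (intro borel_measurable_continuous_onI continuous_intros)
    then show ?thesis using F measurable_compose by (auto simp: Lp_space_2_iff)
  qed
  have "integrable M (\<lambda>x. (norm (F x $ i))\<^sup>2)"
  proof (rule Bochner_Integration.integrable_bound)
    show "integrable M (\<lambda>x. (norm (F x))\<^sup>2)" using F by (simp add: Lp_space_2_iff)
    show "(\<lambda>x. (norm (F x $ i))\<^sup>2) \<in> borel_measurable M" using m by measurable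
  qed (auto intro!: AE_I2 power_mono Finite_Cartesian_Product.norm_nth_le)
  with m show ?thesis by (simp add: Lp_space_2_iff)
qed

lemma norm_vec_sq: "(norm (v :: ('b::real_normed_vector, 'l::finite) vec))\<^sup>2 = (\<Sum>i\<in>UNIV. (norm (v $ i))\<^sup>2)"
  by (simp add: norm_vec_def L2_set_def sum_nonneg)

lemma measurable_vec_lambda:
  fixes f :: "'l::finite \<Rightarrow> 'a \<Rightarrow> 'b::euclidean_space"
  assumes f: "\<And>i. f i \<in> borel_measurable M"
  shows "(\<lambda>x. (\<chi> i. f i x)) \<in> borel_measurable M"
proof -
  have "(\<lambda>x. \<Sum>i\<in>UNIV. axis i (f i x)) \<in> borel_measurable M"
  proof (intro borel_measurable_sum)
    fix i :: 'l
    have "continuous_on UNIV (\<lambda>x::'b. if k = i then x else 0)" for k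
      by (cases "k = i") auto
    then have "continuous_on UNIV (axis i :: 'b \<Rightarrow> ('b, 'l) vec)"
      unfolding axis_def by (intro continuous_on_vec_lambda)
    then show "(\<lambda>x. axis i (f i x)) \<in> borel_measurable M"
      by (intro measurable_compose[OF f[of i]] borel_measurable_continuous_onI)
  qed
  moreover have "(\<Sum>i\<in>UNIV. axis i (f i x)) = (\<chi> i. f i x)" for x
    by (simp add: vec_eq_iff axis_def if_distrib[of "\<lambda>t. t $ _"] sum.delta' cong: if_cong)
  ultimately show ?thesis by simp
qed

lemma L2_vecI:
  fixes F :: "'a \<Rightarrow> ('b::euclidean_space, 'l::finite) vec"
  assumes F: "\<And>i. (\<lambda>x. F x $ i) \<in> Lp_space 2 M"
  shows "F \<in> Lp_space 2 M"
proof -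
  have "(\<lambda>x. (\<chi> i. F x $ i)) \<in> borel_measurable M"
    by (rule measurable_vec_lambda) (use F in \<open>simp add: Lp_space_2_iff\<close>)
  then show ?thesis using F unfolding Lp_space_2_iff norm_vec_sq[of "F _"] by auto
qed

lemma integral_norm_vec_sq:
  fixes F :: "'a \<Rightarrow> ('b::euclidean_space, 'l::finite) vec"
  assumes F: "F \<in> Lp_space 2 M"
  shows "(LINT x|M. (norm (F x))\<^sup>2) = (\<Sum>i\<in>UNIV. LINT x|M. (norm (F x $ i))\<^sup>2)"
  using L2_vec_nth[OF F] unfolding Lp_space_2_iff norm_vec_sq[of "F _"] by simp

lemma L2_locally_integrable: "F \<in> Lp_space 2 lebesgue \<Longrightarrow> locally_integrable F"
  by (rule square_integrable_locally_integrable) (auto simp: Lp_space_2_iff)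

lemma locally_integrable_vecI:
  fixes H :: "real^'n \<Rightarrow> real^'l"
  assumes "\<And>i. locally_integrable (\<lambda>x. H x $ i)"
  shows "locally_integrable H"
  using assms unfolding locally_integrable_def set_integrable_def by (auto intro!: integrable_vecI)

text \<open>The definition of the weak gradient is tested with the partial derivatives of
  \<open>z\<close>, which are test functions again.\<close>

lemma weak_gradient_distr_laplacian:
  fixes H :: "real^'n \<Rightarrow> real^'l"
  assumes HG: "has_weak_gradient H G" and z: "z \<in> test_functions"
  shows "distr_laplacian H z = distr_div G z"
proof (rule vec_eq_iff[THEN iffD2], rule allI)
  fix i
  have H: "locally_integrable H" and G: "locally_integrable G"
    and ibp: "\<And>\<zeta> i j. \<zeta> \<in> test_functions \<Longrightarrow> (LINT x|lebesgue. \<zeta> x * G x $ i $ j) = - (LINT x|lebesgue. partial_deriv j \<zeta> x * H x $ i)"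
    using HG by (auto simp: has_weak_gradient_def)
  have "integrable lebesgue (\<lambda>x. partial_deriv j (partial_deriv j z) x * H x $ i)" for j
    by (intro locally_integrable_mult_test locally_integrable_vec_nth H test_partial z)
  then have "distr_laplacian H z $ i = (\<Sum>j\<in>UNIV. LINT x|lebesgue. partial_deriv j (partial_deriv j z) x * H x $ i)"
    unfolding distr_laplacian_nth[OF H z] laplacian_def by (simp add: sum_distrib_right)
  also have "\<dots> = (\<Sum>j\<in>UNIV. - (LINT x|lebesgue. partial_deriv j z x * G x $ i $ j))"
    by (simp add: ibp test_partial z)
  also have "\<dots> = distr_div G z $ i"
    unfolding distr_div_nth(2)[OF G z] by (simp add: sum_negf)
  finally show "distr_laplacian H z $ i = distr_div G z $ i" .
qed

text \<open>The divergence acts on each row separately and the squared norm is the sum over the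
  rows, so the projection is carried out row by row and the minimality of the rows adds up.\<close>

lemma potential_exists:
  fixes F :: "real^'n \<Rightarrow> real^'n^'l"
  assumes F: "F \<in> Lp_space 2 lebesgue"
  shows "\<exists>H G. is_potential F H \<and> G \<in> Lp_space 2 lebesgue \<and> has_weak_gradient H G \<and>
    (\<forall>w\<in>Lp_space 2 lebesgue. (\<forall>z\<in>test_functions. distr_div w z = distr_div F z) \<longrightarrow>
       (LINT x|lebesgue. (norm (G x))\<^sup>2) \<le> (LINT x|lebesgue. (norm (w x))\<^sup>2))"
proof -
  \<comment> \<open>All conclusions are gathered in one predicate so that the potential and the
    gradient of each row can be chosen together.\<close>
  define Pr where "Pr i h g \<longleftrightarrow> locally_integrable h \<and> g \<in> Lp_space 2 lebesgue \<and>
     (\<forall>\<zeta> j. \<zeta> \<in> test_functions \<longrightarrow> (LINT x|lebesgue. \<zeta> x * g x $ j) = - (LINT x|lebesgue. partial_deriv j \<zeta> x * h x)) \<and>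
     (\<forall>\<zeta>. \<zeta> \<in> test_functions \<longrightarrow> (LINT x|lebesgue. F x $ i \<bullet> gradient \<zeta> x) = (LINT x|lebesgue. g x \<bullet> gradient \<zeta> x)) \<and>
     (\<forall>w. w \<in> Lp_space 2 lebesgue \<longrightarrow> (\<forall>\<zeta>. \<zeta> \<in> test_functions \<longrightarrow> (LINT x|lebesgue. w x \<bullet> gradient \<zeta> x) = (LINT x|lebesgue. F x $ i \<bullet> gradient \<zeta> x))
        \<longrightarrow> (LINT x|lebesgue. (norm (g x))\<^sup>2) \<le> (LINT x|lebesgue. (norm (w x))\<^sup>2))"
    for i and h :: "real^'n \<Rightarrow> real" and g :: "real^'n \<Rightarrow> real^'n"
  have "\<exists>h g. Pr i h g" for i
    unfolding Pr_def by (rule gradient_projection[OF L2_vec_nth[OF F, of i]]) blast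
  then obtain h g where hg: "\<And>i. Pr i (h i) (g i)" by metis
  have h: "\<And>i. locally_integrable (h i)" and g: "\<And>i. g i \<in> Lp_space 2 lebesgue"
    and ibp: "\<And>i \<zeta> j. \<zeta> \<in> test_functions \<Longrightarrow> (LINT x|lebesgue. \<zeta> x * g i x $ j) = - (LINT x|lebesgue. partial_deriv j \<zeta> x * h i x)"
    and fg: "\<And>i \<zeta>. \<zeta> \<in> test_functions \<Longrightarrow> (LINT x|lebesgue. F x $ i \<bullet> gradient \<zeta> x) = (LINT x|lebesgue. g i x \<bullet> gradient \<zeta> x)"
    and min: "\<And>i w. w \<in> Lp_space 2 lebesgue \<Longrightarrow> (\<forall>\<zeta>. \<zeta> \<in> test_functions \<longrightarrow> (LINT x|lebesgue. w x \<bullet> gradient \<zeta> x) = (LINT x|lebesgue. F x $ i \<bullet> gradient \<zeta> x))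
        \<Longrightarrow> (LINT x|lebesgue. (norm (g i x))\<^sup>2) \<le> (LINT x|lebesgue. (norm (w x))\<^sup>2)"
    using hg unfolding Pr_def by blast+
  define H where "H x = (\<chi> i. h i x)" for x
  define G where "G x = (\<chi> i. g i x)" for x
  have H: "locally_integrable H" by (rule locally_integrable_vecI) (simp add: H_def h)
  have G: "G \<in> Lp_space 2 lebesgue" by (rule L2_vecI) (simp add: G_def g)
  note Gl = L2_locally_integrable[OF G] and Fl = L2_locally_integrable[OF F]
  have wg: "has_weak_gradient H G"
    using H Gl ibp by (simp add: has_weak_gradient_def H_def G_def)
  have divs: "distr_div G z = distr_div F z" if z: "z \<in> test_functions" for z
    using fg[OF z] by (simp add: vec_eq_iff distr_div_nth(1)[OF Gl z] distr_div_nth(1)[OF Fl z] G_def)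
  have pot: "is_potential F H"
    unfolding is_potential_def using H G wg weak_gradient_distr_laplacian[OF wg] divs by auto
  have "(LINT x|lebesgue. (norm (G x))\<^sup>2) \<le> (LINT x|lebesgue. (norm (w x))\<^sup>2)"
    if w: "w \<in> Lp_space 2 lebesgue" and wF: "\<forall>z\<in>test_functions. distr_div w z = distr_div F z" for w
  proof -
    note wl = L2_locally_integrable[OF w]
    have "(LINT x|lebesgue. w x $ i \<bullet> gradient \<zeta> x) = (LINT x|lebesgue. F x $ i \<bullet> gradient \<zeta> x)" if \<zeta>: "\<zeta> \<in> test_functions" for \<zeta> i
      using arg_cong[OF bspec[OF wF \<zeta>], of "\<lambda>v. v $ i"] by (simp add: distr_div_nth(1)[OF wl \<zeta>] distr_div_nth(1)[OF Fl \<zeta>])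
    then have "(LINT x|lebesgue. (norm (g i x))\<^sup>2) \<le> (LINT x|lebesgue. (norm (w x $ i))\<^sup>2)" for i
      by (intro min L2_vec_nth w) auto
    then show ?thesis
      unfolding integral_norm_vec_sq[OF G] integral_norm_vec_sq[OF w] by (intro sum_mono) (simp add: G_def)
  qed
  with pot G wg show ?thesis by blast
qed

lemma locally_integrable_diff:
  "locally_integrable f \<Longrightarrow> locally_integrable g \<Longrightarrow> locally_integrable (\<lambda>x. f x - g x)"
  by (simp add: locally_integrable_def set_integral_diff(1))

lemma AE_eq_vecI: "(\<And>i. AE x in M. f x $ i = g x $ i) \<Longrightarrow> AE x in M. f x = (g x :: ('b, 'l::finite) vec)"
  by (simp add: vec_eq_iff eventually_all_finite)

lemma weak_gradient_unique:
  fixes H :: "real^'n \<Rightarrow> real^'l"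
  assumes "has_weak_gradient H G" "has_weak_gradient H G'"
  shows "AE x in lebesgue. G x = G' x"
proof (intro AE_eq_vecI)
  fix i j
  have G: "locally_integrable (\<lambda>x. G x $ i $ j)" "locally_integrable (\<lambda>x. G' x $ i $ j)"
    using assms by (auto simp: has_weak_gradient_def intro!: locally_integrable_vec_nth)
  have "AE x in lebesgue. G x $ i $ j - G' x $ i $ j = 0"
  proof (rule fundamental_lemma[OF locally_integrable_diff[OF G]])
    fix z :: "real^'n \<Rightarrow> real" assume z: "z \<in> test_functions"
    have "(LINT x|lebesgue. z x * G x $ i $ j) = (LINT x|lebesgue. z x * G' x $ i $ j)"
      using assms z by (auto simp: has_weak_gradient_def)
    then show "(LINT x|lebesgue. z x * (G x $ i $ j - G' x $ i $ j)) = 0"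
      using locally_integrable_mult_test[OF G(1) z] locally_integrable_mult_test[OF G(2) z]
      by (simp add: right_diff_distrib)
  qed
  then show "AE x in lebesgue. G x $ i $ j = G' x $ i $ j" by simp
qed

text \<open>The right-hand side involves \<open>F\<close> only. Hence the gradients of two
  potentials of \<open>F\<close> differ by weakly harmonic functions.\<close>

lemma potential_weak_gradient_laplacian:
  fixes H :: "real^'n \<Rightarrow> real^'l"
  assumes pot: "is_potential F H" and HG: "has_weak_gradient H G" and z: "z \<in> test_functions"
  shows "(LINT x|lebesgue. laplacian z x * G x $ i $ j) = - distr_div F (partial_deriv j z) $ i"
proof -
  have H: "locally_integrable H" using HG by (simp add: has_weak_gradient_def)
  have "(LINT x|lebesgue. laplacian z x * G x $ i $ j) = - (LINT x|lebesgue. laplacian (partial_deriv j z) x * H x $ i)"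
    using HG laplacian_test[OF z] unfolding partial_deriv_laplacian[OF z, symmetric] has_weak_gradient_def by blast
  also have "\<dots> = - distr_laplacian H (partial_deriv j z) $ i"
    by (simp add: distr_laplacian_nth H test_partial z)
  also have "\<dots> = - distr_div F (partial_deriv j z) $ i"
    using pot test_partial[OF z, of j] by (simp add: is_potential_def)
  finally show ?thesis .
qed

text \<open>Liouville's theorem is applied to the entries of the difference of the gradients. These
  are square integrable, whereas the potentials need not be.\<close>

lemma potential_gradient_unique:
  fixes H :: "real^'n \<Rightarrow> real^'l"
  assumes "is_potential F H" "has_weak_gradient H G" "G \<in> Lp_space 2 lebesgue"
    and "is_potential F H'" "has_weak_gradient H' G'" "G' \<in> Lp_space 2 lebesgue"
  shows "AE x in lebesgue. G x = G' x"
proof (intro AE_eq_vecI)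
  fix i j
  have L2: "(\<lambda>x. G x $ i $ j) \<in> Lp_space 2 lebesgue" "(\<lambda>x. G' x $ i $ j) \<in> Lp_space 2 lebesgue"
    using assms by (auto intro!: L2_vec_nth)
  note D = L2_diff[OF L2]
  have "AE x in lebesgue. G x $ i $ j - G' x $ i $ j = 0"
  proof (rule liouville_square_integrable)
    show "(\<lambda>x. G x $ i $ j - G' x $ i $ j) \<in> borel_measurable lebesgue"
      "integrable lebesgue (\<lambda>x. (G x $ i $ j - G' x $ i $ j)\<^sup>2)"
      using D by (simp_all add: Lp_space_2_iff)
    fix c s :: real and y :: "real^'n" assume "c > 0" "s > 0"
    then have z: "cap_bump c s y \<in> test_functions" by (rule cap_bump_test)
    have "integrable lebesgue (\<lambda>x. laplacian (cap_bump c s y) x * G x $ i $ j)"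
      "integrable lebesgue (\<lambda>x. laplacian (cap_bump c s y) x * G' x $ i $ j)"
      by (intro locally_integrable_mult_test laplacian_test z L2_locally_integrable L2)+
    then show "(LINT x|lebesgue. laplacian (cap_bump c s y) x * (G x $ i $ j - G' x $ i $ j)) = 0"
      using potential_weak_gradient_laplacian[OF assms(1,2) z, of i j] potential_weak_gradient_laplacian[OF assms(4,5) z, of i j]
      by (simp add: right_diff_distrib)
  qed
  then show "AE x in lebesgue. G x $ i $ j = G' x $ i $ j" by simp
qed

text \<open>The properties hold for the pair \<open>H0\<close>, \<open>G0\<close> obtained by
  projection. Integrals of G and of G0 agree since the two fields are equal almost
  everywhere.\<close>

lemma Hbar_gradient:
  fixes F :: "real^'n \<Rightarrow> real^'n^'l"
  assumes F: "F \<in> Lp_space 2 lebesgue"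
  shows "weak_gradient (Hbar F) \<in> Lp_space 2 lebesgue"
    and "z \<in> test_functions \<Longrightarrow> distr_div (weak_gradient (Hbar F)) z = distr_div F z"
    and "w \<in> Lp_space 2 lebesgue \<Longrightarrow> (\<And>z. z \<in> test_functions \<Longrightarrow> distr_div w z = distr_div F z) \<Longrightarrow>
       (LINT x|lebesgue. (norm (weak_gradient (Hbar F) x))\<^sup>2) \<le> (LINT x|lebesgue. (norm (w x))\<^sup>2)"
proof -
  obtain H0 G0 where 0: "is_potential F H0" "has_weak_gradient H0 G0" "G0 \<in> Lp_space 2 lebesgue"
    and min: "\<And>w. w \<in> Lp_space 2 lebesgue \<Longrightarrow> (\<forall>z\<in>test_functions. distr_div w z = distr_div F z) \<Longrightarrow>
       (LINT x|lebesgue. (norm (G0 x))\<^sup>2) \<le> (LINT x|lebesgue. (norm (w x))\<^sup>2)"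
    using potential_exists[OF F] by blast
  define H where "H = Hbar F"
  define G where "G = weak_gradient H"
  have H: "is_potential F H" unfolding H_def Hbar_def by (rule someI[of "is_potential F", OF 0(1)])
  \<comment> \<open>An intermediate field: the chosen weak gradient \<open>G\<close> is not yet
    known to lie in L2, while \<open>G1\<close> is. Uniqueness of weak gradients links G to G1, and
    Liouville's theorem links G1 to G0.\<close>
  then obtain G1 where G1: "G1 \<in> Lp_space 2 lebesgue" "has_weak_gradient H G1"
    by (auto simp: is_potential_def)
  have G: "has_weak_gradient H G" unfolding G_def weak_gradient_def by (rule someI[of "has_weak_gradient H", OF G1(2)])
  have "AE x in lebesgue. G x = G1 x" by (rule weak_gradient_unique[OF G G1(2)])
  moreover have "AE x in lebesgue. G1 x = G0 x"
    by (rule potential_gradient_unique[OF H G1(2,1) 0])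
  ultimately have AE: "AE x in lebesgue. G x = G0 x" by eventually_elim simp
  have Gm: "G \<in> borel_measurable lebesgue"
    using G by (auto simp: has_weak_gradient_def intro: locally_integrable_measurable)
  have G0m: "G0 \<in> borel_measurable lebesgue" using 0(3) by (simp add: Lp_space_2_iff)
  have m: "(\<lambda>x. (norm (G x))\<^sup>2) \<in> borel_measurable lebesgue" "(\<lambda>x. (norm (G0 x))\<^sup>2) \<in> borel_measurable lebesgue"
    using Gm G0m by measurable
  have AE2: "AE x in lebesgue. (norm (G x))\<^sup>2 = (norm (G0 x))\<^sup>2" using AE by eventually_elim simp
  have "integrable lebesgue (\<lambda>x. (norm (G x))\<^sup>2)"
    using integrable_cong_AE[OF m AE2] 0(3) by (simp add: Lp_space_2_iff)
  then show "weak_gradient (Hbar F) \<in> Lp_space 2 lebesgue"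
    using Gm by (simp add: Lp_space_2_iff G_def H_def)
  show "distr_div (weak_gradient (Hbar F)) z = distr_div F z" if "z \<in> test_functions"
    using weak_gradient_distr_laplacian[OF G that] H that by (simp add: is_potential_def G_def H_def)
  show "(LINT x|lebesgue. (norm (weak_gradient (Hbar F) x))\<^sup>2) \<le> (LINT x|lebesgue. (norm (w x))\<^sup>2)"
    if "w \<in> Lp_space 2 lebesgue" "\<And>z. z \<in> test_functions \<Longrightarrow> distr_div w z = distr_div F z"
    using min[OF that(1)] that(2) integral_cong_AE[OF m AE2] by (simp add: G_def H_def)
qed

subsection \<open>Continuity of the superposition operator\<close>

lemma Lp_space_iff_integrable:
  "f \<in> Lp_space p M \<longleftrightarrow> f \<in> borel_measurable M \<and> integrable M (\<lambda>x. norm (f x) powr p)"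
  by (simp add: Lp_space_def)

lemma powr_sum_le:
  fixes a b p :: real
  assumes "0 \<le> a" "0 \<le> b" "0 < p"
  shows "(a + b) powr p \<le> 2 powr p * (a powr p + b powr p)"
proof -
  have "(a + b) powr p \<le> (2 * max a b) powr p" using assms by (intro powr_mono2) auto
  also have "\<dots> = 2 powr p * max a b powr p" using assms by (simp add: powr_mult)
  also have "max a b powr p \<le> a powr p + b powr p" by (auto simp: max_def)
  finally show ?thesis by simp
qed

lemma Lp_diff:
  assumes p: "p > 0" and f: "f \<in> Lp_space p M" and g: "g \<in> Lp_space p M"
  shows "integrable M (\<lambda>x. norm (f x - g x) powr p)"
proof (rule Bochner_Integration.integrable_bound)
  show "integrable M (\<lambda>x. 2 powr p * (norm (f x) powr p + norm (g x) powr p))"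
    using f g by (simp add: Lp_space_iff_integrable)
  show "(\<lambda>x. norm (f x - g x) powr p) \<in> borel_measurable M"
    using f g by (auto simp: Lp_space_iff_integrable)
  show "AE x in M. norm (norm (f x - g x) powr p) \<le> norm (2 powr p * (norm (f x) powr p + norm (g x) powr p))"
  proof (rule AE_I2)
    fix x
    have "norm (f x - g x) powr p \<le> (norm (f x) + norm (g x)) powr p"
      by (rule powr_mono2) (use p norm_triangle_ineq4 in auto)
    also have "\<dots> \<le> 2 powr p * (norm (f x) powr p + norm (g x) powr p)"
      using p by (intro powr_sum_le) auto
    finally show "norm (norm (f x - g x) powr p) \<le> norm (2 powr p * (norm (f x) powr p + norm (g x) powr p))" by simp
  qed
qed

context
  fixes \<Psi> :: "'a::euclidean_space \<Rightarrow> 'b::euclidean_space" and C p :: real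
  assumes cont: "continuous_on UNIV \<Psi>" and p: "p > 0"
    and growth: "\<And>\<psi>. norm (\<Psi> \<psi>) \<le> C * norm \<psi> powr (p / 2)"
begin

lemma growth_sq: "(norm (\<Psi> \<psi>))\<^sup>2 \<le> C\<^sup>2 * norm \<psi> powr p"
proof -
  have "(norm (\<Psi> \<psi>))\<^sup>2 \<le> (C * norm \<psi> powr (p / 2))\<^sup>2" by (intro power_mono growth) auto
  also have "(norm \<psi> powr (p / 2))\<^sup>2 = norm \<psi> powr p"
    by (simp add: power2_eq_square powr_add[symmetric])
  then have "(C * norm \<psi> powr (p / 2))\<^sup>2 = C\<^sup>2 * norm \<psi> powr p" by (simp add: power_mult_distrib)
  finally show ?thesis .
qed

lemma superposition_L2:
  assumes f: "f \<in> Lp_space p M"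
  shows "(\<lambda>x. \<Psi> (f x)) \<in> Lp_space 2 M"
proof -
  have m: "(\<lambda>x. \<Psi> (f x)) \<in> borel_measurable M"
    using f by (intro measurable_compose[OF _ borel_measurable_continuous_onI[OF cont]]) (simp add: Lp_space_iff_integrable)
  have "integrable M (\<lambda>x. (norm (\<Psi> (f x)))\<^sup>2)"
  proof (rule Bochner_Integration.integrable_bound)
    show "integrable M (\<lambda>x. C\<^sup>2 * norm (f x) powr p)" using f by (simp add: Lp_space_iff_integrable)
    show "(\<lambda>x. (norm (\<Psi> (f x)))\<^sup>2) \<in> borel_measurable M" using m by measurable
  qed (use growth_sq in auto)
  with m show ?thesis by (simp add: Lp_space_2_iff)
qed

text \<open>A summable rate replaces the passage to a subsequence. The sum of all p-th powers of the
  distances is integrable, so the distances tend to 0 almost everywhere, and the same sum provides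
  the majorant for dominated convergence.\<close>

lemma superposition_tendsto_fast:
  assumes f: "\<And>n. f n \<in> Lp_space p M" and g: "g \<in> Lp_space p M"
    and fast: "\<And>n. (LINT x|M. norm (f n x - g x) powr p) \<le> (1/2) ^ n"
  shows "(\<lambda>n. LINT x|M. (norm (\<Psi> (f n x) - \<Psi> (g x)))\<^sup>2) \<longlonglongrightarrow> 0"
proof -
  define e where "e n x = norm (f n x - g x) powr p" for n x
  have ie: "integrable M (e n)" for n unfolding e_def by (rule Lp_diff[OF p f g])
  have em[measurable]: "e n \<in> borel_measurable M" for n using ie by auto
  have e0: "e n x \<ge> 0" for n x by (simp add: e_def)
  have "(\<integral>\<^sup>+x. (\<Sum>n. ennreal (e n x)) \<partial>M) = (\<Sum>n. \<integral>\<^sup>+x. ennreal (e n x) \<partial>M)"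
    by (rule nn_integral_suminf) measurable
  also have "\<dots> \<le> (\<Sum>n. ennreal ((1/2) ^ n))"
  proof (rule suminf_le)
    fix n
    have "(\<integral>\<^sup>+x. ennreal (e n x) \<partial>M) = ennreal (LINT x|M. e n x)"
      by (rule nn_integral_eq_integral[OF ie]) (simp add: e0)
    also have "\<dots> \<le> ennreal ((1/2) ^ n)" unfolding e_def by (rule ennreal_leI[OF fast])
    finally show "(\<integral>\<^sup>+x. ennreal (e n x) \<partial>M) \<le> ennreal ((1/2) ^ n)" .
  qed auto
  also have "\<dots> = ennreal (\<Sum>n. (1/2) ^ n)"
    by (intro suminf_ennreal2 summable_geometric) auto
  also have "\<dots> < \<infinity>" by simp
  finally have fin: "(\<integral>\<^sup>+x. (\<Sum>n. ennreal (e n x)) \<partial>M) < \<infinity>" .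
  have "AE x in M. (\<Sum>n. ennreal (e n x)) \<noteq> \<infinity>"
    by (rule nn_integral_noteq_infinite) (use fin in auto)
  then have sm: "AE x in M. summable (\<lambda>n. e n x)"
    by eventually_elim (rule summable_suminf_not_top, use e0 in auto)
  define S where "S x = enn2real (\<Sum>n. ennreal (e n x))" for x
  have Sm[measurable]: "S \<in> borel_measurable M" unfolding S_def by measurable
  have iS: "integrable M S"
  proof (rule integrableI_bounded)
    have "(\<integral>\<^sup>+x. ennreal (norm (S x)) \<partial>M) \<le> (\<integral>\<^sup>+x. (\<Sum>n. ennreal (e n x)) \<partial>M)"
    proof (rule nn_integral_mono)
      fix x
      show "ennreal (norm (S x)) \<le> (\<Sum>n. ennreal (e n x))"
        unfolding S_def by (cases "\<Sum>n. ennreal (e n x)") (auto simp: top_unique)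
    qed
    with fin show "(\<integral>\<^sup>+x. ennreal (norm (S x)) \<partial>M) < \<infinity>" by (rule le_less_trans[rotated])
  qed auto
  have eS: "e n x \<le> S x" if s: "summable (\<lambda>n. e n x)" for n x
  proof -
    have "S x = (\<Sum>n. e n x)"
      unfolding S_def using s e0 by (subst suminf_ennreal2) (simp_all add: enn2real_ennreal suminf_nonneg)
    then show ?thesis using sum_le_suminf[OF s, of "{n}"] e0 by simp
  qed
  \<comment> \<open>The factor 2 comes from squaring a difference, the square of \<open>C\<close>
    from the growth condition, \<open>2 powr p\<close> from splitting f n = (f n - g) + g, and the
    summand 1 from g itself.\<close>
  define K where "K = 2 * C\<^sup>2 * (2 powr p + 1)"
  have m1: "(\<lambda>x. \<Psi> (g x)) \<in> borel_measurable M" "(\<lambda>x. \<Psi> (f n x)) \<in> borel_measurable M" for n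
    using superposition_L2[OF g] superposition_L2[OF f[of n]] by (auto simp: Lp_space_2_iff)
  have "(\<lambda>n. LINT x|M. (norm (\<Psi> (f n x) - \<Psi> (g x)))\<^sup>2) \<longlonglongrightarrow> (LINT x|M. 0)"
  proof (rule integral_dominated_convergence[where w = "\<lambda>x. K * (S x + norm (g x) powr p)"])
    show "(\<lambda>x. (norm (\<Psi> (f n x) - \<Psi> (g x)))\<^sup>2) \<in> borel_measurable M" for n
      using m1 by measurable
    show "integrable M (\<lambda>x. K * (S x + norm (g x) powr p))"
      using iS g by (simp add: Lp_space_iff_integrable)
    show "AE x in M. (\<lambda>n. (norm (\<Psi> (f n x) - \<Psi> (g x)))\<^sup>2) \<longlonglongrightarrow> 0"
      using sm
    proof eventually_elim
      case (elim x)
      have "(\<lambda>n. e n x powr (1 / p)) \<longlonglongrightarrow> 0"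
        by (rule tendsto_zero_powrI[OF summable_LIMSEQ_zero[OF elim] tendsto_const]) (use p e0 in auto)
      then have "(\<lambda>n. norm (f n x - g x)) \<longlonglongrightarrow> 0"
        using p by (simp add: e_def powr_powr)
      then have "(\<lambda>n. f n x) \<longlonglongrightarrow> g x" by (simp add: tendsto_norm_zero_iff LIM_zero_iff)
      then have "(\<lambda>n. \<Psi> (f n x)) \<longlonglongrightarrow> \<Psi> (g x)"
        by (rule continuous_on_tendsto_compose[OF cont]) auto
      then have "(\<lambda>n. (norm (\<Psi> (f n x) - \<Psi> (g x)))\<^sup>2) \<longlonglongrightarrow> (norm (\<Psi> (g x) - \<Psi> (g x)))\<^sup>2"
        by (intro tendsto_intros)
      then show ?case by simp
    qed
    show "AE x in M. norm ((norm (\<Psi> (f n x) - \<Psi> (g x)))\<^sup>2) \<le> K * (S x + norm (g x) powr p)" for n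
      using sm
    proof eventually_elim
      case (elim x)
      define G where "G = norm (g x) powr p"
      have G0: "G \<ge> 0" by (simp add: G_def)
      have "norm (f n x) powr p \<le> (norm (f n x - g x) + norm (g x)) powr p"
        by (rule powr_mono2) (use p norm_triangle_sub[of "f n x" "g x"] in auto)
      also have "\<dots> \<le> 2 powr p * (e n x + G)"
        unfolding e_def G_def using p by (intro powr_sum_le) auto
      also have "\<dots> \<le> 2 powr p * (S x + G)" using eS[OF elim, of n] by (intro mult_left_mono) auto
      finally have fn: "norm (f n x) powr p \<le> 2 powr p * (S x + G)" .
      have SG: "G \<le> S x + G" using eS[OF elim, of 0] e0[of 0 x] by linarith
      have "(norm (\<Psi> (f n x) - \<Psi> (g x)))\<^sup>2 \<le> 2 * (norm (\<Psi> (f n x)))\<^sup>2 + 2 * (norm (\<Psi> (g x)))\<^sup>2"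
        using norm_add_sq_le[of "\<Psi> (f n x)" "- \<Psi> (g x)"] by simp
      also have "\<dots> \<le> 2 * (C\<^sup>2 * norm (f n x) powr p) + 2 * (C\<^sup>2 * G)"
        unfolding G_def by (intro add_mono mult_left_mono growth_sq) auto
      also have "\<dots> \<le> 2 * (C\<^sup>2 * (2 powr p * (S x + G))) + 2 * (C\<^sup>2 * (S x + G))"
        using fn SG by (intro add_mono mult_left_mono) auto
      also have "\<dots> = K * (S x + G)" by (simp add: K_def algebra_simps)
      finally show ?case by (simp add: G_def)
    qed
  qed auto
  then show ?thesis by simp
qed

text \<open>If the integrals stayed above some e along arbitrarily small \<epsilon>, a sequence of
  such \<epsilon> with distances below 2^-n could be selected, contrary to
  \<open>superposition_tendsto_fast\<close>.\<close>

lemma superposition_family_tendsto: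
  assumes conv: "Lp_family_converges p M f g"
  shows "((\<lambda>\<epsilon>. LINT x|M. (norm (\<Psi> (f \<epsilon> x) - \<Psi> (g x)))\<^sup>2) \<longlongrightarrow> 0) (at_right 0)"
proof (rule ccontr)
  define N where "N \<epsilon> = (LINT x|M. norm (f \<epsilon> x - g x) powr p)" for \<epsilon>
  define X where "X \<epsilon> = (LINT x|M. (norm (\<Psi> (f \<epsilon> x) - \<Psi> (g x)))\<^sup>2)" for \<epsilon>
  have N0: "N \<epsilon> \<ge> 0" and X0: "X \<epsilon> \<ge> 0" for \<epsilon> by (simp_all add: N_def X_def)
  have "((\<lambda>\<epsilon>. N \<epsilon> powr (1 / p)) \<longlongrightarrow> 0) (at_right 0)"
    using conv by (simp add: Lp_family_converges_def Lp_norm_def N_def)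
  then have "((\<lambda>\<epsilon>. (N \<epsilon> powr (1 / p)) powr p) \<longlongrightarrow> 0) (at_right 0)"
    by (rule tendsto_zero_powrI[OF _ tendsto_const]) (use p in auto)
  then have Nlim: "(N \<longlongrightarrow> 0) (at_right 0)"
    using p N0 by (simp add: powr_powr)
  assume "\<not> ((\<lambda>\<epsilon>. LINT x|M. (norm (\<Psi> (f \<epsilon> x) - \<Psi> (g x)))\<^sup>2) \<longlongrightarrow> 0) (at_right 0)"
  then have "\<not> (X \<longlongrightarrow> 0) (at_right 0)" by (simp add: X_def[abs_def])
  then obtain e where e: "e > 0" "\<not> eventually (\<lambda>\<epsilon>. X \<epsilon> < e) (at_right 0)"
    using X0 by (auto simp: tendsto_iff dist_real_def)
  \<comment> \<open>It suffices to record that the p-th power of the distance is below 2^-n; the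
    selected parameters serve only to index a sequence of functions.\<close>
  have "\<exists>\<epsilon>>0. e \<le> X \<epsilon> \<and> N \<epsilon> < (1/2) ^ n" for n :: nat
  proof (rule ccontr)
    assume neg: "\<not> (\<exists>\<epsilon>>0. e \<le> X \<epsilon> \<and> N \<epsilon> < (1/2) ^ n)"
    have "eventually (\<lambda>\<epsilon>. N \<epsilon> < (1/2) ^ n) (at_right 0)"
      by (rule order_tendstoD(2)[OF Nlim]) simp
    moreover have "eventually (\<lambda>\<epsilon>. \<epsilon> > (0::real)) (at_right 0)" by (rule eventually_at_right_less)
    ultimately have "eventually (\<lambda>\<epsilon>. X \<epsilon> < e) (at_right 0)"
      by eventually_elim (use neg in \<open>auto simp: not_le\<close>)
    with e(2) show False by simp
  qed
  then obtain s where s: "\<And>n. s n > 0" "\<And>n. e \<le> X (s n)" "\<And>n. N (s n) < (1/2) ^ n" by metis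
  have "(\<lambda>n. X (s n)) \<longlonglongrightarrow> 0"
    unfolding X_def
  proof (rule superposition_tendsto_fast)
    show "f (s n) \<in> Lp_space p M" for n using conv s(1) by (simp add: Lp_family_converges_def)
    show "g \<in> Lp_space p M" using conv by (simp add: Lp_family_converges_def)
    show "(LINT x|M. norm (f (s n) x - g x) powr p) \<le> (1/2) ^ n" for n
      using s(3)[of n] by (simp add: N_def)
  qed
  then have "e \<le> 0" by (rule LIMSEQ_le_const) (use s(2) in auto)
  with e(1) show False by simp
qed

end

text \<open>Connects the field extended by zero, which the potential requires, with the space over
  \<Omega> in which the superposition estimate is proved.\<close>

lemma L2_lebesgue_on_iff:
  fixes f :: "real^'n \<Rightarrow> 'b::euclidean_space"
  assumes \<Omega>: "\<Omega> \<in> sets lebesgue"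
  shows "(\<lambda>x. indicat_real \<Omega> x *\<^sub>R f x) \<in> Lp_space 2 lebesgue \<longleftrightarrow> f \<in> Lp_space 2 (lebesgue_on \<Omega>)"
proof -
  have "(norm (indicat_real \<Omega> x *\<^sub>R f x))\<^sup>2 = indicat_real \<Omega> x *\<^sub>R (norm (f x))\<^sup>2" for x
    by (auto simp: indicator_def)
  then show ?thesis
    using \<Omega> by (simp add: Lp_space_2_iff integrable_restrict_space borel_measurable_restrict_space_iff)
qed

lemma cut_field_L2:
  assumes \<Omega>: "open \<Omega>" and \<Psi>: "continuous_on UNIV \<Psi>" and p: "p > 0"
    and growth: "\<And>\<psi>. norm (\<Psi> \<psi>) \<le> C * norm \<psi> powr (p / 2)"
    and f: "f \<in> Lp_space p (lebesgue_on \<Omega>)"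
  shows "cut_field \<Omega> \<Psi> f \<in> Lp_space 2 lebesgue"
  unfolding cut_field_def[abs_def]
  using superposition_L2[OF \<Psi> p growth f] \<Omega> by (subst L2_lebesgue_on_iff) auto

lemma cut_field_family_tendsto:
  assumes \<Omega>: "open \<Omega>" and \<Psi>: "continuous_on UNIV \<Psi>" and p: "p > 0"
    and growth: "\<And>\<psi>. norm (\<Psi> \<psi>) \<le> C * norm \<psi> powr (p / 2)"
    and conv: "Lp_family_converges p (lebesgue_on \<Omega>) f g"
  shows "((\<lambda>\<epsilon>. LINT x|lebesgue. (norm (cut_field \<Omega> \<Psi> (f \<epsilon>) x - cut_field \<Omega> \<Psi> g x))\<^sup>2) \<longlongrightarrow> 0) (at_right 0)"
proof -
  have "(norm (cut_field \<Omega> \<Psi> (f \<epsilon>) x - cut_field \<Omega> \<Psi> g x))\<^sup>2 = indicat_real \<Omega> x *\<^sub>R (norm (\<Psi> (f \<epsilon> x) - \<Psi> (g x)))\<^sup>2" for \<epsilon> x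
    by (auto simp: indicator_def cut_field_def)
  then have "(LINT x|lebesgue. (norm (cut_field \<Omega> \<Psi> (f \<epsilon>) x - cut_field \<Omega> \<Psi> g x))\<^sup>2) = (LINT x|lebesgue_on \<Omega>. (norm (\<Psi> (f \<epsilon> x) - \<Psi> (g x)))\<^sup>2)" for \<epsilon>
    using \<Omega> by (simp add: integral_restrict_space)
  then show ?thesis using superposition_family_tendsto[OF \<Psi> p growth conv] by simp
qed

subsection \<open>Comparison of the two functionals\<close>

lemma distr_div_diff:
  fixes F G :: "real^'n \<Rightarrow> real^'n^'l"
  assumes F: "F \<in> Lp_space 2 lebesgue" and G: "G \<in> Lp_space 2 lebesgue" and z: "z \<in> test_functions"
  shows "distr_div (\<lambda>x. F x - G x) z = distr_div F z - distr_div G z"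
proof (rule vec_eq_iff[THEN iffD2], rule allI)
  fix i
  have "(LINT x|lebesgue. (F x $ i - G x $ i) \<bullet> gradient z x) = (LINT x|lebesgue. F x $ i \<bullet> gradient z x) - (LINT x|lebesgue. G x $ i \<bullet> gradient z x)"
    unfolding inner_diff_left
    by (intro Bochner_Integration.integral_diff L2_integrable_inner L2_vec_nth F G gradient_L2 z)
  then show "distr_div (\<lambda>x. F x - G x) z $ i = (distr_div F z - distr_div G z) $ i"
    by (simp add: distr_div_nth(1)[OF L2_locally_integrable[OF F] z] distr_div_nth(1)[OF L2_locally_integrable[OF G] z]
        distr_div_nth(1)[OF L2_locally_integrable[OF L2_diff[OF F G]] z])
qed

lemma L2_nn_integral:
  "F \<in> Lp_space 2 M \<Longrightarrow> (\<integral>\<^sup>+x. ennreal ((norm (F x))\<^sup>2) \<partial>M) = ennreal (LINT x|M. (norm (F x))\<^sup>2)"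
  by (rule nn_integral_eq_integral) (auto simp: Lp_space_2_iff)

lemma P_functional_le_Q_functional:
  fixes \<Psi> :: "real^'m \<Rightarrow> real^'n^'l"
  assumes F: "cut_field \<Omega> \<Psi> u \<in> Lp_space 2 lebesgue" and L: "L \<in> Lp_space 2 lebesgue"
  shows "P_functional \<Omega> \<Psi> E \<delta> \<epsilon> u \<le> Q_functional \<Omega> \<Psi> E \<delta> \<epsilon> u L"
proof (cases "div_free L")
  case True
  define F' where "F' = cut_field \<Omega> \<Psi> u"
  have F': "F' \<in> Lp_space 2 lebesgue" using F by (simp add: F'_def)
  note w = L2_add[OF L F']
  have "distr_div (\<lambda>x. L x + F' x) z = distr_div F' z" if z: "z \<in> test_functions" for z
    using distr_div_diff[OF w F' z] True z by (simp add: div_free_def)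
  then have "(LINT x|lebesgue. (norm (weak_gradient (Hbar F') x))\<^sup>2) \<le> (LINT x|lebesgue. (norm (L x + F' x))\<^sup>2)"
    by (rule Hbar_gradient(3)[OF F' w])
  then have "(\<integral>\<^sup>+x. ennreal ((norm (weak_gradient (Hbar F') x))\<^sup>2) \<partial>lebesgue) \<le> (\<integral>\<^sup>+x. ennreal ((norm (L x + F' x))\<^sup>2) \<partial>lebesgue)"
    unfolding L2_nn_integral[OF Hbar_gradient(1)[OF F']] L2_nn_integral[OF w] by (rule ennreal_leI)
  then show ?thesis
    using True unfolding P_functional_def Q_functional_def F'_def by (simp add: add_left_mono mult_left_mono)
qed (simp add: Q_functional_def)

text \<open>The bound \<open>b\<close> is fixed before the family, and nothing is claimed about Q
  where P reaches \<open>b\<close>. This one statement serves for lower and upper limits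
  alike.\<close>

lemma recovery_family:
  fixes \<Psi> :: "real^'m \<Rightarrow> real^'n^'l"
  assumes \<Omega>: "open \<Omega>" and \<Psi>: "continuous_on UNIV \<Psi>" and p: "p > 0"
    and growth: "\<And>\<psi>. norm (\<Psi> \<psi>) \<le> C * norm \<psi> powr (p / 2)"
    and \<delta>: "\<And>\<epsilon>. \<epsilon> > 0 \<Longrightarrow> \<delta> \<epsilon> > 0" "(\<delta> \<longlongrightarrow> 0) (at_right 0)"
    and conv: "Lp_family_converges p (lebesgue_on \<Omega>) f g" and b: "b \<ge> 0"
  obtains L where "Lp_family_converges 2 lebesgue L (\<lambda>x. - cut_field \<Omega> \<Psi> g x)"
    "\<And>\<epsilon>. \<epsilon> > 0 \<Longrightarrow> P_functional \<Omega> \<Psi> E \<delta> \<epsilon> (f \<epsilon>) < ennreal b \<Longrightarrow>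
       Q_functional \<Omega> \<Psi> E \<delta> \<epsilon> (f \<epsilon>) (L \<epsilon>) = P_functional \<Omega> \<Psi> E \<delta> \<epsilon> (f \<epsilon>)"
proof -
  define F where "F \<epsilon> = cut_field \<Omega> \<Psi> (f \<epsilon>)" for \<epsilon>
  define F0 where "F0 = cut_field \<Omega> \<Psi> g"
  define G where "G \<epsilon> = weak_gradient (Hbar (F \<epsilon>))" for \<epsilon>
  define good where "good \<epsilon> \<longleftrightarrow> \<epsilon> > 0 \<and> P_functional \<Omega> \<Psi> E \<delta> \<epsilon> (f \<epsilon>) < ennreal b" for \<epsilon>
  define L where "L \<epsilon> = (if good \<epsilon> then (\<lambda>x. G \<epsilon> x - F \<epsilon> x) else (\<lambda>x. - F0 x))" for \<epsilon>
  have F: "F \<epsilon> \<in> Lp_space 2 lebesgue" if "\<epsilon> > 0" for \<epsilon>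
    unfolding F_def by (rule cut_field_L2[OF \<Omega> \<Psi> p growth]) (use conv that in \<open>simp add: Lp_family_converges_def\<close>)
  have F0: "F0 \<in> Lp_space 2 lebesgue"
    unfolding F0_def by (rule cut_field_L2[OF \<Omega> \<Psi> p growth]) (use conv in \<open>simp add: Lp_family_converges_def\<close>)
  have mF0: "(\<lambda>x. - F0 x) \<in> Lp_space 2 lebesgue" using L2_scale[OF F0, of "-1"] by simp
  have G: "G \<epsilon> \<in> Lp_space 2 lebesgue" if "\<epsilon> > 0" for \<epsilon>
    unfolding G_def by (rule Hbar_gradient(1)[OF F[OF that]])
  \<comment> \<open>The energy E is nonnegative, so the gradient term alone stays below
    \<open>b\<close>; multiplying by \<delta> turns this into a bound that tends to 0.\<close>
  have Gb: "(LINT x|lebesgue. (norm (G \<epsilon> x))\<^sup>2) \<le> b * \<delta> \<epsilon>" if g: "good \<epsilon>" for \<epsilon>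
  proof -
    have e: "\<epsilon> > 0" using g by (simp add: good_def)
    define I where "I = (LINT x|lebesgue. (norm (G \<epsilon> x))\<^sup>2)"
    have I0: "I \<ge> 0" by (simp add: I_def)
    have "ennreal I = (\<integral>\<^sup>+x. ennreal ((norm (G \<epsilon> x))\<^sup>2) \<partial>lebesgue)"
      by (simp add: I_def L2_nn_integral[OF G[OF e]])
    then have "ennreal (1 / \<delta> \<epsilon>) * ennreal I \<le> P_functional \<Omega> \<Psi> E \<delta> \<epsilon> (f \<epsilon>)"
      by (simp add: P_functional_def G_def F_def)
    also have "\<dots> < ennreal b" using g by (simp add: good_def)
    finally have "ennreal (1 / \<delta> \<epsilon> * I) < ennreal b"
      using \<delta>(1)[OF e] I0 by (subst ennreal_mult) auto
    then have "1 / \<delta> \<epsilon> * I < b" by (rule ennreal_less_iff[THEN iffD1, rotated]) (use \<delta>(1)[OF e] I0 in simp)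
    then show ?thesis using \<delta>(1)[OF e] by (simp add: I_def field_simps)
  qed
  have LL2: "L \<epsilon> \<in> Lp_space 2 lebesgue" if "\<epsilon> > 0" for \<epsilon>
    using L2_diff[OF G[OF that] F[OF that]] mF0 by (simp add: L_def)
  define X where "X \<epsilon> = (LINT x|lebesgue. (norm (F \<epsilon> x - F0 x))\<^sup>2)" for \<epsilon>
  have Xlim: "(X \<longlongrightarrow> 0) (at_right 0)"
    unfolding X_def F_def F0_def by (rule cut_field_family_tendsto[OF \<Omega> \<Psi> p growth conv])
  \<comment> \<open>One estimate for both kinds of \<epsilon>: if \<epsilon> is not good, the left
    side is 0 and the right side is nonnegative.\<close>
  have bound: "(LINT x|lebesgue. (norm (L \<epsilon> x - - F0 x))\<^sup>2) \<le> 2 * (b * \<delta> \<epsilon>) + 2 * X \<epsilon>" if e: "\<epsilon> > 0" for \<epsilon>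
  proof (cases "good \<epsilon>")
    case True
    note D = L2_diff[OF F[OF e] F0]
    have i: "integrable lebesgue (\<lambda>x. (norm (G \<epsilon> x))\<^sup>2)" "integrable lebesgue (\<lambda>x. (norm (F \<epsilon> x - F0 x))\<^sup>2)"
      using G[OF e] D by (simp_all add: Lp_space_2_iff)
    have "(LINT x|lebesgue. (norm (L \<epsilon> x - - F0 x))\<^sup>2) \<le> (LINT x|lebesgue. 2 * (norm (G \<epsilon> x))\<^sup>2 + 2 * (norm (F \<epsilon> x - F0 x))\<^sup>2)"
    proof (rule integral_mono)
      show "integrable lebesgue (\<lambda>x. (norm (L \<epsilon> x - - F0 x))\<^sup>2)"
        using L2_diff[OF LL2[OF e] mF0] by (simp add: Lp_space_2_iff)
      show "integrable lebesgue (\<lambda>x. 2 * (norm (G \<epsilon> x))\<^sup>2 + 2 * (norm (F \<epsilon> x - F0 x))\<^sup>2)"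
        using i by simp
      fix x
      show "(norm (L \<epsilon> x - - F0 x))\<^sup>2 \<le> 2 * (norm (G \<epsilon> x))\<^sup>2 + 2 * (norm (F \<epsilon> x - F0 x))\<^sup>2"
        using norm_add_sq_le[of "G \<epsilon> x" "- (F \<epsilon> x - F0 x)"] True
        by (simp add: L_def norm_minus_commute algebra_simps)
    qed
    also have "\<dots> = 2 * (LINT x|lebesgue. (norm (G \<epsilon> x))\<^sup>2) + 2 * X \<epsilon>"
      using i by (simp add: X_def)
    also have "\<dots> \<le> 2 * (b * \<delta> \<epsilon>) + 2 * X \<epsilon>" using Gb[OF True] by simp
    finally show ?thesis .
  next
    case False
    then show ?thesis using b \<delta>(1)[OF e] by (simp add: L_def X_def)
  qed
  have "((\<lambda>\<epsilon>. LINT x|lebesgue. (norm (L \<epsilon> x - - F0 x))\<^sup>2) \<longlongrightarrow> 0) (at_right 0)"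
  proof (rule tendsto_sandwich[OF _ _ tendsto_const])
    show "eventually (\<lambda>\<epsilon>. 0 \<le> (LINT x|lebesgue. (norm (L \<epsilon> x - - F0 x))\<^sup>2)) (at_right 0)" by simp
    show "eventually (\<lambda>\<epsilon>. (LINT x|lebesgue. (norm (L \<epsilon> x - - F0 x))\<^sup>2) \<le> 2 * (b * \<delta> \<epsilon>) + 2 * X \<epsilon>) (at_right 0)"
      using eventually_at_right_less[of "0::real"] by eventually_elim (rule bound)
    have "((\<lambda>\<epsilon>. 2 * (b * \<delta> \<epsilon>) + 2 * X \<epsilon>) \<longlongrightarrow> 2 * (b * 0) + 2 * 0) (at_right 0)"
      by (intro tendsto_intros \<delta>(2) Xlim)
    then show "((\<lambda>\<epsilon>. 2 * (b * \<delta> \<epsilon>) + 2 * X \<epsilon>) \<longlongrightarrow> 0) (at_right 0)" by simp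
  qed
  then have "((\<lambda>\<epsilon>. (LINT x|lebesgue. (norm (L \<epsilon> x - - F0 x))\<^sup>2) powr (1 / 2)) \<longlongrightarrow> 0) (at_right 0)"
    by (rule tendsto_zero_powrI[OF _ tendsto_const]) auto
  then have conv_L: "Lp_family_converges 2 lebesgue L (\<lambda>x. - F0 x)"
    using LL2 mF0 by (simp add: Lp_family_converges_def Lp_norm_def)
  have "Q_functional \<Omega> \<Psi> E \<delta> \<epsilon> (f \<epsilon>) (L \<epsilon>) = P_functional \<Omega> \<Psi> E \<delta> \<epsilon> (f \<epsilon>)"
    if "\<epsilon> > 0" "P_functional \<Omega> \<Psi> E \<delta> \<epsilon> (f \<epsilon>) < ennreal b" for \<epsilon>
  proof -
    have L: "L \<epsilon> = (\<lambda>x. G \<epsilon> x - F \<epsilon> x)" using that by (simp add: L_def good_def)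
    have "div_free (L \<epsilon>)"
      unfolding L div_free_def
      using distr_div_diff[OF G[OF that(1)] F[OF that(1)]] Hbar_gradient(2)[OF F[OF that(1)]] by (simp add: G_def)
    then show ?thesis
      unfolding Q_functional_def P_functional_def by (simp add: L F_def[symmetric] G_def)
  qed
  then show ?thesis using conv_L by (intro that) (simp_all add: F0_def)
qed

theorem proposition1p2:
  fixes \<Omega> :: "(real^'n) set"
    and \<Psi> :: "real^'m \<Rightarrow> real^'n^'l"
    and C\<^sub>0 p :: real
    and E :: "real \<Rightarrow> (real^'n \<Rightarrow> real^'m) \<Rightarrow> ennreal"
    and \<delta> :: "real \<Rightarrow> real"
    and \<phi> :: "real^'n \<Rightarrow> real^'m"
  assumes "open \<Omega>" and "locally_lipschitz_boundary \<Omega>"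
    and "continuous_on UNIV \<Psi>"
    and "C\<^sub>0 > 0" and "p \<ge> 1"
    and "\<And>\<psi>. norm (\<Psi> \<psi>) \<le> C\<^sub>0 * norm \<psi> powr (p / 2)"
    and E_well_defined_on_classes:
      "\<And>\<epsilon> u v. \<epsilon> > 0 \<Longrightarrow> u \<in> Lp_space p (lebesgue_on \<Omega>) \<Longrightarrow> v \<in> Lp_space p (lebesgue_on \<Omega>) \<Longrightarrow>
         (AE x in lebesgue_on \<Omega>. u x = v x) \<Longrightarrow> E \<epsilon> u = E \<epsilon> v"
    and "\<And>\<epsilon>. \<epsilon> > 0 \<Longrightarrow> \<delta> \<epsilon> > 0"
    and "(\<delta> \<longlongrightarrow> 0) (at_right 0)"
    and "\<phi> \<in> Lp_space p (lebesgue_on \<Omega>)"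
    and "div_free (cut_field \<Omega> \<Psi> \<phi>)"
  shows "Inf {Liminf (at_right 0) (\<lambda>\<epsilon>. P_functional \<Omega> \<Psi> E \<delta> \<epsilon> (\<phi>\<^sub>\<epsilon> \<epsilon>)) | \<phi>\<^sub>\<epsilon>.
             Lp_family_converges p (lebesgue_on \<Omega>) \<phi>\<^sub>\<epsilon> \<phi>}
       = Inf {Liminf (at_right 0) (\<lambda>\<epsilon>. Q_functional \<Omega> \<Psi> E \<delta> \<epsilon> (\<phi>\<^sub>\<epsilon> \<epsilon>) (L\<^sub>\<epsilon> \<epsilon>)) | \<phi>\<^sub>\<epsilon> L\<^sub>\<epsilon>.
             Lp_family_converges p (lebesgue_on \<Omega>) \<phi>\<^sub>\<epsilon> \<phi> \<and>
             Lp_family_converges 2 lebesgue L\<^sub>\<epsilon> (\<lambda>x. - cut_field \<Omega> \<Psi> \<phi> x)}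
     \<and> Inf {Limsup (at_right 0) (\<lambda>\<epsilon>. P_functional \<Omega> \<Psi> E \<delta> \<epsilon> (\<phi>\<^sub>\<epsilon> \<epsilon>)) | \<phi>\<^sub>\<epsilon>.
             Lp_family_converges p (lebesgue_on \<Omega>) \<phi>\<^sub>\<epsilon> \<phi>}
       = Inf {Limsup (at_right 0) (\<lambda>\<epsilon>. Q_functional \<Omega> \<Psi> E \<delta> \<epsilon> (\<phi>\<^sub>\<epsilon> \<epsilon>) (L\<^sub>\<epsilon> \<epsilon>)) | \<phi>\<^sub>\<epsilon> L\<^sub>\<epsilon>.
             Lp_family_converges p (lebesgue_on \<Omega>) \<phi>\<^sub>\<epsilon> \<phi> \<and>
             Lp_family_converges 2 lebesgue L\<^sub>\<epsilon> (\<lambda>x. - cut_field \<Omega> \<Psi> \<phi> x)}"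
proof -
  have p: "p > 0" using \<open>p \<ge> 1\<close> by simp
  note recovery = recovery_family[where \<delta> = \<delta>, OF \<open>open \<Omega>\<close> \<open>continuous_on UNIV \<Psi>\<close> p assms(6) assms(8) \<open>(\<delta> \<longlongrightarrow> 0) (at_right 0)\<close>]
  have PQ: "eventually (\<lambda>\<epsilon>. P_functional \<Omega> \<Psi> E \<delta> \<epsilon> (f \<epsilon>) \<le> Q_functional \<Omega> \<Psi> E \<delta> \<epsilon> (f \<epsilon>) (L \<epsilon>)) (at_right 0)"
    if f: "Lp_family_converges p (lebesgue_on \<Omega>) f \<phi>" and L: "Lp_family_converges 2 lebesgue L (\<lambda>x. - cut_field \<Omega> \<Psi> \<phi> x)" for f L
    using eventually_at_right_less[of "0::real"]
  proof eventually_elim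
    case (elim \<epsilon>)
    have "cut_field \<Omega> \<Psi> (f \<epsilon>) \<in> Lp_space 2 lebesgue"
      by (rule cut_field_L2[OF \<open>open \<Omega>\<close> \<open>continuous_on UNIV \<Psi>\<close> p assms(6)])
         (use f elim in \<open>simp add: Lp_family_converges_def\<close>)
    then show ?case
      by (rule P_functional_le_Q_functional) (use L elim in \<open>simp add: Lp_family_converges_def\<close>)
  qed
  \<comment> \<open>The bound has to be a finite real: only then does b \<delta> tend to 0 in the
    construction of the recovery family.\<close>
  have real_bound: "\<exists>b::real. b \<ge> 0 \<and> c < ennreal b" if "c < top" for c :: ennreal
    using that by (cases c) (auto intro!: exI[of _ "enn2real c + 1"] ennreal_lessI)
  have liminf: "\<exists>L. Lp_family_converges 2 lebesgue L (\<lambda>x. - cut_field \<Omega> \<Psi> \<phi> x) \<and>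
      Liminf (at_right 0) (\<lambda>\<epsilon>. Q_functional \<Omega> \<Psi> E \<delta> \<epsilon> (f \<epsilon>) (L \<epsilon>)) \<le> Liminf (at_right 0) (\<lambda>\<epsilon>. P_functional \<Omega> \<Psi> E \<delta> \<epsilon> (f \<epsilon>))"
    if f: "Lp_family_converges p (lebesgue_on \<Omega>) f \<phi>" for f
  proof (cases "Liminf (at_right 0) (\<lambda>\<epsilon>. P_functional \<Omega> \<Psi> E \<delta> \<epsilon> (f \<epsilon>)) < top")
    case True
    define c where "c = Liminf (at_right 0) (\<lambda>\<epsilon>. P_functional \<Omega> \<Psi> E \<delta> \<epsilon> (f \<epsilon>))"
    obtain b where b: "b \<ge> 0" "c < ennreal b" using real_bound True by (auto simp: c_def)
    obtain L where L: "Lp_family_converges 2 lebesgue L (\<lambda>x. - cut_field \<Omega> \<Psi> \<phi> x)"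
      and QP: "\<And>\<epsilon>. \<epsilon> > 0 \<Longrightarrow> P_functional \<Omega> \<Psi> E \<delta> \<epsilon> (f \<epsilon>) < ennreal b \<Longrightarrow>
       Q_functional \<Omega> \<Psi> E \<delta> \<epsilon> (f \<epsilon>) (L \<epsilon>) = P_functional \<Omega> \<Psi> E \<delta> \<epsilon> (f \<epsilon>)"
      using recovery[OF _ f b(1), of E] by blast
    have "Liminf (at_right 0) (\<lambda>\<epsilon>. Q_functional \<Omega> \<Psi> E \<delta> \<epsilon> (f \<epsilon>) (L \<epsilon>)) \<le> c"
    proof (rule ccontr)
      assume "\<not> ?thesis"
      \<comment> \<open>Choose y strictly between c and both the lower limit of Q and b. Eventually
        P is at least y: where P is below b it equals Q, which exceeds y, and elsewhere P is at
        least b. So the lower limit of P would be at least y, although it is c.\<close>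
      then have "c < min (Liminf (at_right 0) (\<lambda>\<epsilon>. Q_functional \<Omega> \<Psi> E \<delta> \<epsilon> (f \<epsilon>) (L \<epsilon>))) (ennreal b)"
        using b by simp
      from dense[OF this] obtain y where y: "c < y" "y < Liminf (at_right 0) (\<lambda>\<epsilon>. Q_functional \<Omega> \<Psi> E \<delta> \<epsilon> (f \<epsilon>) (L \<epsilon>))" "y < ennreal b"
        by (elim exE conjE) simp
      have "eventually (\<lambda>\<epsilon>. y < Q_functional \<Omega> \<Psi> E \<delta> \<epsilon> (f \<epsilon>) (L \<epsilon>)) (at_right 0)"
        by (rule less_LiminfD[OF y(2)])
      then have "eventually (\<lambda>\<epsilon>. y \<le> P_functional \<Omega> \<Psi> E \<delta> \<epsilon> (f \<epsilon>)) (at_right 0)"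
        using eventually_at_right_less[of "0::real"]
      proof eventually_elim
        case (elim \<epsilon>)
        show ?case
        proof (cases "P_functional \<Omega> \<Psi> E \<delta> \<epsilon> (f \<epsilon>) < ennreal b")
          case True
          then show ?thesis using QP[OF elim(2) True] elim(1) by simp
        next
          case False
          then show ?thesis using y(3) by (simp add: not_less)
        qed
      qed
      then have "y \<le> c" unfolding c_def by (rule Liminf_bounded)
      with y(1) show False by simp
    qed
    with L show ?thesis by (auto simp: c_def)
  next
    case False
    then have "Liminf (at_right 0) (\<lambda>\<epsilon>. P_functional \<Omega> \<Psi> E \<delta> \<epsilon> (f \<epsilon>)) = top" using top.not_eq_extremum by blast
    \<comment> \<open>With b = 0 the lemma just supplies some admissible family, which is enough
      when the limit to be compared with is infinite.\<close>
    moreover obtain L where "Lp_family_converges 2 lebesgue L (\<lambda>x. - cut_field \<Omega> \<Psi> \<phi> x)"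
      using recovery[OF _ f order_refl, of E] by blast
    ultimately show ?thesis by auto
  qed
  have limsup: "\<exists>L. Lp_family_converges 2 lebesgue L (\<lambda>x. - cut_field \<Omega> \<Psi> \<phi> x) \<and>
      Limsup (at_right 0) (\<lambda>\<epsilon>. Q_functional \<Omega> \<Psi> E \<delta> \<epsilon> (f \<epsilon>) (L \<epsilon>)) \<le> Limsup (at_right 0) (\<lambda>\<epsilon>. P_functional \<Omega> \<Psi> E \<delta> \<epsilon> (f \<epsilon>))"
    if f: "Lp_family_converges p (lebesgue_on \<Omega>) f \<phi>" for f
  proof (cases "Limsup (at_right 0) (\<lambda>\<epsilon>. P_functional \<Omega> \<Psi> E \<delta> \<epsilon> (f \<epsilon>)) < top")
    case True
    obtain b where b: "b \<ge> 0" "Limsup (at_right 0) (\<lambda>\<epsilon>. P_functional \<Omega> \<Psi> E \<delta> \<epsilon> (f \<epsilon>)) < ennreal b" using real_bound[OF True] by auto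
    obtain L where L: "Lp_family_converges 2 lebesgue L (\<lambda>x. - cut_field \<Omega> \<Psi> \<phi> x)"
      and QP: "\<And>\<epsilon>. \<epsilon> > 0 \<Longrightarrow> P_functional \<Omega> \<Psi> E \<delta> \<epsilon> (f \<epsilon>) < ennreal b \<Longrightarrow>
       Q_functional \<Omega> \<Psi> E \<delta> \<epsilon> (f \<epsilon>) (L \<epsilon>) = P_functional \<Omega> \<Psi> E \<delta> \<epsilon> (f \<epsilon>)"
      using recovery[OF _ f b(1), of E] by blast
    \<comment> \<open>Unlike for the lower limit, here all sufficiently small \<epsilon> are good,
      so Q equals P from some point on.\<close>
    have "eventually (\<lambda>\<epsilon>. P_functional \<Omega> \<Psi> E \<delta> \<epsilon> (f \<epsilon>) < ennreal b) (at_right 0)"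
      by (rule Limsup_lessD[OF b(2)])
    then have "eventually (\<lambda>\<epsilon>. Q_functional \<Omega> \<Psi> E \<delta> \<epsilon> (f \<epsilon>) (L \<epsilon>) \<le> P_functional \<Omega> \<Psi> E \<delta> \<epsilon> (f \<epsilon>)) (at_right 0)"
      using eventually_at_right_less[of "0::real"] by eventually_elim (simp add: QP)
    with L show ?thesis by (intro exI[of _ L] conjI Limsup_mono)
  next
    case False
    then have "Limsup (at_right 0) (\<lambda>\<epsilon>. P_functional \<Omega> \<Psi> E \<delta> \<epsilon> (f \<epsilon>)) = top" using top.not_eq_extremum by blast
    moreover obtain L where "Lp_family_converges 2 lebesgue L (\<lambda>x. - cut_field \<Omega> \<Psi> \<phi> x)"
      using recovery[OF _ f order_refl, of E] by blast
    ultimately show ?thesis by auto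
  qed
  show ?thesis
  \<comment> \<open>Infima are compared member by member: a pair of families is matched with its
    first component, and a single family with the pair formed by its recovery family.\<close>
  proof (intro conjI antisym Inf_mono; elim CollectE exE conjE; hypsubst)
    fix f L
    assume fL: "Lp_family_converges p (lebesgue_on \<Omega>) f \<phi>" "Lp_family_converges 2 lebesgue L (\<lambda>x. - cut_field \<Omega> \<Psi> \<phi> x)"
    show "\<exists>a\<in>{Liminf (at_right 0) (\<lambda>\<epsilon>. P_functional \<Omega> \<Psi> E \<delta> \<epsilon> (\<phi>\<^sub>\<epsilon> \<epsilon>)) | \<phi>\<^sub>\<epsilon>. Lp_family_converges p (lebesgue_on \<Omega>) \<phi>\<^sub>\<epsilon> \<phi>}.
       a \<le> Liminf (at_right 0) (\<lambda>\<epsilon>. Q_functional \<Omega> \<Psi> E \<delta> \<epsilon> (f \<epsilon>) (L \<epsilon>))"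
      using Liminf_mono[OF PQ[OF fL]] fL(1) by blast
    show "\<exists>a\<in>{Limsup (at_right 0) (\<lambda>\<epsilon>. P_functional \<Omega> \<Psi> E \<delta> \<epsilon> (\<phi>\<^sub>\<epsilon> \<epsilon>)) | \<phi>\<^sub>\<epsilon>. Lp_family_converges p (lebesgue_on \<Omega>) \<phi>\<^sub>\<epsilon> \<phi>}.
       a \<le> Limsup (at_right 0) (\<lambda>\<epsilon>. Q_functional \<Omega> \<Psi> E \<delta> \<epsilon> (f \<epsilon>) (L \<epsilon>))"
      using Limsup_mono[OF PQ[OF fL]] fL(1) by blast
  next
    fix f assume f: "Lp_family_converges p (lebesgue_on \<Omega>) f \<phi>"
    show "\<exists>a\<in>{Liminf (at_right 0) (\<lambda>\<epsilon>. Q_functional \<Omega> \<Psi> E \<delta> \<epsilon> (\<phi>\<^sub>\<epsilon> \<epsilon>) (L\<^sub>\<epsilon> \<epsilon>)) | \<phi>\<^sub>\<epsilon> L\<^sub>\<epsilon>.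
             Lp_family_converges p (lebesgue_on \<Omega>) \<phi>\<^sub>\<epsilon> \<phi> \<and> Lp_family_converges 2 lebesgue L\<^sub>\<epsilon> (\<lambda>x. - cut_field \<Omega> \<Psi> \<phi> x)}.
       a \<le> Liminf (at_right 0) (\<lambda>\<epsilon>. P_functional \<Omega> \<Psi> E \<delta> \<epsilon> (f \<epsilon>))"
      using liminf[OF f] f by blast
    show "\<exists>a\<in>{Limsup (at_right 0) (\<lambda>\<epsilon>. Q_functional \<Omega> \<Psi> E \<delta> \<epsilon> (\<phi>\<^sub>\<epsilon> \<epsilon>) (L\<^sub>\<epsilon> \<epsilon>)) | \<phi>\<^sub>\<epsilon> L\<^sub>\<epsilon>.
             Lp_family_converges p (lebesgue_on \<Omega>) \<phi>\<^sub>\<epsilon> \<phi> \<and> Lp_family_converges 2 lebesgue L\<^sub>\<epsilon> (\<lambda>x. - cut_field \<Omega> \<Psi> \<phi> x)}.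
       a \<le> Limsup (at_right 0) (\<lambda>\<epsilon>. P_functional \<Omega> \<Psi> E \<delta> \<epsilon> (f \<epsilon>))"
      using limsup[OF f] f by blast
  qed
qed

end
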